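(* Let $\mathcal{C}$ be a pseudo-triangulated category satisfying conditions (AC1) and (AC2), let $\mathcal{Z}\subseteq\mathcal{C}$ be an extension-closed subcategory, and let $\mathcal{D}\subseteq\mathcal{Z}$ be a full additive replete subcategory closed under finite direct summands in $\mathcal{Z}$. If $(\mathcal{C},\mathcal{Z},\mathcal{D})$ is Frobenius, then the quotient category $\mathcal{Z}/\mathcal{I}_{\mathcal{D}}$, equipped with the shift functor $S$ and the class $\triangle$ of distinguished triangles, is a triangulated category. In particular (case $\mathcal{D}=\mathcal{Z}$), if $\mathcal{Z}$ is Frobenius, then the stable category $\mathcal{Z}/\mathcal{I}$ is a triangulated category.
   Context: Conventions. Subcategories of $\mathcal{C}$ are full, additive and replete (closed under isomorphisms). Right triangulation. Let $\mathcal{C}$ be an additive category and $\Sigma\colon\mathcal{C}\to\mathcal{C}$ an additive endofunctor (not necessarily an equivalence). Consider the category of diagrams $A\xrightarrow{f}B\xrightarrow{g}C\xrightarrow{h}\Sigma A$; a morphism to $A'\xrightarrow{f'}B'\xrightarrow{g'}C'\xrightarrow{h'}\Sigma A'$ is a triple $(a,b,c)$ with $bf=f'a$, $cg=g'b$, $(\Sigma a)h=h'c$. A right triangulation $(\Sigma,\triangleright)$ consists of $\Sigma$ and a full isomorphism-closed subcategory $\triangleright$ of it such that: (RTR1) $0\to A\xrightarrow{\mathrm{id}}A\to\Sigma 0=0$ is in $\triangleright$ for all $A$, and every $f\colon A\to B$ is the first morphism of some object $A\xrightarrow{f}B\to C\to\Sigma A$ of $\triangleright$. (RTR2) If $A\xrightarrow{f}B\xrightarrow{g}C\xrightarrow{h}\Sigma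 A$ is in $\triangleright$, so is $B\xrightarrow{g}C\xrightarrow{h}\Sigma A\xrightarrow{-\Sigma f}\Sigma B$. (RTR3) Given two objects $A\xrightarrow{f}B\xrightarrow{g}C\xrightarrow{h}\Sigma A$ and $A'\xrightarrow{f'}B'\xrightarrow{g'}C'\xrightarrow{h'}\Sigma A'$ of $\triangleright$ and morphisms $a\colon A\to A'$, $b\colon B\to B'$ with $bf=f'a$, there is $c\colon C\to C'$ making $(a,b,c)$ a morphism. (RTR4) Given objects $A\xrightarrow{f}B\xrightarrow{g}C\xrightarrow{h}\Sigma A$, $A\xrightarrow{\ell}M\xrightarrow{m}B'\xrightarrow{n}\Sigma A$, $A'\xrightarrow{\ell'}M\xrightarrow{m'}B\xrightarrow{n'}\Sigma A'$ of $\triangleright$ with $m'\ell=f$, there are $g'\colon B'\to C$, $h'\colon C\to\Sigma A'$ with $h'g=n'$, $hg'=n$, $g'm=gm'$, $(\Sigma\ell)h+(\Sigma\ell')h'=0$ and $A'\xrightarrow{m\ell'}B'\xrightarrow{g'}C\xrightarrow{h'}\Sigma A'$ in $\triangleright$. Left triangulation $(\Omega,\triangleleft)$: the dual notion, for an additive endofunctor $\Omega$ and diagrams $\Omega C\xrightarrow{e}A\xrightarrow{f}B\xrightarrow{g}C$ (morphisms: triples $(a,b,c)$ with $ae=e'(\Omega c)$, $bf=f'a$, $cg=g'b$): (LTR1) $\Omega0=0\to A\xrightarrow{\mathrm{id}}A\to0$ is in $\triangleleft$, and every $g\colon B\to C$ is the last morphism of some object $\Omega C\to A\to B\xrightarrow{g}C$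 of $\triangleleft$. (LTR2) If $\Omega C\xrightarrow{e}A\xrightarrow{f}B\xrightarrow{g}C$ is in $\triangleleft$, so is $\Omega B\xrightarrow{-\Omega g}\Omega C\xrightarrow{e}A\xrightarrow{f}B$. (LTR3) Given two objects of $\triangleleft$ and $b,c$ with $cg=g'b$, there is $a$ making $(a,b,c)$ a morphism. (LTR4) Given $\Omega A\xrightarrow{h}C\xrightarrow{g}B\xrightarrow{f}A$, $\Omega A\xrightarrow{n}B'\xrightarrow{m}M\xrightarrow{\ell}A$, $\Omega A'\xrightarrow{n'}B\xrightarrow{m'}M\xrightarrow{\ell'}A'$ in $\triangleleft$ with $\ell m'=f$, there are $g'\colon C\to B'$, $h'\colon\Omega A'\to C$ with $gh'=n'$, $g'h=n$, $mg'=m'g$, $h(\Omega\ell)+h'(\Omega\ell')=0$ and $\Omega A'\xrightarrow{h'}C\xrightarrow{g'}B'\xrightarrow{\ell'm}A'$ in $\triangleleft$. A morphism is $\Sigma$-null if it factors through an object of the form $\Sigma X$; $f\colon A\to B$ is $\Sigma$-epic if every $b\colon B\to B'$ with $bf=0$ is $\Sigma$-null. Dually, a morphism is $\Omega$-null if it factors through some $\Omega X$; $f\colon A\to B$ is $\Omega$-monic if every $a\colon A'\to A$ with $fa=0$ is $\Omega$-null. Pseudo-triangulated category: an additive category $\mathcal{C}$ with a right triangulation $(\Sigma,\triangleright)$, a left triangulation $(\Omega,\triangleleft)$ and an adjunction isomorphism $\psi_{A,B}\colon\mathcal{C}(\Omega A,B)\cong\mathcal{C}(A,\Sigma B)$ natural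 in $A,B$, such that: (G1) if $g\colon B\to C$ is $\Sigma$-epic, then for any $\Omega C\xrightarrow{e}A\xrightarrow{f}B\xrightarrow{g}C$ in $\triangleleft$ and $A\xrightarrow{f}B\xrightarrow{g'}C'\xrightarrow{h'}\Sigma A$ in $\triangleright$ there is an isomorphism $c\colon C'\to C$ with $cg'=g$ and $-\psi(e)c=h'$; (G2) if $f\colon A\to B$ is $\Omega$-monic, then for any $A\xrightarrow{f}B\xrightarrow{g}C\xrightarrow{h}\Sigma A$ in $\triangleright$ and $\Omega C\xrightarrow{e'}A'\xrightarrow{f'}B\xrightarrow{g}C$ in $\triangleleft$ there is an isomorphism $a\colon A\to A'$ with $f'a=f$ and $-a\psi^{-1}(h)=e'$. Extension: a sequence $\Omega C\xrightarrow{e}A\xrightarrow{f}B\xrightarrow{g}C\xrightarrow{h}\Sigma A$ whose last four terms form an object of $\triangleright$, whose first four terms form an object of $\triangleleft$, and with $h=-\psi_{C,A}(e)$. A morphism of extensions is a triple $(a,b,c)$ with $bf=f'a$, $cg=g'b$, $(\Sigma a)h=h'c$ (the last is equivalent to $ae=e'(\Omega c)$). Conditions (AC1), (AC2): for all extensions $\Omega C\xrightarrow{e}A\xrightarrow{f}B\xrightarrow{g}C\xrightarrow{h}\Sigma A$ and $\Omega C'\xrightarrow{e'}A'\xrightarrow{f'}B'\xrightarrow{g'}C'\xrightarrow{h'}\Sigma A'$: (AC1) if $c\colon C\to C'$ satisfies $h'c=0$ and $cg=0$, then $c=g'c'$ for some $c'\colon C\to B'$; (AC2) if $a\colon A\to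 A'$ satisfies $f'a=0$ and $ae=0$, then $a=a'f$ for some $a'\colon B\to A'$. $\mathcal{Z}\subseteq\mathcal{C}$ is extension-closed if for each extension $\Omega Z\to X\to Y\to Z\to\Sigma X$, $X,Z\in\mathcal{Z}$ implies $Y\in\mathcal{Z}$. A conflation is an extension $\Omega Z\to X\xrightarrow{f}Y\xrightarrow{g}Z\to\Sigma X$ with $X,Y,Z\in\mathcal{Z}$; then $f$ is called an inflation and $g$ a deflation. Morphisms of conflations are morphisms of extensions. $\mathcal{D}\subseteq\mathcal{Z}$ is closed under finite direct summands in $\mathcal{Z}$ if $D\cong Z_1\oplus Z_2$ with $D\in\mathcal{D}$, $Z_1,Z_2\in\mathcal{Z}$ implies $Z_1,Z_2\in\mathcal{D}$. $\mathcal{I}_{\mathcal{D}}$: full subcategory of the $I\in\mathcal{D}$ such that $-\circ f\colon\mathcal{Z}(Y,I)\to\mathcal{Z}(X,I)$ is surjective for every inflation $f\colon X\to Y$. $\mathcal{P}_{\mathcal{D}}$: full subcategory of the $P\in\mathcal{D}$ such that $g\circ-\colon\mathcal{Z}(P,Y)\to\mathcal{Z}(P,Z)$ is surjective for every deflation $g\colon Y\to Z$. Put $\mathcal{I}=\mathcal{I}_{\mathcal{Z}}$. $(\mathcal{C},\mathcal{Z},\mathcal{D})$ has enough injectives if every $X\in\mathcal{Z}$ admits an inflation $X\to I$ with $I\in\mathcal{I}_{\mathcal{D}}$; it has enough projectives if every $Z\in\mathcal{Z}$ admits a deflation $P\to Z$ with $P\in\mathcal{P}_{\mathcal{D}}$;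 it is Frobenius if it has enough injectives and enough projectives and $\mathcal{I}_{\mathcal{D}}=\mathcal{P}_{\mathcal{D}}$. "$\mathcal{Z}$ is Frobenius" means $(\mathcal{C},\mathcal{Z},\mathcal{Z})$ is Frobenius. $\mathcal{Z}/\mathcal{I}_{\mathcal{D}}$ is the quotient of $\mathcal{Z}$ by the ideal of morphisms factoring through objects of $\mathcal{I}_{\mathcal{D}}$; $\underline{f}$ is the class of $f$. Shift $S$: for each $X\in\mathcal{Z}$ fix a conflation $\Omega S_X\xrightarrow{\delta_X}X\xrightarrow{\alpha_X}I_X\xrightarrow{\beta_X}S_X\xrightarrow{\gamma_X}\Sigma X$ with $I_X\in\mathcal{I}_{\mathcal{D}}$ and let $SX$ be $S_X$ in $\mathcal{Z}/\mathcal{I}_{\mathcal{D}}$. For $f\in\mathcal{Z}(X,Y)$ choose $I_f\colon I_X\to I_Y$ and $S_f\colon S_X\to S_Y$ such that $(f,I_f,S_f)$ is a morphism of conflations, and put $S\underline{f}=\underline{S_f}$ (well defined). Distinguished triangles: for a conflation $\Omega Z\xrightarrow{e}X\xrightarrow{f}Y\xrightarrow{g}Z\xrightarrow{h}\Sigma X$ and $p\in\mathcal{Z}(Y,I_X)$, $q\in\mathcal{Z}(Z,S_X)$ with $pf=\alpha_X$, $qg=\beta_Xp$, $\gamma_Xq=h$, the sequence $X\xrightarrow{\underline f}Y\xrightarrow{\underline g}Z\xrightarrow{\underline q}SX$ is a standard triangle. $\triangle$ is the class of sequences $X\to Y\to Z\to SX$ in $\mathcal{Z}/\mathcal{I}_{\mathcal{D}}$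 isomorphic to standard triangles. *)

theory Defs
  imports "HOL-Algebra.Group"
begin

section \<open>Additive categories\<close>

text \<open>Arrows carry their source and target, so hom-sets between different pairs of objects are
  disjoint. \<open>g \<cdot> f\<close> is the composite ``first \<open>f\<close>, then \<open>g\<close>''.\<close>

record ('o, 'm) cat =
  Obj :: "'o set"
  Arr :: "'m set"
  Src :: "'m \<Rightarrow> 'o"
  Tgt :: "'m \<Rightarrow> 'o"
  Idn :: "'o \<Rightarrow> 'm"
  Comp :: "'m \<Rightarrow> 'm \<Rightarrow> 'm" (infixr "\<cdot>\<index>" 70)
  Plus :: "'m \<Rightarrow> 'm \<Rightarrow> 'm" (infixl "\<boxplus>\<index>" 65)
  Zer :: "'o \<Rightarrow> 'o \<Rightarrow> 'm"

definition Hom :: "('o, 'm, 'b) cat_scheme \<Rightarrow> 'o \<Rightarrow> 'o \<Rightarrow> 'm set" where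
  "Hom C A B = {f \<in> Arr C. Src C f = A \<and> Tgt C f = B}"

definition hom_group :: "('o, 'm, 'b) cat_scheme \<Rightarrow> 'o \<Rightarrow> 'o \<Rightarrow> 'm monoid" where
  "hom_group C A B = \<lparr>carrier = Hom C A B, mult = Plus C, one = Zer C A B\<rparr>"

definition Neg :: "('o, 'm, 'b) cat_scheme \<Rightarrow> 'm \<Rightarrow> 'm" ("\<boxminus>\<index> _" [81] 80) where
  "Neg C f = m_inv (hom_group C (Src C f) (Tgt C f)) f"

definition iso_arrow :: "('o, 'm, 'b) cat_scheme \<Rightarrow> 'm \<Rightarrow> bool" where
  "iso_arrow C f \<longleftrightarrow> f \<in> Arr C \<and>
     (\<exists>g \<in> Hom C (Tgt C f) (Src C f).
        g \<cdot>\<^bsub>C\<^esub> f = Idn C (Src C f) \<and> f \<cdot>\<^bsub>C\<^esub> g = Idn C (Tgt C f))"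

definition isomorphic :: "('o, 'm, 'b) cat_scheme \<Rightarrow> 'o \<Rightarrow> 'o \<Rightarrow> bool" where
  "isomorphic C A B \<longleftrightarrow> (\<exists>f \<in> Hom C A B. iso_arrow C f)"

definition zero_object :: "('o, 'm, 'b) cat_scheme \<Rightarrow> 'o \<Rightarrow> bool" where
  "zero_object C N \<longleftrightarrow> N \<in> Obj C \<and>
     (\<forall>A \<in> Obj C. (\<exists>!f. f \<in> Hom C N A) \<and> (\<exists>!f. f \<in> Hom C A N))"

definition biproduct :: "('o, 'm, 'b) cat_scheme \<Rightarrow> 'o \<Rightarrow> 'o \<Rightarrow> 'o \<Rightarrow> bool" where
  "biproduct C A B P \<longleftrightarrow> A \<in> Obj C \<and> B \<in> Obj C \<and> P \<in> Obj C \<and>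
     (\<exists>i \<in> Hom C A P. \<exists>j \<in> Hom C B P. \<exists>p \<in> Hom C P A. \<exists>q \<in> Hom C P B.
        p \<cdot>\<^bsub>C\<^esub> i = Idn C A \<and> q \<cdot>\<^bsub>C\<^esub> j = Idn C B \<and>
        q \<cdot>\<^bsub>C\<^esub> i = Zer C A B \<and> p \<cdot>\<^bsub>C\<^esub> j = Zer C B A \<and>
        i \<cdot>\<^bsub>C\<^esub> p \<boxplus>\<^bsub>C\<^esub> j \<cdot>\<^bsub>C\<^esub> q = Idn C P)"

locale category =
  fixes C :: "('o, 'm, 'b) cat_scheme" (structure)
  assumes src_obj: "f \<in> Arr C \<Longrightarrow> Src C f \<in> Obj C"
    and tgt_obj: "f \<in> Arr C \<Longrightarrow> Tgt C f \<in> Obj C"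
    and id_hom: "A \<in> Obj C \<Longrightarrow> Idn C A \<in> Hom C A A"
    and comp_hom: "f \<in> Hom C A B \<Longrightarrow> g \<in> Hom C B D \<Longrightarrow> g \<cdot> f \<in> Hom C A D"
    and comp_id_right: "f \<in> Hom C A B \<Longrightarrow> f \<cdot> Idn C A = f"
    and comp_id_left: "f \<in> Hom C A B \<Longrightarrow> Idn C B \<cdot> f = f"
    and comp_assoc: "f \<in> Hom C A B \<Longrightarrow> g \<in> Hom C B D \<Longrightarrow> h \<in> Hom C D E \<Longrightarrow>
      (h \<cdot> g) \<cdot> f = h \<cdot> (g \<cdot> f)"

locale preadditive_category = category +
  assumes hom_comm_group: "A \<in> Obj C \<Longrightarrow> B \<in> Obj C \<Longrightarrow> comm_group (hom_group C A B)"
    and comp_plus_right: "f \<in> Hom C A B \<Longrightarrow> f' \<in> Hom C A B \<Longrightarrow> g \<in> Hom C B D \<Longrightarrow>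
      g \<cdot> (f \<boxplus> f') = g \<cdot> f \<boxplus> g \<cdot> f'"
    and comp_plus_left: "f \<in> Hom C A B \<Longrightarrow> g \<in> Hom C B D \<Longrightarrow> g' \<in> Hom C B D \<Longrightarrow>
      (g \<boxplus> g') \<cdot> f = g \<cdot> f \<boxplus> g' \<cdot> f"

locale additive_category = preadditive_category +
  assumes ex_zero_object: "\<exists>N. zero_object C N"
    and ex_biproduct: "A \<in> Obj C \<Longrightarrow> B \<in> Obj C \<Longrightarrow> \<exists>P. biproduct C A B P"

section \<open>Endofunctors\<close>

record ('o, 'm) endofun =
  FOb :: "'o \<Rightarrow> 'o"
  FAr :: "'m \<Rightarrow> 'm"

definition endofunctor :: "('o, 'm, 'b) cat_scheme \<Rightarrow> ('o, 'm) endofun \<Rightarrow> bool" where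
  "endofunctor C F \<longleftrightarrow>
     (\<forall>A \<in> Obj C. FOb F A \<in> Obj C) \<and>
     (\<forall>f \<in> Arr C. FAr F f \<in> Hom C (FOb F (Src C f)) (FOb F (Tgt C f))) \<and>
     (\<forall>A \<in> Obj C. FAr F (Idn C A) = Idn C (FOb F A)) \<and>
     (\<forall>f \<in> Arr C. \<forall>g \<in> Arr C. Src C g = Tgt C f \<longrightarrow>
        FAr F (g \<cdot>\<^bsub>C\<^esub> f) = FAr F g \<cdot>\<^bsub>C\<^esub> FAr F f)"

definition additive_endofunctor :: "('o, 'm, 'b) cat_scheme \<Rightarrow> ('o, 'm) endofun \<Rightarrow> bool" where
  "additive_endofunctor C F \<longleftrightarrow> endofunctor C F \<and>
     (\<forall>A \<in> Obj C. \<forall>B \<in> Obj C. \<forall>f \<in> Hom C A B. \<forall>g \<in> Hom C A B.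
        FAr F (f \<boxplus>\<^bsub>C\<^esub> g) = FAr F f \<boxplus>\<^bsub>C\<^esub> FAr F g)"

definition id_fun :: "('o, 'm) endofun" where
  "id_fun = \<lparr>FOb = (\<lambda>A. A), FAr = (\<lambda>f. f)\<rparr>"

definition comp_fun :: "('o, 'm) endofun \<Rightarrow> ('o, 'm) endofun \<Rightarrow> ('o, 'm) endofun" where
  "comp_fun F G = \<lparr>FOb = FOb F \<circ> FOb G, FAr = FAr F \<circ> FAr G\<rparr>"

definition naturally_isomorphic ::
    "('o, 'm, 'b) cat_scheme \<Rightarrow> ('o, 'm) endofun \<Rightarrow> ('o, 'm) endofun \<Rightarrow> bool" where
  "naturally_isomorphic C F G \<longleftrightarrow>
     (\<exists>\<eta>. (\<forall>A \<in> Obj C. \<eta> A \<in> Hom C (FOb F A) (FOb G A) \<and> iso_arrow C (\<eta> A)) \<and>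
          (\<forall>f \<in> Arr C. \<eta> (Tgt C f) \<cdot>\<^bsub>C\<^esub> FAr F f = FAr G f \<cdot>\<^bsub>C\<^esub> \<eta> (Src C f)))"

definition autoequivalence :: "('o, 'm, 'b) cat_scheme \<Rightarrow> ('o, 'm) endofun \<Rightarrow> bool" where
  "autoequivalence C F \<longleftrightarrow> endofunctor C F \<and>
     (\<exists>G. endofunctor C G \<and> naturally_isomorphic C (comp_fun F G) id_fun \<and>
          naturally_isomorphic C (comp_fun G F) id_fun)"

section \<open>Right and left triangulations\<close>

text \<open>A diagram \<open>A \<rightarrow> B \<rightarrow> C \<rightarrow> \<Sigma>A\<close> is the triple \<open>(f, g, h)\<close> of its arrows, and a diagram
  \<open>\<Omega>C \<rightarrow> A \<rightarrow> B \<rightarrow> C\<close> is the triple \<open>(e, f, g)\<close>; the objects are recovered as sources and targets,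
  except that the argument of \<open>\<Sigma>\<close> (resp. \<open>\<Omega>\<close>) is the source of the first (resp. the target of
  the last) arrow.\<close>

definition rdiagram :: "('o, 'm, 'b) cat_scheme \<Rightarrow> ('o, 'm) endofun \<Rightarrow> 'm \<Rightarrow> 'm \<Rightarrow> 'm \<Rightarrow> bool" where
  "rdiagram C F f g h \<longleftrightarrow> f \<in> Arr C \<and> g \<in> Arr C \<and> h \<in> Arr C \<and>
     Src C g = Tgt C f \<and> Src C h = Tgt C g \<and> Tgt C h = FOb F (Src C f)"

definition rmorphism :: "('o, 'm, 'b) cat_scheme \<Rightarrow> ('o, 'm) endofun \<Rightarrow>
    'm \<times> 'm \<times> 'm \<Rightarrow> 'm \<times> 'm \<times> 'm \<Rightarrow> 'm \<times> 'm \<times> 'm \<Rightarrow> bool" where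
  "rmorphism C F = (\<lambda>(a, b, c) (f, g, h) (f', g', h').
     a \<in> Hom C (Src C f) (Src C f') \<and> b \<in> Hom C (Tgt C f) (Tgt C f') \<and>
     c \<in> Hom C (Tgt C g) (Tgt C g') \<and>
     b \<cdot>\<^bsub>C\<^esub> f = f' \<cdot>\<^bsub>C\<^esub> a \<and> c \<cdot>\<^bsub>C\<^esub> g = g' \<cdot>\<^bsub>C\<^esub> b \<and> FAr F a \<cdot>\<^bsub>C\<^esub> h = h' \<cdot>\<^bsub>C\<^esub> c)"

definition risomorphic :: "('o, 'm, 'b) cat_scheme \<Rightarrow> ('o, 'm) endofun \<Rightarrow>
    'm \<times> 'm \<times> 'm \<Rightarrow> 'm \<times> 'm \<times> 'm \<Rightarrow> bool" where
  "risomorphic C F t t' \<longleftrightarrow> (\<exists>a b c. rmorphism C F (a, b, c) t t' \<and>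
     iso_arrow C a \<and> iso_arrow C b \<and> iso_arrow C c)"

definition ldiagram :: "('o, 'm, 'b) cat_scheme \<Rightarrow> ('o, 'm) endofun \<Rightarrow> 'm \<Rightarrow> 'm \<Rightarrow> 'm \<Rightarrow> bool" where
  "ldiagram C F e f g \<longleftrightarrow> e \<in> Arr C \<and> f \<in> Arr C \<and> g \<in> Arr C \<and>
     Src C f = Tgt C e \<and> Src C g = Tgt C f \<and> Src C e = FOb F (Tgt C g)"

definition lmorphism :: "('o, 'm, 'b) cat_scheme \<Rightarrow> ('o, 'm) endofun \<Rightarrow>
    'm \<times> 'm \<times> 'm \<Rightarrow> 'm \<times> 'm \<times> 'm \<Rightarrow> 'm \<times> 'm \<times> 'm \<Rightarrow> bool" where
  "lmorphism C F = (\<lambda>(a, b, c) (e, f, g) (e', f', g').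
     a \<in> Hom C (Src C f) (Src C f') \<and> b \<in> Hom C (Tgt C f) (Tgt C f') \<and>
     c \<in> Hom C (Tgt C g) (Tgt C g') \<and>
     a \<cdot>\<^bsub>C\<^esub> e = e' \<cdot>\<^bsub>C\<^esub> FAr F c \<and> b \<cdot>\<^bsub>C\<^esub> f = f' \<cdot>\<^bsub>C\<^esub> a \<and> c \<cdot>\<^bsub>C\<^esub> g = g' \<cdot>\<^bsub>C\<^esub> b)"

definition lisomorphic :: "('o, 'm, 'b) cat_scheme \<Rightarrow> ('o, 'm) endofun \<Rightarrow>
    'm \<times> 'm \<times> 'm \<Rightarrow> 'm \<times> 'm \<times> 'm \<Rightarrow> bool" where
  "lisomorphic C F t t' \<longleftrightarrow> (\<exists>a b c. lmorphism C F (a, b, c) t t' \<and>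
     iso_arrow C a \<and> iso_arrow C b \<and> iso_arrow C c)"

locale right_triangulation = additive_category C
  for C :: "('o, 'm, 'b) cat_scheme" (structure) +
  fixes \<Sigma> :: "('o, 'm) endofun" and RT :: "('m \<times> 'm \<times> 'm) set"
  assumes Sigma_additive: "additive_endofunctor C \<Sigma>"
    and RT_diagram: "(f, g, h) \<in> RT \<Longrightarrow> rdiagram C \<Sigma> f g h"
    and RT_iso_closed: "(f, g, h) \<in> RT \<Longrightarrow> rdiagram C \<Sigma> f' g' h' \<Longrightarrow>
      risomorphic C \<Sigma> (f, g, h) (f', g', h') \<Longrightarrow> (f', g', h') \<in> RT"
    and RTR1_id: "zero_object C N \<Longrightarrow> A \<in> Obj C \<Longrightarrow>
      (Zer C N A, Idn C A, Zer C A (FOb \<Sigma> N)) \<in> RT"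
    and RTR1_ex: "f \<in> Arr C \<Longrightarrow> \<exists>g h. (f, g, h) \<in> RT"
    and RTR2: "(f, g, h) \<in> RT \<Longrightarrow> (g, h, \<boxminus> FAr \<Sigma> f) \<in> RT"
    and RTR3: "(f, g, h) \<in> RT \<Longrightarrow> (f', g', h') \<in> RT \<Longrightarrow>
      a \<in> Hom C (Src C f) (Src C f') \<Longrightarrow> b \<in> Hom C (Tgt C f) (Tgt C f') \<Longrightarrow>
      b \<cdot> f = f' \<cdot> a \<Longrightarrow> \<exists>c. rmorphism C \<Sigma> (a, b, c) (f, g, h) (f', g', h')"
    and RTR4: "(f, g, h) \<in> RT \<Longrightarrow> (l, m, n) \<in> RT \<Longrightarrow> (l', m', n') \<in> RT \<Longrightarrow>
      Src C l = Src C f \<Longrightarrow> Tgt C l' = Tgt C l \<Longrightarrow> Tgt C m' = Tgt C f \<Longrightarrow> m' \<cdot> l = f \<Longrightarrow>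
      \<exists>g' \<in> Hom C (Tgt C m) (Tgt C g). \<exists>h' \<in> Hom C (Tgt C g) (FOb \<Sigma> (Src C l')).
        h' \<cdot> g = n' \<and> h \<cdot> g' = n \<and> g' \<cdot> m = g \<cdot> m' \<and>
        FAr \<Sigma> l \<cdot> h \<boxplus> FAr \<Sigma> l' \<cdot> h' = Zer C (Tgt C g) (FOb \<Sigma> (Tgt C l)) \<and>
        (m \<cdot> l', g', h') \<in> RT"

locale left_triangulation = additive_category C
  for C :: "('o, 'm, 'b) cat_scheme" (structure) +
  fixes \<Omega> :: "('o, 'm) endofun" and LT :: "('m \<times> 'm \<times> 'm) set"
  assumes Omega_additive: "additive_endofunctor C \<Omega>"
    and LT_diagram: "(e, f, g) \<in> LT \<Longrightarrow> ldiagram C \<Omega> e f g"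
    and LT_iso_closed: "(e, f, g) \<in> LT \<Longrightarrow> ldiagram C \<Omega> e' f' g' \<Longrightarrow>
      lisomorphic C \<Omega> (e, f, g) (e', f', g') \<Longrightarrow> (e', f', g') \<in> LT"
    and LTR1_id: "zero_object C N \<Longrightarrow> A \<in> Obj C \<Longrightarrow>
      (Zer C (FOb \<Omega> N) A, Idn C A, Zer C A N) \<in> LT"
    and LTR1_ex: "g \<in> Arr C \<Longrightarrow> \<exists>e f. (e, f, g) \<in> LT"
    and LTR2: "(e, f, g) \<in> LT \<Longrightarrow> (\<boxminus> FAr \<Omega> g, e, f) \<in> LT"
    and LTR3: "(e, f, g) \<in> LT \<Longrightarrow> (e', f', g') \<in> LT \<Longrightarrow>
      b \<in> Hom C (Src C g) (Src C g') \<Longrightarrow> c \<in> Hom C (Tgt C g) (Tgt C g') \<Longrightarrow>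
      c \<cdot> g = g' \<cdot> b \<Longrightarrow> \<exists>a. lmorphism C \<Omega> (a, b, c) (e, f, g) (e', f', g')"
    and LTR4: "(h, g, f) \<in> LT \<Longrightarrow> (n, m, l) \<in> LT \<Longrightarrow> (n', m', l') \<in> LT \<Longrightarrow>
      Tgt C l = Tgt C f \<Longrightarrow> Src C l' = Src C l \<Longrightarrow> Src C m' = Src C f \<Longrightarrow> l \<cdot> m' = f \<Longrightarrow>
      \<exists>g' \<in> Hom C (Src C g) (Src C m). \<exists>h' \<in> Hom C (FOb \<Omega> (Tgt C l')) (Src C g).
        g \<cdot> h' = n' \<and> g' \<cdot> h = n \<and> m \<cdot> g' = m' \<cdot> g \<and>
        h \<cdot> FAr \<Omega> l \<boxplus> h' \<cdot> FAr \<Omega> l' = Zer C (FOb \<Omega> (Src C l)) (Src C g) \<and>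
        (h', g', l' \<cdot> m) \<in> LT"

section \<open>Pseudo-triangulated categories\<close>

definition factors_through :: "('o, 'm, 'b) cat_scheme \<Rightarrow> 'o set \<Rightarrow> 'm \<Rightarrow> bool" where
  "factors_through C J f \<longleftrightarrow> f \<in> Arr C \<and>
     (\<exists>X \<in> J. \<exists>u \<in> Hom C (Src C f) X. \<exists>v \<in> Hom C X (Tgt C f). f = v \<cdot>\<^bsub>C\<^esub> u)"

text \<open>For \<open>F = \<Sigma>\<close> (resp. \<open>F = \<Omega>\<close>) this is the notion of a \<open>\<Sigma>\<close>-null (resp. \<open>\<Omega>\<close>-null) morphism.\<close>

definition null_arrow :: "('o, 'm, 'b) cat_scheme \<Rightarrow> ('o, 'm) endofun \<Rightarrow> 'm \<Rightarrow> bool" where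
  "null_arrow C F f \<longleftrightarrow> factors_through C (FOb F ` Obj C) f"

definition Sigma_epic :: "('o, 'm, 'b) cat_scheme \<Rightarrow> ('o, 'm) endofun \<Rightarrow> 'm \<Rightarrow> bool" where
  "Sigma_epic C \<Sigma> f \<longleftrightarrow> f \<in> Arr C \<and>
     (\<forall>B' \<in> Obj C. \<forall>b \<in> Hom C (Tgt C f) B'.
        b \<cdot>\<^bsub>C\<^esub> f = Zer C (Src C f) B' \<longrightarrow> null_arrow C \<Sigma> b)"

definition Omega_monic :: "('o, 'm, 'b) cat_scheme \<Rightarrow> ('o, 'm) endofun \<Rightarrow> 'm \<Rightarrow> bool" where
  "Omega_monic C \<Omega> f \<longleftrightarrow> f \<in> Arr C \<and>
     (\<forall>A' \<in> Obj C. \<forall>a \<in> Hom C A' (Src C f).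
        f \<cdot>\<^bsub>C\<^esub> a = Zer C A' (Tgt C f) \<longrightarrow> null_arrow C \<Omega> a)"

text \<open>\<open>Psi A B\<close> is the adjunction bijection from \<open>Hom (\<Omega>A) B\<close> to \<open>Hom A (\<Sigma>B)\<close>; note that
  \<open>\<Omega>\<close> is the left adjoint.\<close>

record ('o, 'm) pt_cat = "('o, 'm) cat" +
  Sig :: "('o, 'm) endofun"
  RTri :: "('m \<times> 'm \<times> 'm) set"
  Ome :: "('o, 'm) endofun"
  LTri :: "('m \<times> 'm \<times> 'm) set"
  Psi :: "'o \<Rightarrow> 'o \<Rightarrow> 'm \<Rightarrow> 'm"

definition Psi_inv :: "('o, 'm, 'b) pt_cat_scheme \<Rightarrow> 'o \<Rightarrow> 'o \<Rightarrow> 'm \<Rightarrow> 'm" where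
  "Psi_inv C A B = inv_into (Hom C (FOb (Ome C) A) B) (Psi C A B)"

locale pseudo_triangulated =
  right_triangulation C "Sig C" "RTri C" + left_triangulation C "Ome C" "LTri C"
  for C :: "('o, 'm, 'b) pt_cat_scheme" (structure) +
  assumes Psi_bij: "A \<in> Obj C \<Longrightarrow> B \<in> Obj C \<Longrightarrow>
      bij_betw (Psi C A B) (Hom C (FOb (Ome C) A) B) (Hom C A (FOb (Sig C) B))"
    and Psi_natural: "A \<in> Obj C \<Longrightarrow> B \<in> Obj C \<Longrightarrow> A' \<in> Obj C \<Longrightarrow> B' \<in> Obj C \<Longrightarrow>
      x \<in> Hom C (FOb (Ome C) A) B \<Longrightarrow> a \<in> Hom C A' A \<Longrightarrow> b \<in> Hom C B B' \<Longrightarrow>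
      Psi C A' B' (b \<cdot> x \<cdot> FAr (Ome C) a) = FAr (Sig C) b \<cdot> Psi C A B x \<cdot> a"
    and G1: "Sigma_epic C (Sig C) g \<Longrightarrow> (e, f, g) \<in> LTri C \<Longrightarrow> (f, g', h') \<in> RTri C \<Longrightarrow>
      \<exists>c \<in> Hom C (Tgt C g') (Tgt C g). iso_arrow C c \<and> c \<cdot> g' = g \<and>
        (\<boxminus> Psi C (Tgt C g) (Src C f) e) \<cdot> c = h'"
    and G2: "Omega_monic C (Ome C) f \<Longrightarrow> (f, g, h) \<in> RTri C \<Longrightarrow> (e', f', g) \<in> LTri C \<Longrightarrow>
      \<exists>a \<in> Hom C (Src C f) (Src C f'). iso_arrow C a \<and> f' \<cdot> a = f \<and>
        \<boxminus> (a \<cdot> Psi_inv C (Tgt C g) (Src C f) h) = e'"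

text \<open>\<open>extension C e f g h\<close>: the arrows \<open>e, f, g, h\<close> form an extension
  \<open>\<Omega>C \<rightarrow> A \<rightarrow> B \<rightarrow> C \<rightarrow> \<Sigma>A\<close>.\<close>

definition extension :: "('o, 'm, 'b) pt_cat_scheme \<Rightarrow> 'm \<Rightarrow> 'm \<Rightarrow> 'm \<Rightarrow> 'm \<Rightarrow> bool" where
  "extension C e f g h \<longleftrightarrow> (f, g, h) \<in> RTri C \<and> (e, f, g) \<in> LTri C \<and>
     h = \<boxminus>\<^bsub>C\<^esub> Psi C (Tgt C g) (Src C f) e"

definition AC1 :: "('o, 'm, 'b) pt_cat_scheme \<Rightarrow> bool" where
  "AC1 C \<longleftrightarrow> (\<forall>e f g h e' f' g' h' c.
     extension C e f g h \<and> extension C e' f' g' h' \<and> c \<in> Hom C (Tgt C g) (Tgt C g') \<and>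
     h' \<cdot>\<^bsub>C\<^esub> c = Zer C (Tgt C g) (Tgt C h') \<and> c \<cdot>\<^bsub>C\<^esub> g = Zer C (Src C g) (Tgt C g') \<longrightarrow>
     (\<exists>c' \<in> Hom C (Tgt C g) (Src C g'). c = g' \<cdot>\<^bsub>C\<^esub> c'))"

definition AC2 :: "('o, 'm, 'b) pt_cat_scheme \<Rightarrow> bool" where
  "AC2 C \<longleftrightarrow> (\<forall>e f g h e' f' g' h' a.
     extension C e f g h \<and> extension C e' f' g' h' \<and> a \<in> Hom C (Src C f) (Src C f') \<and>
     f' \<cdot>\<^bsub>C\<^esub> a = Zer C (Src C f) (Tgt C f') \<and> a \<cdot>\<^bsub>C\<^esub> e = Zer C (Src C e) (Src C f') \<longrightarrow>
     (\<exists>a' \<in> Hom C (Tgt C f) (Src C f'). a = a' \<cdot>\<^bsub>C\<^esub> f))"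

section \<open>Subcategories, conflations, injectives and projectives\<close>

text \<open>Full subcategories are given by their sets of objects.\<close>

definition additive_subcategory :: "('o, 'm, 'b) cat_scheme \<Rightarrow> 'o set \<Rightarrow> bool" where
  "additive_subcategory C Z \<longleftrightarrow> Z \<subseteq> Obj C \<and>
     (\<exists>N \<in> Z. zero_object C N) \<and>
     (\<forall>A \<in> Z. \<forall>B \<in> Z. \<exists>P \<in> Z. biproduct C A B P) \<and>
     (\<forall>A \<in> Z. \<forall>B \<in> Obj C. isomorphic C A B \<longrightarrow> B \<in> Z)"

definition summand_closed :: "('o, 'm, 'b) cat_scheme \<Rightarrow> 'o set \<Rightarrow> 'o set \<Rightarrow> bool" where
  "summand_closed C Z D \<longleftrightarrow>
     (\<forall>X \<in> D. \<forall>Z1 \<in> Z. \<forall>Z2 \<in> Z. \<forall>P.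
        biproduct C Z1 Z2 P \<and> isomorphic C X P \<longrightarrow> Z1 \<in> D \<and> Z2 \<in> D)"

definition extension_closed :: "('o, 'm, 'b) pt_cat_scheme \<Rightarrow> 'o set \<Rightarrow> bool" where
  "extension_closed C Z \<longleftrightarrow> (\<forall>e f g h.
     extension C e f g h \<and> Src C f \<in> Z \<and> Tgt C g \<in> Z \<longrightarrow> Tgt C f \<in> Z)"

definition conflation :: "('o, 'm, 'b) pt_cat_scheme \<Rightarrow> 'o set \<Rightarrow> 'm \<Rightarrow> 'm \<Rightarrow> 'm \<Rightarrow> 'm \<Rightarrow> bool" where
  "conflation C Z e f g h \<longleftrightarrow>
     extension C e f g h \<and> Src C f \<in> Z \<and> Tgt C f \<in> Z \<and> Tgt C g \<in> Z"

definition inflation :: "('o, 'm, 'b) pt_cat_scheme \<Rightarrow> 'o set \<Rightarrow> 'm \<Rightarrow> bool" where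
  "inflation C Z f \<longleftrightarrow> (\<exists>e g h. conflation C Z e f g h)"

definition deflation :: "('o, 'm, 'b) pt_cat_scheme \<Rightarrow> 'o set \<Rightarrow> 'm \<Rightarrow> bool" where
  "deflation C Z g \<longleftrightarrow> (\<exists>e f h. conflation C Z e f g h)"

definition injectives :: "('o, 'm, 'b) pt_cat_scheme \<Rightarrow> 'o set \<Rightarrow> 'o set \<Rightarrow> 'o set" where
  "injectives C Z D = {I \<in> D. \<forall>f. inflation C Z f \<longrightarrow>
     (\<lambda>y. y \<cdot>\<^bsub>C\<^esub> f) ` Hom C (Tgt C f) I = Hom C (Src C f) I}"

definition projectives :: "('o, 'm, 'b) pt_cat_scheme \<Rightarrow> 'o set \<Rightarrow> 'o set \<Rightarrow> 'o set" where
  "projectives C Z D = {P \<in> D. \<forall>g. deflation C Z g \<longrightarrow>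
     (\<lambda>y. g \<cdot>\<^bsub>C\<^esub> y) ` Hom C P (Src C g) = Hom C P (Tgt C g)}"

definition enough_injectives :: "('o, 'm, 'b) pt_cat_scheme \<Rightarrow> 'o set \<Rightarrow> 'o set \<Rightarrow> bool" where
  "enough_injectives C Z D \<longleftrightarrow>
     (\<forall>X \<in> Z. \<exists>f. inflation C Z f \<and> Src C f = X \<and> Tgt C f \<in> injectives C Z D)"

definition enough_projectives :: "('o, 'm, 'b) pt_cat_scheme \<Rightarrow> 'o set \<Rightarrow> 'o set \<Rightarrow> bool" where
  "enough_projectives C Z D \<longleftrightarrow>
     (\<forall>X \<in> Z. \<exists>g. deflation C Z g \<and> Tgt C g = X \<and> Src C g \<in> projectives C Z D)"

definition frobenius :: "('o, 'm, 'b) pt_cat_scheme \<Rightarrow> 'o set \<Rightarrow> 'o set \<Rightarrow> bool" where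
  "frobenius C Z D \<longleftrightarrow> enough_injectives C Z D \<and> enough_projectives C Z D \<and>
     injectives C Z D = projectives C Z D"

section \<open>The quotient category, its shift functor and its distinguished triangles\<close>

definition arrow_class :: "('o, 'm, 'b) cat_scheme \<Rightarrow> 'o set \<Rightarrow> 'm \<Rightarrow> 'm set" where
  "arrow_class C J f =
     {f' \<in> Hom C (Src C f) (Tgt C f). factors_through C J (f' \<boxplus>\<^bsub>C\<^esub> \<boxminus>\<^bsub>C\<^esub> f)}"

text \<open>The quotient of the full subcategory \<open>Z\<close> by the arrows factoring through objects of \<open>J\<close>.
  Operations on classes are unions over all representatives; such a union is again a single class
  exactly if the operation does not depend on the representatives.\<close>

definition quotient_category ::
    "('o, 'm, 'b) cat_scheme \<Rightarrow> 'o set \<Rightarrow> 'o set \<Rightarrow> ('o, 'm set) cat" where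
  "quotient_category C Z J =
     \<lparr>Obj = Z,
      Arr = arrow_class C J ` {f \<in> Arr C. Src C f \<in> Z \<and> Tgt C f \<in> Z},
      Src = (\<lambda>F. the_elem (Src C ` F)),
      Tgt = (\<lambda>F. the_elem (Tgt C ` F)),
      Idn = (\<lambda>A. arrow_class C J (Idn C A)),
      Comp = (\<lambda>G F. \<Union>g \<in> G. \<Union>f \<in> F. arrow_class C J (g \<cdot>\<^bsub>C\<^esub> f)),
      Plus = (\<lambda>F G. \<Union>f \<in> F. \<Union>g \<in> G. arrow_class C J (f \<boxplus>\<^bsub>C\<^esub> g)),
      Zer = (\<lambda>A B. arrow_class C J (Zer C A B))\<rparr>"

text \<open>The choices entering the construction of the shift: the conflations
  \<open>\<Omega>S\<^sub>X \<rightarrow> X \<rightarrow> I\<^sub>X \<rightarrow> S\<^sub>X \<rightarrow> \<Sigma>X\<close> with arrows \<open>sh_delta X\<close>, \<open>sh_alpha X\<close>, \<open>sh_beta X\<close>,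
  \<open>sh_gamma X\<close>, and the lifts \<open>I\<^sub>f = sh_I f\<close> and \<open>S\<^sub>f = sh_S f\<close>.\<close>

record ('o, 'm) shift_data =
  sh_delta :: "'o \<Rightarrow> 'm"
  sh_alpha :: "'o \<Rightarrow> 'm"
  sh_beta :: "'o \<Rightarrow> 'm"
  sh_gamma :: "'o \<Rightarrow> 'm"
  sh_I :: "'m \<Rightarrow> 'm"
  sh_S :: "'m \<Rightarrow> 'm"

definition shift_choice ::
    "('o, 'm, 'b) pt_cat_scheme \<Rightarrow> 'o set \<Rightarrow> 'o set \<Rightarrow> ('o, 'm) shift_data \<Rightarrow> bool" where
  "shift_choice C Z D s \<longleftrightarrow>
     (\<forall>X \<in> Z. conflation C Z (sh_delta s X) (sh_alpha s X) (sh_beta s X) (sh_gamma s X) \<and>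
        Src C (sh_alpha s X) = X \<and> Tgt C (sh_alpha s X) \<in> injectives C Z D) \<and>
     (\<forall>X \<in> Z. \<forall>Y \<in> Z. \<forall>f \<in> Hom C X Y.
        rmorphism C (Sig C) (f, sh_I s f, sh_S s f)
          (sh_alpha s X, sh_beta s X, sh_gamma s X)
          (sh_alpha s Y, sh_beta s Y, sh_gamma s Y))"

definition shift_functor ::
    "('o, 'm, 'b) pt_cat_scheme \<Rightarrow> 'o set \<Rightarrow> 'o set \<Rightarrow> ('o, 'm) shift_data \<Rightarrow> ('o, 'm set) endofun" where
  "shift_functor C Z D s =
     \<lparr>FOb = (\<lambda>X. Tgt C (sh_beta s X)),
      FAr = (\<lambda>F. \<Union>f \<in> F. arrow_class C (injectives C Z D) (sh_S s f))\<rparr>"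

definition standard_triangles ::
    "('o, 'm, 'b) pt_cat_scheme \<Rightarrow> 'o set \<Rightarrow> 'o set \<Rightarrow> ('o, 'm) shift_data \<Rightarrow>
      ('m set \<times> 'm set \<times> 'm set) set" where
  "standard_triangles C Z D s =
     {(arrow_class C (injectives C Z D) f, arrow_class C (injectives C Z D) g,
       arrow_class C (injectives C Z D) q) | e f g h p q X.
       conflation C Z e f g h \<and> X = Src C f \<and>
       p \<in> Hom C (Tgt C f) (Tgt C (sh_alpha s X)) \<and>
       q \<in> Hom C (Tgt C g) (Tgt C (sh_beta s X)) \<and>
       p \<cdot>\<^bsub>C\<^esub> f = sh_alpha s X \<and> q \<cdot>\<^bsub>C\<^esub> g = sh_beta s X \<cdot>\<^bsub>C\<^esub> p \<and>
       sh_gamma s X \<cdot>\<^bsub>C\<^esub> q = h}"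

definition distinguished_triangles ::
    "('o, 'm, 'b) pt_cat_scheme \<Rightarrow> 'o set \<Rightarrow> 'o set \<Rightarrow> ('o, 'm) shift_data \<Rightarrow>
      ('m set \<times> 'm set \<times> 'm set) set" where
  "distinguished_triangles C Z D s =
     {(u, v, w). rdiagram (quotient_category C Z (injectives C Z D)) (shift_functor C Z D s) u v w \<and>
       (\<exists>t \<in> standard_triangles C Z D s.
          risomorphic (quotient_category C Z (injectives C Z D)) (shift_functor C Z D s) (u, v, w) t)}"

section \<open>Triangulated categories\<close>

locale triangulated_category = additive_category C
  for C :: "('o, 'm, 'b) cat_scheme" (structure) +
  fixes S :: "('o, 'm) endofun" and T :: "('m \<times> 'm \<times> 'm) set"
  assumes shift_additive: "additive_endofunctor C S"
    and shift_equivalence: "autoequivalence C S"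
    and T_diagram: "(f, g, h) \<in> T \<Longrightarrow> rdiagram C S f g h"
    and TR1_iso: "(f, g, h) \<in> T \<Longrightarrow> rdiagram C S f' g' h' \<Longrightarrow>
      risomorphic C S (f, g, h) (f', g', h') \<Longrightarrow> (f', g', h') \<in> T"
    and TR1_id: "zero_object C N \<Longrightarrow> A \<in> Obj C \<Longrightarrow>
      (Idn C A, Zer C A N, Zer C N (FOb S A)) \<in> T"
    and TR1_ex: "f \<in> Arr C \<Longrightarrow> \<exists>g h. (f, g, h) \<in> T"
    and TR2: "rdiagram C S f g h \<Longrightarrow> (f, g, h) \<in> T \<longleftrightarrow> (g, h, \<boxminus> FAr S f) \<in> T"
    and TR3: "(f, g, h) \<in> T \<Longrightarrow> (f', g', h') \<in> T \<Longrightarrow>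
      a \<in> Hom C (Src C f) (Src C f') \<Longrightarrow> b \<in> Hom C (Tgt C f) (Tgt C f') \<Longrightarrow>
      b \<cdot> f = f' \<cdot> a \<Longrightarrow> \<exists>c. rmorphism C S (a, b, c) (f, g, h) (f', g', h')"
    and TR4: "(f, f1, f2) \<in> T \<Longrightarrow> (g, g1, g2) \<in> T \<Longrightarrow> Src C g = Tgt C f \<Longrightarrow>
      (g \<cdot> f, k1, k2) \<in> T \<Longrightarrow>
      \<exists>u \<in> Hom C (Tgt C f1) (Tgt C k1). \<exists>v \<in> Hom C (Tgt C k1) (Tgt C g1).
        (u, v, FAr S f1 \<cdot> g2) \<in> T \<and>
        u \<cdot> f1 = k1 \<cdot> g \<and> k2 \<cdot> u = f2 \<and> v \<cdot> k1 = g1 \<and> g2 \<cdot> v = FAr S f \<cdot> k2"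

end

theory Submission
  imports Defs
begin

text \<open>The octahedral axiom (RTR4), applied to extensions, yields extensions again, because the first
  arrow of the new triangle is \<open>\<Omega>\<close>-monic. It replaces push-outs: for a conflation
  \<open>X \<rightarrow> I\<^sub>X \<rightarrow> S\<^sub>X\<close> and \<open>f : X \<rightarrow> Y\<close>, the arrow \<open>X \<rightarrow> Y \<oplus> I\<^sub>X\<close> is an inflation, which gives cones in
  the quotient, and for a conflation \<open>X \<rightarrow> Y \<rightarrow> W\<close> it produces a conflation
  \<open>Y \<rightarrow> W \<oplus> I\<^sub>X \<rightarrow> S\<^sub>X\<close>, which rotates triangles. By (AC1), a morphism of conflations into one with
  injective middle term is determined by its first component up to arrows through injectives, so the
  quotient is right triangulated. By (AC2) and enough projectives the shift is an equivalence, and a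
  right triangulation whose suspension is an equivalence is a triangulation.\<close>

text \<open>Two obstacles shape the verification of (RTR4) in the quotient. First, representatives
  satisfy m'l = f only up to arrows through injectives, while octahedra of extensions need equality.
  So M and B are enlarged by the injective I_A of the common source A: a component \<alpha>_A is
  added to l and to the composite, which makes both inflations, and m' becomes the sum of an old
  arrow with an identity, so that m'l = f holds on the nose. The result is carried back along
  isomorphisms of triangles, and this needs the five lemma. Second, the sum relation of the
  octahedron is about \<Sigma>, whereas the quotient needs it for S. Lifting both summands to S_M
  gives an arrow whose composite with \<gamma>_M vanishes. For (AC1) it must, after a correction
  through I_M, also be killed by the last arrow of an extension. The arrow available is g m', which
  is no deflation a priori; it is \<Sigma>-epic, and (G1) completes it to an extension. The signs in
  rotations come from the sum relation in (RTR4).\<close>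

context category
begin

text \<open>As a simp rule this reduces every typing goal to equations between sources and targets,
  which the conditional rules for composites, sums and functor values then discharge.\<close>

lemma Hom_iff [simp]: "f \<in> Hom C A B \<longleftrightarrow> f \<in> Arr C \<and> Src C f = A \<and> Tgt C f = B"
  by (simp add: Hom_def)

lemma Hom_objD:
  assumes "f \<in> Hom C A B"
  shows "A \<in> Obj C" and "B \<in> Obj C"
  using assms src_obj tgt_obj by auto

lemma arr_obj [simp]: "f \<in> Arr C \<Longrightarrow> Src C f \<in> Obj C" "f \<in> Arr C \<Longrightarrow> Tgt C f \<in> Obj C"
  by (rule src_obj tgt_obj; assumption)+

lemma comp_arr [simp]:
  assumes "f \<in> Arr C" "g \<in> Arr C" "Src C g = Tgt C f"
  shows "g \<cdot> f \<in> Arr C" "Src C (g \<cdot> f) = Src C f" "Tgt C (g \<cdot> f) = Tgt C g"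
  using comp_hom[of f "Src C f" "Tgt C f" g "Tgt C g"] assms by auto

lemma comp_assoc_arr [simp]:
  assumes "f \<in> Arr C" "g \<in> Arr C" "h \<in> Arr C" "Src C g = Tgt C f" "Src C h = Tgt C g"
  shows "(h \<cdot> g) \<cdot> f = h \<cdot> (g \<cdot> f)"
  using comp_assoc[of f "Src C f" "Tgt C f" g "Tgt C g" h "Tgt C h"] assms by auto

lemma Idn_arr [simp]:
  assumes "A \<in> Obj C"
  shows "Idn C A \<in> Arr C" "Src C (Idn C A) = A" "Tgt C (Idn C A) = A"
  using id_hom[OF assms] by auto

lemma comp_Idn [simp]:
  "f \<in> Arr C \<Longrightarrow> Src C f = A \<Longrightarrow> f \<cdot> Idn C A = f"
  "f \<in> Arr C \<Longrightarrow> Tgt C f = A \<Longrightarrow> Idn C A \<cdot> f = f"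
  using comp_id_right[of f A "Tgt C f"] comp_id_left[of f "Src C f" A] by auto

text \<open>Composites are normalised to the right, so an equation \<open>g \<cdot> f = k\<close> no
  longer matches inside a longer composite; the version with a tail \<open>x\<close> does. Hence the
  many uses of \<open>[THEN comp_eq_comp]\<close>.\<close>

lemma comp_eq_comp:
  assumes "g \<cdot> f = k" "x \<in> Arr C" "f \<in> Arr C" "g \<in> Arr C" "Src C f = Tgt C x" "Src C g = Tgt C f"
  shows "g \<cdot> (f \<cdot> x) = k \<cdot> x"
  using assms comp_assoc_arr[of x f g] by simp

lemma iso_arrowI:
  assumes "f \<in> Hom C A B" "g \<in> Hom C B A" "g \<cdot> f = Idn C A" "f \<cdot> g = Idn C B"
  shows "iso_arrow C f"
  using assms unfolding iso_arrow_def by auto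

lemma iso_arrowE:
  assumes "iso_arrow C f" "f \<in> Hom C A B"
  obtains g where "g \<in> Hom C B A" "g \<cdot> f = Idn C A" "f \<cdot> g = Idn C B" "iso_arrow C g"
proof -
  obtain g where g: "g \<in> Hom C B A" "g \<cdot> f = Idn C A" "f \<cdot> g = Idn C B"
    using assms unfolding iso_arrow_def by auto
  with assms(2) have "iso_arrow C g" by (intro iso_arrowI[of g B A f])
  with g that show thesis by blast
qed

lemma iso_arrow_Idn [simp]: "A \<in> Obj C \<Longrightarrow> iso_arrow C (Idn C A)"
  by (rule iso_arrowI[of _ A A "Idn C A"]) auto

lemma iso_arrow_two_sided:
  assumes "f \<in> Hom C A B" "g \<in> Hom C B A" "k \<in> Hom C B A"
    and "g \<cdot> f = Idn C A" "f \<cdot> k = Idn C B"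
  shows "iso_arrow C f"
proof -
  have "g = g \<cdot> (f \<cdot> k)" using assms by simp
  also have "\<dots> = (g \<cdot> f) \<cdot> k" using assms(1-3) by simp
  also have "\<dots> = k" using assms by simp
  finally show ?thesis using assms by (intro iso_arrowI[of f A B g]) auto
qed

lemma iso_arrow_comp:
  assumes "f \<in> Hom C A B" "g \<in> Hom C B D" "iso_arrow C f" "iso_arrow C g"
  shows "iso_arrow C (g \<cdot> f)"
proof -
  obtain f' where f': "f' \<in> Hom C B A" "f' \<cdot> f = Idn C A" "f \<cdot> f' = Idn C B"
    using iso_arrowE[OF assms(3,1)] by blast
  obtain g' where g': "g' \<in> Hom C D B" "g' \<cdot> g = Idn C B" "g \<cdot> g' = Idn C D"
    using iso_arrowE[OF assms(4,2)] by blast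
  have "f' \<cdot> g' \<cdot> g \<cdot> f = Idn C A"
    using assms f' g' by (simp add: comp_eq_comp[OF g'(2)])
  moreover have "g \<cdot> f \<cdot> f' \<cdot> g' = Idn C D"
    using assms f' g' by (simp add: comp_eq_comp[OF f'(3)])
  ultimately show ?thesis
    using assms f' g' by (intro iso_arrowI[of _ A D "f' \<cdot> g'"]) auto
qed

lemma iso_arrow_cancel_left:
  assumes "iso_arrow C f" "f \<in> Hom C B D" "x \<in> Hom C A B" "y \<in> Hom C A B" "f \<cdot> x = f \<cdot> y"
  shows "x = y"
proof -
  obtain f' where f': "f' \<in> Hom C D B" "f' \<cdot> f = Idn C B"
    using iso_arrowE[OF assms(1,2)] by blast
  have "x = f' \<cdot> (f \<cdot> x)" using f' assms(2,3) by (simp add: comp_eq_comp[OF f'(2)])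
  also have "\<dots> = y" using f' assms by (simp add: comp_eq_comp[OF f'(2)])
  finally show ?thesis .
qed

end

section \<open>Arithmetic of arrows in preadditive categories\<close>

context preadditive_category
begin

lemma comm_group_hom: "f \<in> Arr C \<Longrightarrow> comm_group (hom_group C (Src C f) (Tgt C f))"
  by (simp add: hom_comm_group)

lemma Zer_arr [simp]:
  assumes "A \<in> Obj C" "B \<in> Obj C"
  shows "Zer C A B \<in> Arr C" "Src C (Zer C A B) = A" "Tgt C (Zer C A B) = B"
proof -
  interpret G: comm_group "hom_group C A B" using hom_comm_group assms .
  show "Zer C A B \<in> Arr C" "Src C (Zer C A B) = A" "Tgt C (Zer C A B) = B"
    using G.one_closed by (auto simp: hom_group_def)
qed

lemma Plus_arr [simp]:
  assumes "f \<in> Arr C" "g \<in> Arr C" "Src C g = Src C f" "Tgt C g = Tgt C f"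
  shows "f \<boxplus> g \<in> Arr C" "Src C (f \<boxplus> g) = Src C f" "Tgt C (f \<boxplus> g) = Tgt C f"
proof -
  interpret G: comm_group "hom_group C (Src C f) (Tgt C f)" using comm_group_hom assms(1) .
  show "f \<boxplus> g \<in> Arr C" "Src C (f \<boxplus> g) = Src C f" "Tgt C (f \<boxplus> g) = Tgt C f"
    using G.m_closed[of f g] assms by (auto simp: hom_group_def)
qed

lemma Neg_arr [simp]:
  assumes "f \<in> Arr C"
  shows "\<boxminus> f \<in> Arr C" "Src C (\<boxminus> f) = Src C f" "Tgt C (\<boxminus> f) = Tgt C f"
proof -
  interpret G: comm_group "hom_group C (Src C f) (Tgt C f)" using comm_group_hom assms(1) .
  show "\<boxminus> f \<in> Arr C" "Src C (\<boxminus> f) = Src C f" "Tgt C (\<boxminus> f) = Tgt C f"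
    using G.inv_closed[of f] assms by (auto simp: hom_group_def Neg_def)
qed

lemma Plus_assoc [simp]:
  assumes "f \<in> Arr C" "g \<in> Arr C" "h \<in> Arr C" "Src C g = Src C f" "Tgt C g = Tgt C f"
    "Src C h = Src C f" "Tgt C h = Tgt C f"
  shows "(f \<boxplus> g) \<boxplus> h = f \<boxplus> (g \<boxplus> h)"
proof -
  interpret G: comm_group "hom_group C (Src C f) (Tgt C f)" using comm_group_hom assms(1) .
  show ?thesis
    using G.m_assoc[of f g h] assms by (auto simp: hom_group_def)
qed

lemma Plus_comm:
  assumes "f \<in> Arr C" "g \<in> Arr C" "Src C g = Src C f" "Tgt C g = Tgt C f"
  shows "f \<boxplus> g = g \<boxplus> f"
proof -
  interpret G: comm_group "hom_group C (Src C f) (Tgt C f)" using comm_group_hom assms(1) .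
  show ?thesis
    using G.m_comm[of f g] assms by (auto simp: hom_group_def)
qed

lemma Plus_left_comm:
  assumes "f \<in> Arr C" "g \<in> Arr C" "h \<in> Arr C" "Src C g = Src C f" "Tgt C g = Tgt C f"
    "Src C h = Src C f" "Tgt C h = Tgt C f"
  shows "f \<boxplus> (g \<boxplus> h) = g \<boxplus> (f \<boxplus> h)"
  using assms Plus_comm[of f g] Plus_assoc[of f g h] Plus_assoc[of g f h] by simp

lemma Plus_Zer [simp]:
  assumes "f \<in> Arr C" "Src C f = A" "Tgt C f = B"
  shows "f \<boxplus> Zer C A B = f" "Zer C A B \<boxplus> f = f"
proof -
  interpret G: comm_group "hom_group C (Src C f) (Tgt C f)" using comm_group_hom assms(1) .
  show "f \<boxplus> Zer C A B = f" "Zer C A B \<boxplus> f = f"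
    using G.r_one[of f] G.l_one[of f] assms by (auto simp: hom_group_def)
qed

lemma Plus_Neg [simp]:
  assumes "f \<in> Arr C"
  shows "f \<boxplus> \<boxminus> f = Zer C (Src C f) (Tgt C f)" "\<boxminus> f \<boxplus> f = Zer C (Src C f) (Tgt C f)"
proof -
  interpret G: comm_group "hom_group C (Src C f) (Tgt C f)" using comm_group_hom assms(1) .
  show "f \<boxplus> \<boxminus> f = Zer C (Src C f) (Tgt C f)" "\<boxminus> f \<boxplus> f = Zer C (Src C f) (Tgt C f)"
    using G.r_inv[of f] G.l_inv[of f] assms by (auto simp: hom_group_def Neg_def)
qed

lemma Plus_Neg_left [simp]:
  assumes "f \<in> Arr C" "g \<in> Arr C" "Src C g = Src C f" "Tgt C g = Tgt C f"
  shows "f \<boxplus> (\<boxminus> f \<boxplus> g) = g" "\<boxminus> f \<boxplus> (f \<boxplus> g) = g"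
  using assms Plus_assoc[of f "\<boxminus> f" g] Plus_assoc[of "\<boxminus> f" f g] by auto

lemma Neg_unique:
  assumes "f \<in> Arr C" "g \<in> Arr C" "Src C g = Src C f" "Tgt C g = Tgt C f"
    and "f \<boxplus> g = Zer C (Src C f) (Tgt C f)"
  shows "g = \<boxminus> f"
proof -
  have "g = \<boxminus> f \<boxplus> (f \<boxplus> g)" using assms(1-4) by simp
  also have "\<dots> = \<boxminus> f" using assms by simp
  finally show ?thesis .
qed

lemma Neg_Neg [simp]: "f \<in> Arr C \<Longrightarrow> \<boxminus> (\<boxminus> f) = f"
  by (rule Neg_unique[symmetric]) auto

lemma Neg_Zer [simp]: "A \<in> Obj C \<Longrightarrow> B \<in> Obj C \<Longrightarrow> \<boxminus> Zer C A B = Zer C A B"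
  by (rule Neg_unique[symmetric]) auto

lemma Neg_Plus [simp]:
  assumes "f \<in> Arr C" "g \<in> Arr C" "Src C g = Src C f" "Tgt C g = Tgt C f"
  shows "\<boxminus> (f \<boxplus> g) = \<boxminus> f \<boxplus> \<boxminus> g"
proof (rule Neg_unique[symmetric])
  have "(f \<boxplus> g) \<boxplus> (\<boxminus> f \<boxplus> \<boxminus> g) = g \<boxplus> (f \<boxplus> (\<boxminus> f \<boxplus> \<boxminus> g))"
    using assms by (simp add: Plus_left_comm[of f g])
  then show "(f \<boxplus> g) \<boxplus> (\<boxminus> f \<boxplus> \<boxminus> g) = Zer C (Src C (f \<boxplus> g)) (Tgt C (f \<boxplus> g))"
    using assms by simp
qed (use assms in auto)

lemma diff_eq_Zer:
  assumes "f \<in> Arr C" "g \<in> Arr C" "Src C g = Src C f" "Tgt C g = Tgt C f"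
    and "f \<boxplus> \<boxminus> g = Zer C (Src C f) (Tgt C f)"
  shows "f = g"
  using Neg_unique[of f "\<boxminus> g"] assms by (metis Neg_Neg Neg_arr)

lemma diff_eqD:
  assumes "f \<in> Hom C A B" "g \<in> Hom C A B" "h \<in> Hom C A B" "f \<boxplus> \<boxminus> g = h"
  shows "f = g \<boxplus> h"
proof -
  have "g \<boxplus> h = f \<boxplus> (g \<boxplus> \<boxminus> g)"
    using assms(1-3) Plus_left_comm[of f g "\<boxminus> g"] by (simp add: assms(4)[symmetric])
  then show ?thesis using assms by simp
qed

lemma comp_Plus [simp]:
  assumes "f \<in> Arr C" "g \<in> Arr C" "Src C g = Src C f" "Tgt C g = Tgt C f"
  shows "h \<in> Arr C \<Longrightarrow> Src C h = Tgt C f \<Longrightarrow> h \<cdot> (f \<boxplus> g) = h \<cdot> f \<boxplus> h \<cdot> g"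
    "k \<in> Arr C \<Longrightarrow> Tgt C k = Src C f \<Longrightarrow> (f \<boxplus> g) \<cdot> k = f \<cdot> k \<boxplus> g \<cdot> k"
  using comp_plus_right[of f "Src C f" "Tgt C f" g h "Tgt C h"]
    comp_plus_left[of k "Src C k" "Tgt C k" f "Tgt C f" g] assms by auto

lemma comp_Zer [simp]:
  assumes "A \<in> Obj C" "B \<in> Obj C" "f \<in> Arr C"
  shows "Src C f = B \<Longrightarrow> f \<cdot> Zer C A B = Zer C A (Tgt C f)"
    "Tgt C f = A \<Longrightarrow> Zer C A B \<cdot> f = Zer C (Src C f) B"
proof -
  \<comment> \<open>An arrow equal to its own double is zero, and by distributivity both composites
    with a zero arrow are of this kind.\<close>
  have cancel: "x = Zer C (Src C x) (Tgt C x)" if "x \<in> Arr C" "x \<boxplus> x = x" for x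
    using that Plus_Neg_left(2)[of x x] by simp
  show "f \<cdot> Zer C A B = Zer C A (Tgt C f)" if "Src C f = B"
    using cancel[of "f \<cdot> Zer C A B"] comp_Plus(1)[of "Zer C A B" "Zer C A B" f] that assms by simp
  show "Zer C A B \<cdot> f = Zer C (Src C f) B" if "Tgt C f = A"
    using cancel[of "Zer C A B \<cdot> f"] comp_Plus(2)[of "Zer C A B" "Zer C A B" f] that assms by simp
qed

lemma comp_Neg [simp]:
  assumes "f \<in> Arr C" "g \<in> Arr C" "Src C g = Tgt C f"
  shows "g \<cdot> \<boxminus> f = \<boxminus> (g \<cdot> f)" "\<boxminus> g \<cdot> f = \<boxminus> (g \<cdot> f)"
proof -
  show "g \<cdot> \<boxminus> f = \<boxminus> (g \<cdot> f)"
    using assms comp_Plus(1)[of f "\<boxminus> f" g] by (intro Neg_unique) auto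
  show "\<boxminus> g \<cdot> f = \<boxminus> (g \<cdot> f)"
  proof (rule Neg_unique)
    have "g \<cdot> f \<boxplus> \<boxminus> g \<cdot> f = (g \<boxplus> \<boxminus> g) \<cdot> f"
      using assms by (intro comp_Plus(2)[symmetric]) auto
    also have "\<dots> = Zer C (Src C (g \<cdot> f)) (Tgt C (g \<cdot> f))"
      using assms(1,2) by (simp only: Plus_Neg) (simp add: assms(3))
    finally show "g \<cdot> f \<boxplus> \<boxminus> g \<cdot> f = Zer C (Src C (g \<cdot> f)) (Tgt C (g \<cdot> f))" .
  qed (use assms in auto)
qed

text \<open>The equation passes to images under additive functors and to the quotient category,
  where the universal property would need a fresh proof.\<close>

lemma zero_object_iff: "zero_object C N \<longleftrightarrow> N \<in> Obj C \<and> Idn C N = Zer C N N"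
proof
  assume N: "zero_object C N"
  then have "N \<in> Obj C" "\<exists>!f. f \<in> Hom C N N" by (auto simp: zero_object_def)
  moreover have "Idn C N \<in> Hom C N N" "Zer C N N \<in> Hom C N N" using \<open>N \<in> Obj C\<close> by auto
  ultimately show "N \<in> Obj C \<and> Idn C N = Zer C N N" by blast
next
  assume N: "N \<in> Obj C \<and> Idn C N = Zer C N N"
  have "f = Zer C N A" if "f \<in> Hom C N A" for f A
    using comp_id_right[OF that] N that Hom_objD[OF that] by simp
  moreover have "f = Zer C A N" if "f \<in> Hom C A N" for f A
    using comp_id_left[OF that] N that Hom_objD[OF that] by simp
  moreover have "Zer C N A \<in> Hom C N A" "Zer C A N \<in> Hom C A N" if "A \<in> Obj C" for A
    using N that by auto
  ultimately show "zero_object C N" unfolding zero_object_def using N by blast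
qed

lemma arrow_to_zero_object: "zero_object C N \<Longrightarrow> f \<in> Arr C \<Longrightarrow> Tgt C f = N \<Longrightarrow> f = Zer C (Src C f) N"
  using comp_id_left[of f "Src C f" N] comp_Zer(2)[of N N f] by (auto simp: zero_object_iff)

text \<open>Since \<open>n\<close> squares to zero, \<open>1 - n\<close> is inverse to
  \<open>1 + n\<close>.\<close>

lemma iso_arrow_unipotent:
  assumes "c \<in> Hom C A A" "n \<in> Hom C A A" "c = Idn C A \<boxplus> n" "n \<cdot> n = Zer C A A"
  shows "iso_arrow C c"
proof (rule iso_arrowI)
  have A: "A \<in> Obj C" using Hom_objD assms(1) by blast
  show "c \<in> Hom C A A" "Idn C A \<boxplus> \<boxminus> n \<in> Hom C A A" using assms A by auto
  show "(Idn C A \<boxplus> \<boxminus> n) \<cdot> c = Idn C A" "c \<cdot> (Idn C A \<boxplus> \<boxminus> n) = Idn C A"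
    using assms A by auto
qed

end

section \<open>Morphisms of diagrams\<close>

text \<open>Interpreted for \<Sigma> and \<Omega> and for the shift of the quotient, so that the
  functor calculus and the morphisms of diagrams are treated once.\<close>

locale shifted_category = preadditive_category C
  for C :: "('o, 'm, 'b) cat_scheme" (structure) +
  fixes F :: "('o, 'm) endofun"
  assumes F_additive: "additive_endofunctor C F"
begin

lemma FOb_obj [simp]: "A \<in> Obj C \<Longrightarrow> FOb F A \<in> Obj C"
  using F_additive by (auto simp: additive_endofunctor_def endofunctor_def)

lemma FAr_arr [simp]:
  assumes "f \<in> Arr C"
  shows "FAr F f \<in> Arr C" "Src C (FAr F f) = FOb F (Src C f)" "Tgt C (FAr F f) = FOb F (Tgt C f)"
  using F_additive assms by (auto simp: additive_endofunctor_def endofunctor_def)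

lemma FAr_Idn [simp]: "A \<in> Obj C \<Longrightarrow> FAr F (Idn C A) = Idn C (FOb F A)"
  using F_additive by (auto simp: additive_endofunctor_def endofunctor_def)

lemma FAr_comp [simp]:
  "f \<in> Arr C \<Longrightarrow> g \<in> Arr C \<Longrightarrow> Src C g = Tgt C f \<Longrightarrow> FAr F (g \<cdot> f) = FAr F g \<cdot> FAr F f"
  using F_additive by (auto simp: additive_endofunctor_def endofunctor_def)

lemma FAr_Plus [simp]:
  assumes "f \<in> Arr C" "g \<in> Arr C" "Src C g = Src C f" "Tgt C g = Tgt C f"
  shows "FAr F (f \<boxplus> g) = FAr F f \<boxplus> FAr F g"
proof -
  have "f \<in> Hom C (Src C f) (Tgt C f)" "g \<in> Hom C (Src C f) (Tgt C f)"
    "Src C f \<in> Obj C" "Tgt C f \<in> Obj C"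
    using assms by auto
  then show ?thesis using F_additive unfolding additive_endofunctor_def by blast
qed

lemma FAr_Zer [simp]:
  assumes "A \<in> Obj C" "B \<in> Obj C"
  shows "FAr F (Zer C A B) = Zer C (FOb F A) (FOb F B)"
proof -
  have "FAr F (Zer C A B) \<boxplus> FAr F (Zer C A B) = FAr F (Zer C A B)"
    using assms FAr_Plus[of "Zer C A B" "Zer C A B"] by simp
  then show ?thesis
    using Plus_Neg_left(2)[of "FAr F (Zer C A B)" "FAr F (Zer C A B)"] assms by simp
qed

lemma FAr_Neg [simp]: "f \<in> Arr C \<Longrightarrow> FAr F (\<boxminus> f) = \<boxminus> FAr F f"
  using FAr_Plus[of f "\<boxminus> f"] by (intro Neg_unique) auto

lemma FOb_zero_object [simp]: "zero_object C N \<Longrightarrow> zero_object C (FOb F N)"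
  using FAr_Idn[of N] by (auto simp: zero_object_iff)

lemma FAr_iso_arrow [simp]:
  assumes "iso_arrow C f"
  shows "iso_arrow C (FAr F f)"
proof -
  have f: "f \<in> Hom C (Src C f) (Tgt C f)" using assms by (simp add: iso_arrow_def)
  obtain g where g: "g \<in> Hom C (Tgt C f) (Src C f)" "g \<cdot> f = Idn C (Src C f)" "f \<cdot> g = Idn C (Tgt C f)"
    using iso_arrowE[OF assms f] by blast
  have "FAr F g \<cdot> FAr F f = FAr F (g \<cdot> f)" "FAr F f \<cdot> FAr F g = FAr F (f \<cdot> g)"
    using f g(1) by simp_all
  with f g show ?thesis
    by (intro iso_arrowI[of _ "FOb F (Src C f)" "FOb F (Tgt C f)" "FAr F g"]) auto
qed

lemma rmorphism_iff: "rmorphism C F (a, b, c) (f, g, h) (f', g', h') \<longleftrightarrow>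
     a \<in> Hom C (Src C f) (Src C f') \<and> b \<in> Hom C (Tgt C f) (Tgt C f') \<and>
     c \<in> Hom C (Tgt C g) (Tgt C g') \<and> b \<cdot> f = f' \<cdot> a \<and> c \<cdot> g = g' \<cdot> b \<and> FAr F a \<cdot> h = h' \<cdot> c"
  by (simp add: rmorphism_def)

lemma rmorphism_Idn:
  assumes "rdiagram C F f g h"
  shows "rmorphism C F (Idn C (Src C f), Idn C (Tgt C f), Idn C (Tgt C g)) (f, g, h) (f, g, h)"
  using assms by (auto simp: rmorphism_iff rdiagram_def)

lemma rmorphism_comp:
  assumes d: "rdiagram C F f g h" "rdiagram C F f' g' h'" "rdiagram C F f'' g'' h''"
    and m: "rmorphism C F (a, b, c) (f, g, h) (f', g', h')"
      "rmorphism C F (a', b', c') (f', g', h') (f'', g'', h'')"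
  shows "rmorphism C F (a' \<cdot> a, b' \<cdot> b, c' \<cdot> c) (f, g, h) (f'', g'', h'')"
proof -
  note ar = d[unfolded rdiagram_def]
  from m have e: "b \<cdot> f = f' \<cdot> a" "c \<cdot> g = g' \<cdot> b" "FAr F a \<cdot> h = h' \<cdot> c"
    and e': "b' \<cdot> f' = f'' \<cdot> a'" "c' \<cdot> g' = g'' \<cdot> b'" "FAr F a' \<cdot> h' = h'' \<cdot> c'"
    and t: "a \<in> Hom C (Src C f) (Src C f')" "b \<in> Hom C (Tgt C f) (Tgt C f')"
      "c \<in> Hom C (Tgt C g) (Tgt C g')" "a' \<in> Hom C (Src C f') (Src C f'')"
      "b' \<in> Hom C (Tgt C f') (Tgt C f'')" "c' \<in> Hom C (Tgt C g') (Tgt C g'')"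
    unfolding rmorphism_iff by blast+
  from t ar show ?thesis
    by (simp add: rmorphism_iff e comp_eq_comp[OF e'(1)] comp_eq_comp[OF e'(2)] comp_eq_comp[OF e'(3)])
qed

end

text \<open>\<open>biproduct\<close> hides the four structure maps behind quantifiers; the matrix
  computations below need them by name.\<close>

definition biproduct_data ::
    "('o, 'm, 'b) cat_scheme \<Rightarrow> 'o \<Rightarrow> 'o \<Rightarrow> 'o \<Rightarrow> 'm \<Rightarrow> 'm \<Rightarrow> 'm \<Rightarrow> 'm \<Rightarrow> bool" where
  "biproduct_data C A B P i j p q \<longleftrightarrow>
     i \<in> Hom C A P \<and> j \<in> Hom C B P \<and> p \<in> Hom C P A \<and> q \<in> Hom C P B \<and>
     p \<cdot>\<^bsub>C\<^esub> i = Idn C A \<and> q \<cdot>\<^bsub>C\<^esub> j = Idn C B \<and>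
     q \<cdot>\<^bsub>C\<^esub> i = Zer C A B \<and> p \<cdot>\<^bsub>C\<^esub> j = Zer C B A \<and>
     i \<cdot>\<^bsub>C\<^esub> p \<boxplus>\<^bsub>C\<^esub> j \<cdot>\<^bsub>C\<^esub> q = Idn C P"

lemma biproductE:
  assumes "biproduct C A B P"
  obtains i j p q where "biproduct_data C A B P i j p q"
  using assms unfolding biproduct_def biproduct_data_def by blast

context category
begin

lemma inverse_square:
  assumes "f \<in> Hom C A B" "f' \<in> Hom C A' B'" "a \<in> Hom C A A'" "a' \<in> Hom C A' A"
    "b \<in> Hom C B B'" "b' \<in> Hom C B' B"
    and e: "b \<cdot> f = f' \<cdot> a" "a \<cdot> a' = Idn C A'" "b' \<cdot> b = Idn C B"
  shows "b' \<cdot> f' = f \<cdot> a'"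
proof -
  have "b' \<cdot> f' = b' \<cdot> f' \<cdot> a \<cdot> a'" using assms(1-6) by (simp add: e(2))
  also have "\<dots> = b' \<cdot> b \<cdot> f \<cdot> a'" using assms(1-6) by (simp add: e(1)[symmetric, THEN comp_eq_comp])
  also have "\<dots> = f \<cdot> a'" using assms(1-6) by (simp add: e(3)[THEN comp_eq_comp])
  finally show ?thesis .
qed

text \<open>A left inverse of \<open>f\<close> is read off from \<open>g \<cdot> f\<close>, a right
  inverse from \<open>f \<cdot> g\<close>.\<close>

lemma iso_arrow_of_comps:
  assumes "f \<in> Hom C A B" "g \<in> Hom C B A" "iso_arrow C (g \<cdot> f)" "iso_arrow C (f \<cdot> g)"
  shows "iso_arrow C f"
proof -
  obtain u where u: "u \<in> Hom C A A" "u \<cdot> (g \<cdot> f) = Idn C A"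
    using iso_arrowE[OF assms(3), of A A] assms(1,2) by auto
  obtain v where v: "v \<in> Hom C B B" "(f \<cdot> g) \<cdot> v = Idn C B"
    using iso_arrowE[OF assms(4), of B B] assms(1,2) by auto
  show ?thesis
    using assms(1,2) u v by (intro iso_arrow_two_sided[of f A B "u \<cdot> g" "g \<cdot> v"]) auto
qed

end

context preadditive_category
begin

lemma biproduct_dataD:
  assumes "biproduct_data C A B P i j p q"
  shows "i \<in> Hom C A P" "j \<in> Hom C B P" "p \<in> Hom C P A" "q \<in> Hom C P B"
    "p \<cdot> i = Idn C A" "q \<cdot> j = Idn C B" "q \<cdot> i = Zer C A B" "p \<cdot> j = Zer C B A"
    "i \<cdot> p \<boxplus> j \<cdot> q = Idn C P" "A \<in> Obj C" "B \<in> Obj C" "P \<in> Obj C"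
  using assms Hom_objD[of i A P] Hom_objD[of j B P] unfolding biproduct_data_def by blast+

lemma biproduct_dataI:
  assumes "biproduct_data C A B P i j p q"
  shows "biproduct C A B P"
  using biproduct_dataD(10-12)[OF assms] assms unfolding biproduct_data_def biproduct_def by blast

lemma biproduct_data_swap:
  assumes "biproduct_data C A B P i j p q"
  shows "biproduct_data C B A P j i q p"
  using biproduct_dataD[OF assms] Plus_comm[of "i \<cdot> p" "j \<cdot> q"] by (simp add: biproduct_data_def)

end

context shifted_category
begin

lemma rmorphism_inverse:
  assumes d: "rdiagram C F f g h" "rdiagram C F f' g' h'"
    and m: "rmorphism C F (a, b, c) (f, g, h) (f', g', h')"
    and a': "a' \<in> Hom C (Src C f') (Src C f)" "a' \<cdot> a = Idn C (Src C f)" "a \<cdot> a' = Idn C (Src C f')"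
    and b': "b' \<in> Hom C (Tgt C f') (Tgt C f)" "b' \<cdot> b = Idn C (Tgt C f)" "b \<cdot> b' = Idn C (Tgt C f')"
    and c': "c' \<in> Hom C (Tgt C g') (Tgt C g)" "c' \<cdot> c = Idn C (Tgt C g)" "c \<cdot> c' = Idn C (Tgt C g')"
  shows "rmorphism C F (a', b', c') (f', g', h') (f, g, h)"
proof -
  note ar = d[unfolded rdiagram_def]
  from m have e: "f' \<cdot> a = b \<cdot> f" "g' \<cdot> b = c \<cdot> g" "h' \<cdot> c = FAr F a \<cdot> h"
    and t: "a \<in> Hom C (Src C f) (Src C f')" "b \<in> Hom C (Tgt C f) (Tgt C f')"
      "c \<in> Hom C (Tgt C g) (Tgt C g')"
    unfolding rmorphism_iff by auto
  have 1: "b' \<cdot> f' = f \<cdot> a'" using ar t a' b' e by (intro inverse_square[of f _ _ f' _ _ a a' b]) auto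
  have 2: "c' \<cdot> g' = g \<cdot> b'" using ar t c' b' e by (intro inverse_square[of g _ _ g' _ _ b b' c]) auto
  have "FAr F a' \<cdot> FAr F a = FAr F (a' \<cdot> a)" using a'(1) t by simp
  then have "FAr F a' \<cdot> FAr F a = Idn C (FOb F (Src C f))" using ar a'(2) by simp
  then have 3: "FAr F a' \<cdot> h' = h \<cdot> c'"
    using ar t a'(1) c' e by (intro inverse_square[of h _ _ h' _ _ c c' "FAr F a"]) auto
  from 1 2 3 a'(1) b'(1) c'(1) show ?thesis by (simp add: rmorphism_iff)
qed

lemma rmorphism_isoE:
  assumes d: "rdiagram C F f g h" "rdiagram C F f' g' h'"
    and m: "rmorphism C F (a, b, c) (f, g, h) (f', g', h')"
      "iso_arrow C a" "iso_arrow C b" "iso_arrow C c"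
  obtains a' b' c' where "rmorphism C F (a', b', c') (f', g', h') (f, g, h)"
    "a' \<cdot> a = Idn C (Src C f)" "a \<cdot> a' = Idn C (Src C f')"
    "b' \<cdot> b = Idn C (Tgt C f)" "b \<cdot> b' = Idn C (Tgt C f')"
    "c' \<cdot> c = Idn C (Tgt C g)" "c \<cdot> c' = Idn C (Tgt C g')"
    "iso_arrow C a'" "iso_arrow C b'" "iso_arrow C c'"
proof -
  from m(1) have t: "a \<in> Hom C (Src C f) (Src C f')" "b \<in> Hom C (Tgt C f) (Tgt C f')"
      "c \<in> Hom C (Tgt C g) (Tgt C g')"
    unfolding rmorphism_iff by blast+
  obtain a' where a': "a' \<in> Hom C (Src C f') (Src C f)" "a' \<cdot> a = Idn C (Src C f)"
    "a \<cdot> a' = Idn C (Src C f')" "iso_arrow C a'"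
    using iso_arrowE[OF m(2) t(1)] by blast
  obtain b' where b': "b' \<in> Hom C (Tgt C f') (Tgt C f)" "b' \<cdot> b = Idn C (Tgt C f)"
    "b \<cdot> b' = Idn C (Tgt C f')" "iso_arrow C b'"
    using iso_arrowE[OF m(3) t(2)] by blast
  obtain c' where c': "c' \<in> Hom C (Tgt C g') (Tgt C g)" "c' \<cdot> c = Idn C (Tgt C g)"
    "c \<cdot> c' = Idn C (Tgt C g')" "iso_arrow C c'"
    using iso_arrowE[OF m(4) t(3)] by blast
  show thesis
    using that[OF rmorphism_inverse[OF d m(1) a'(1-3) b'(1-3) c'(1-3)]] a' b' c' by blast
qed

lemma risomorphic_sym:
  assumes d: "rdiagram C F f g h" "rdiagram C F f' g' h'"
    and "risomorphic C F (f, g, h) (f', g', h')"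
  shows "risomorphic C F (f', g', h') (f, g, h)"
  using assms(3) rmorphism_isoE[OF d] unfolding risomorphic_def by metis

lemma risomorphic_trans:
  assumes d: "rdiagram C F f g h" "rdiagram C F f' g' h'" "rdiagram C F f'' g'' h''"
    and "risomorphic C F (f, g, h) (f', g', h')" "risomorphic C F (f', g', h') (f'', g'', h'')"
  shows "risomorphic C F (f, g, h) (f'', g'', h'')"
proof -
  obtain a b c where m: "rmorphism C F (a, b, c) (f, g, h) (f', g', h')"
    "iso_arrow C a" "iso_arrow C b" "iso_arrow C c"
    using assms(4) unfolding risomorphic_def by blast
  obtain a' b' c' where m': "rmorphism C F (a', b', c') (f', g', h') (f'', g'', h'')"
    "iso_arrow C a'" "iso_arrow C b'" "iso_arrow C c'"
    using assms(5) unfolding risomorphic_def by blast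
  have "iso_arrow C (a' \<cdot> a)" "iso_arrow C (b' \<cdot> b)" "iso_arrow C (c' \<cdot> c)"
    using m m' iso_arrow_comp unfolding rmorphism_iff by blast+
  then show ?thesis
    using rmorphism_comp[OF d m(1) m'(1)] unfolding risomorphic_def by blast
qed

end

section \<open>Right triangulations\<close>

text \<open>Without (RTR4): the five lemma is needed in the quotient before (RTR4) can be verified there.\<close>

locale pre_right_triangulation = additive_category C
  for C :: "('o, 'm, 'b) cat_scheme" (structure) +
  fixes \<Sigma> :: "('o, 'm) endofun" and RT :: "('m \<times> 'm \<times> 'm) set"
  assumes suspension_additive: "additive_endofunctor C \<Sigma>"
    and tri_diagram: "(f, g, h) \<in> RT \<Longrightarrow> rdiagram C \<Sigma> f g h"
    and tri_iso_closed: "(f, g, h) \<in> RT \<Longrightarrow> rdiagram C \<Sigma> f' g' h' \<Longrightarrow>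
      risomorphic C \<Sigma> (f, g, h) (f', g', h') \<Longrightarrow> (f', g', h') \<in> RT"
    and tri_zero: "zero_object C N \<Longrightarrow> A \<in> Obj C \<Longrightarrow>
      (Zer C N A, Idn C A, Zer C A (FOb \<Sigma> N)) \<in> RT"
    and tri_ex: "f \<in> Arr C \<Longrightarrow> \<exists>g h. (f, g, h) \<in> RT"
    and tri_rotate: "(f, g, h) \<in> RT \<Longrightarrow> (g, h, \<boxminus> FAr \<Sigma> f) \<in> RT"
    and tri_morphism: "(f, g, h) \<in> RT \<Longrightarrow> (f', g', h') \<in> RT \<Longrightarrow>
      a \<in> Hom C (Src C f) (Src C f') \<Longrightarrow> b \<in> Hom C (Tgt C f) (Tgt C f') \<Longrightarrow>
      b \<cdot> f = f' \<cdot> a \<Longrightarrow> \<exists>c. rmorphism C \<Sigma> (a, b, c) (f, g, h) (f', g', h')"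

sublocale pre_right_triangulation \<subseteq> Sg: shifted_category C \<Sigma>
  by unfold_locales (rule suspension_additive)

sublocale right_triangulation \<subseteq> pre_right_triangulation C \<Sigma> RT
  by unfold_locales (fact Sigma_additive RT_diagram RT_iso_closed RTR1_id RTR1_ex RTR2 RTR3)+

sublocale left_triangulation \<subseteq> Om: shifted_category C \<Omega>
  by unfold_locales (rule Omega_additive)

context pre_right_triangulation
begin

lemma RT_arr:
  assumes "(f, g, h) \<in> RT"
  shows "f \<in> Arr C" "g \<in> Arr C" "h \<in> Arr C" "Src C g = Tgt C f" "Src C h = Tgt C g"
    "Tgt C h = FOb \<Sigma> (Src C f)"
  using tri_diagram[OF assms] by (auto simp: rdiagram_def)

lemma RT_isoI:
  assumes "(f, g, h) \<in> RT" "rdiagram C \<Sigma> f' g' h'"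
    "rmorphism C \<Sigma> (a, b, c) (f, g, h) (f', g', h')" "iso_arrow C a" "iso_arrow C b" "iso_arrow C c"
  shows "(f', g', h') \<in> RT"
  using tri_iso_closed[OF assms(1,2)] assms(3-) unfolding risomorphic_def by blast

text \<open>The square formed by \<open>b\<close> and a zero arrow extends to a morphism into the
  trivial triangle \<open>0 -> W -> W -> \<Sigma>0\<close>; its third component is the
  factorization.\<close>

lemma RT_weak_cokernel:
  assumes t: "(f, g, h) \<in> RT" and b: "b \<in> Hom C (Tgt C f) W" "b \<cdot> f = Zer C (Src C f) W"
  obtains c where "c \<in> Hom C (Tgt C g) W" "c \<cdot> g = b"
proof -
  obtain N where N: "zero_object C N" using ex_zero_object by blast
  then have NO: "N \<in> Obj C" by (simp add: zero_object_iff)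
  have W: "W \<in> Obj C" using Hom_objD b(1) by blast
  note T = RT_arr[OF t]
  have "\<exists>c. rmorphism C \<Sigma> (Zer C (Src C f) N, b, c) (f, g, h) (Zer C N W, Idn C W, Zer C W (FOb \<Sigma> N))"
    using T b NO W by (intro tri_morphism[OF t tri_zero[OF N W]]) simp_all
  then show thesis using that T b NO W by (auto simp: rmorphism_def)
qed

lemma RT_weak_cokernel2:
  assumes t: "(f, g, h) \<in> RT" and b: "b \<in> Hom C (Tgt C g) W" "b \<cdot> g = Zer C (Tgt C f) W"
  obtains c where "c \<in> Hom C (FOb \<Sigma> (Src C f)) W" "c \<cdot> h = b"
  using RT_weak_cokernel[OF tri_rotate[OF t] b(1)] b(2) RT_arr[OF t] by auto

text \<open>The pair of the identity and \<open>f\<close> extends to a morphism from the rotated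
  trivial triangle \<open>A -> A -> \<Sigma>0\<close>. Its second square exhibits
  \<open>g \<cdot> f\<close> as a composite with a zero arrow.\<close>

lemma RT_comp_zero:
  assumes t: "(f, g, h) \<in> RT"
  shows "g \<cdot> f = Zer C (Src C f) (Tgt C g)"
proof -
  obtain N where N: "zero_object C N" using ex_zero_object by blast
  then have NO: "N \<in> Obj C" by (simp add: zero_object_iff)
  note T = RT_arr[OF t]
  have A: "Src C f \<in> Obj C" using T by simp
  have "\<exists>c. rmorphism C \<Sigma> (Idn C (Src C f), f, c)
      (Idn C (Src C f), Zer C (Src C f) (FOb \<Sigma> N), \<boxminus> FAr \<Sigma> (Zer C N (Src C f))) (f, g, h)"
    using T NO by (intro tri_morphism[OF tri_rotate[OF tri_zero[OF N A]] t]) simp_all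
  then show ?thesis using T NO by (auto simp: rmorphism_def)
qed

lemma RT_comp_zero2: "(f, g, h) \<in> RT \<Longrightarrow> h \<cdot> g = Zer C (Tgt C f) (FOb \<Sigma> (Src C f))"
  using RT_comp_zero[OF tri_rotate] RT_arr by metis

lemma RT_comp_zero3:
  assumes t: "(f, g, h) \<in> RT"
  shows "FAr \<Sigma> f \<cdot> h = Zer C (Tgt C g) (FOb \<Sigma> (Tgt C f))"
proof -
  note T = RT_arr[OF t]
  have "\<boxminus> (\<boxminus> (FAr \<Sigma> f \<cdot> h)) = \<boxminus> Zer C (Tgt C g) (FOb \<Sigma> (Tgt C f))"
    using RT_comp_zero2[OF tri_rotate[OF t]] T by simp
  then show ?thesis using T by (simp del: Neg_Zer) (simp)
qed

text \<open>The difference \<open>n = c - 1\<close> kills \<open>g\<close>, so it factors through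
  \<open>h\<close>, and \<open>h\<close> kills \<open>n\<close>. Hence \<open>n\<close> squares to
  zero and \<open>c\<close> is unipotent.\<close>

lemma RT_endo_iso:
  assumes t: "(f, g, h) \<in> RT"
    and c: "rmorphism C \<Sigma> (Idn C (Src C f), Idn C (Tgt C f), c) (f, g, h) (f, g, h)"
  shows "iso_arrow C c"
proof -
  let ?D = "Tgt C g"
  note T = RT_arr[OF t]
  have c: "c \<in> Hom C ?D ?D" "c \<cdot> g = g" "h \<cdot> c = h" using c T by (auto simp: rmorphism_def)
  define n where "n = c \<boxplus> \<boxminus> Idn C ?D"
  have n: "n \<in> Hom C ?D ?D" using T c by (simp add: n_def)
  have "n \<cdot> g = Zer C (Tgt C f) ?D" using T c by (simp add: n_def)
  then obtain s where s: "s \<in> Hom C (FOb \<Sigma> (Src C f)) ?D" "s \<cdot> h = n"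
    using RT_weak_cokernel2[OF t n] by blast
  have "h \<cdot> n = Zer C ?D (FOb \<Sigma> (Src C f))" using T c by (simp add: n_def)
  then have "n \<cdot> n = Zer C ?D ?D"
    using T s(1) n comp_assoc_arr[of n h s] by (simp add: s(2))
  moreover have "c = Idn C ?D \<boxplus> n"
    using c T n by (intro diff_eqD[of _ ?D ?D]) (auto simp: n_def)
  ultimately show ?thesis using c n by (intro iso_arrow_unipotent[of c ?D n]) auto
qed

text \<open>The inverses of \<open>a\<close> and \<open>b\<close> extend to a morphism back, with
  third component \<open>c'\<close>. Both \<open>c' \<cdot> c\<close> and
  \<open>c \<cdot> c'\<close> lie over identities, so they are invertible by the preceding lemma;
  \<open>c'\<close> itself need not be the inverse.\<close>

lemma RT_five_lemma:
  assumes t: "(f, g, h) \<in> RT" "(f', g', h') \<in> RT"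
    and m: "rmorphism C \<Sigma> (a, b, c) (f, g, h) (f', g', h')" and i: "iso_arrow C a" "iso_arrow C b"
  shows "iso_arrow C c"
proof -
  note T = RT_arr[OF t(1)] RT_arr[OF t(2)]
  note d = tri_diagram[OF t(1)] tri_diagram[OF t(2)]
  from m have h: "a \<in> Hom C (Src C f) (Src C f')" "b \<in> Hom C (Tgt C f) (Tgt C f')"
      "c \<in> Hom C (Tgt C g) (Tgt C g')" and e: "f' \<cdot> a = b \<cdot> f"
    by (auto simp: rmorphism_def)
  obtain a' where a': "a' \<in> Hom C (Src C f') (Src C f)" "a' \<cdot> a = Idn C (Src C f)"
    "a \<cdot> a' = Idn C (Src C f')"
    using iso_arrowE[OF i(1) h(1)] by blast
  obtain b' where b': "b' \<in> Hom C (Tgt C f') (Tgt C f)" "b' \<cdot> b = Idn C (Tgt C f)"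
    "b \<cdot> b' = Idn C (Tgt C f')"
    using iso_arrowE[OF i(2) h(2)] by blast
  have "b' \<cdot> f' = f \<cdot> a'" using T h a' b' e by (intro inverse_square[of f _ _ f' _ _ a a' b]) auto
  then obtain c' where m': "rmorphism C \<Sigma> (a', b', c') (f', g', h') (f, g, h)"
    using tri_morphism[OF t(2,1)] a'(1) b'(1) by blast
  have "iso_arrow C (c' \<cdot> c)"
    using RT_endo_iso[OF t(1)] Sg.rmorphism_comp[OF d(1,2,1) m m'] a' b' by simp
  moreover have "iso_arrow C (c \<cdot> c')"
    using RT_endo_iso[OF t(2)] Sg.rmorphism_comp[OF d(2,1,2) m' m] a' b' by simp
  moreover have "c' \<in> Hom C (Tgt C g') (Tgt C g)" using m' by (simp add: rmorphism_def)
  ultimately show ?thesis using h(3) iso_arrow_of_comps by blast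
qed

lemma RT_ex_iso:
  assumes t: "(f, g, h) \<in> RT" "(f', g', h') \<in> RT"
    and ab: "a \<in> Hom C (Src C f) (Src C f')" "b \<in> Hom C (Tgt C f) (Tgt C f')" "b \<cdot> f = f' \<cdot> a"
    and i: "iso_arrow C a" "iso_arrow C b"
  obtains c where "rmorphism C \<Sigma> (a, b, c) (f, g, h) (f', g', h')" "iso_arrow C c"
  using tri_morphism[OF t ab] RT_five_lemma[OF t _ i] by blast

text \<open>\<Sigma>p is a left inverse of \<Sigma>i, and the composite of \<open>h\<close> with
  \<Sigma>i vanishes in every triangle.\<close>

lemma RT_split_first:
  assumes t: "(i, g, h) \<in> RT" and p: "p \<in> Hom C (Tgt C i) (Src C i)" "p \<cdot> i = Idn C (Src C i)"
  shows "h = Zer C (Tgt C g) (FOb \<Sigma> (Src C i))"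
proof -
  note T = RT_arr[OF t]
  have "FAr \<Sigma> p \<cdot> FAr \<Sigma> i = FAr \<Sigma> (p \<cdot> i)" using T p(1) by simp
  then have "FAr \<Sigma> p \<cdot> FAr \<Sigma> i = Idn C (FOb \<Sigma> (Src C i))" using T p by simp
  then have "h = FAr \<Sigma> p \<cdot> (FAr \<Sigma> i \<cdot> h)" using T p by (simp add: comp_eq_comp)
  then show ?thesis using RT_comp_zero3[OF t] T p by simp
qed

text \<open>The complement \<open>1 - i p\<close> of the idempotent given by \<open>p\<close> kills
  \<open>i\<close>, so it factors as \<open>j \<cdot> g\<close>; this \<open>j\<close> is the second
  injection. The remaining identities are verified after composing with \<open>g\<close>.\<close>

lemma RT_split_biproduct:
  assumes t: "(i, g, h) \<in> RT" and p: "p \<in> Hom C (Tgt C i) (Src C i)" "p \<cdot> i = Idn C (Src C i)"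
  obtains j where "biproduct_data C (Src C i) (Tgt C g) (Tgt C i) i j p g"
proof -
  note T = RT_arr[OF t]
  have h: "h = Zer C (Tgt C g) (FOb \<Sigma> (Src C i))" using RT_split_first[OF t p] .
  \<comment> \<open>An arrow killed by \<open>g\<close> factors through \<open>h\<close>, which is
    zero here, so \<open>g\<close> is an epimorphism.\<close>
  have epi: "x = Zer C (Tgt C g) W" if x: "x \<in> Hom C (Tgt C g) W" "x \<cdot> g = Zer C (Tgt C i) W" for x W
  proof -
    obtain s where "s \<in> Hom C (FOb \<Sigma> (Src C i)) W" "s \<cdot> h = x"
      using RT_weak_cokernel2[OF t x] by blast
    then show ?thesis using T h by auto
  qed
  let ?r = "Idn C (Tgt C i) \<boxplus> \<boxminus> (i \<cdot> p)"
  have "?r \<cdot> i = Zer C (Src C i) (Tgt C i)" using T p by simp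
  then obtain j where j: "j \<in> Hom C (Tgt C g) (Tgt C i)" "j \<cdot> g = ?r"
    using RT_weak_cokernel[OF t, of ?r "Tgt C i"] T p by auto
  have "(g \<cdot> j \<boxplus> \<boxminus> Idn C (Tgt C g)) \<cdot> g = Zer C (Tgt C i) (Tgt C g)"
    using T p j(1) by (simp add: j(2) RT_comp_zero[OF t, THEN comp_eq_comp])
  then have "g \<cdot> j \<boxplus> \<boxminus> Idn C (Tgt C g) = Zer C (Tgt C g) (Tgt C g)"
    using T j(1) by (intro epi) auto
  then have gj: "g \<cdot> j = Idn C (Tgt C g)" using T j(1) by - (rule diff_eq_Zer, auto)
  have "(p \<cdot> j) \<cdot> g = Zer C (Tgt C i) (Src C i)"
    using T p j(1) by (simp add: j(2) p(2)[THEN comp_eq_comp])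
  then have pj: "p \<cdot> j = Zer C (Tgt C g) (Src C i)" using T p j(1) by (intro epi) auto
  have "i \<cdot> p \<boxplus> j \<cdot> g = Idn C (Tgt C i)"
    using T p by (simp add: j(2) Plus_left_comm[of "i \<cdot> p"])
  then show thesis
    using that[of j] T p j(1) gj pj RT_comp_zero[OF t] by (simp add: biproduct_data_def)
qed

text \<open>Any triangle completing \<open>i\<close> also exhibits \<open>P\<close> as a biproduct
  with the same \<open>i\<close> and \<open>p\<close>. The two complements are identified by
  \<open>q \<cdot> k\<close>, with inverse \<open>g \<cdot> j\<close>, and the triangle is
  transported along this isomorphism.\<close>

lemma RT_biproduct:
  assumes b: "biproduct_data C A B P i j p q"
  shows "(i, q, Zer C B (FOb \<Sigma> A)) \<in> RT"
proof -
  note b = biproduct_dataD[OF b]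
  have T': "i \<in> Arr C" using b by simp
  then obtain g h where t: "(i, g, h) \<in> RT" using tri_ex by blast
  note T = RT_arr[OF t]
  obtain k where k: "biproduct_data C A (Tgt C g) P i k p g"
    using RT_split_biproduct[OF t, of p] b by auto
  note k = biproduct_dataD[OF k]
  have h: "h = Zer C (Tgt C g) (FOb \<Sigma> A)" using RT_split_first[OF t, of p] b by simp
  have q: "q = q \<cdot> k \<cdot> g"
  proof -
    have "q = q \<cdot> (i \<cdot> p \<boxplus> k \<cdot> g)" using b(4) k(9) by simp
    also have "\<dots> = q \<cdot> k \<cdot> g"
      using b(1-4,7,10-) k(1-4,10-) by (simp add: b(7)[THEN comp_eq_comp])
    finally show ?thesis .
  qed
  have g: "g = g \<cdot> j \<cdot> q"
  proof -
    have "g = g \<cdot> (i \<cdot> p \<boxplus> j \<cdot> q)" using k(4) b(9) by simp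
    also have "\<dots> = g \<cdot> j \<cdot> q"
      using b(1-4,10-) k(1-4,7,10-) by (simp add: k(7)[THEN comp_eq_comp])
    finally show ?thesis .
  qed
  have "(q \<cdot> k) \<cdot> (g \<cdot> j) = q \<cdot> j" using arg_cong[OF q, of "\<lambda>x. x \<cdot> j"] b(1-4) k(1-4) by simp
  moreover have "(g \<cdot> j) \<cdot> (q \<cdot> k) = g \<cdot> k" using arg_cong[OF g, of "\<lambda>x. x \<cdot> k"] b(1-4) k(1-4) by simp
  ultimately have iso: "iso_arrow C (q \<cdot> k)"
    using b k by (intro iso_arrowI[of _ "Tgt C g" B "g \<cdot> j"]) auto
  show ?thesis
  proof (rule RT_isoI[OF t])
    show "rdiagram C \<Sigma> i q (Zer C B (FOb \<Sigma> A))" using b by (simp add: rdiagram_def)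
    show "rmorphism C \<Sigma> (Idn C A, Idn C P, q \<cdot> k) (i, g, h) (i, q, Zer C B (FOb \<Sigma> A))"
      using b k q h by (auto simp: rmorphism_def)
  qed (use b iso in auto)
qed

end

section \<open>Left triangulations: weak kernels and vanishing composites\<close>

context left_triangulation
begin

lemma LT_arr:
  assumes "(e, f, g) \<in> LT"
  shows "e \<in> Arr C" "f \<in> Arr C" "g \<in> Arr C" "Src C f = Tgt C e" "Src C g = Tgt C f"
    "Src C e = FOb \<Omega> (Tgt C g)"
  using LT_diagram[OF assms] by (auto simp: ldiagram_def)

text \<open>Dual to the weak cokernel property: the comparison now starts from the trivial left
  triangle on \<open>W\<close>.\<close>

lemma LT_weak_kernel:
  assumes t: "(e, f, g) \<in> LT" and b: "b \<in> Hom C W (Src C g)" "g \<cdot> b = Zer C W (Tgt C g)"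
  obtains a where "a \<in> Hom C W (Src C f)" "f \<cdot> a = b"
proof -
  obtain N where N: "zero_object C N" using ex_zero_object by blast
  then have NO: "N \<in> Obj C" by (simp add: zero_object_iff)
  have W: "W \<in> Obj C" using Hom_objD b(1) by blast
  note T = LT_arr[OF t]
  have "\<exists>a. lmorphism C \<Omega> (a, b, Zer C N (Tgt C g)) (Zer C (FOb \<Omega> N) W, Idn C W, Zer C W N) (e, f, g)"
    using T b NO W by (intro LTR3[OF LTR1_id[OF N W] t]) simp_all
  then show thesis using that T b NO W by (auto simp: lmorphism_def)
qed

lemma LT_weak_kernel2:
  assumes t: "(e, f, g) \<in> LT" and b: "b \<in> Hom C W (Src C f)" "f \<cdot> b = Zer C W (Tgt C f)"
  obtains a where "a \<in> Hom C W (FOb \<Omega> (Tgt C g))" "e \<cdot> a = b"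
  using LT_weak_kernel[OF LTR2[OF t] b(1)] b(2) LT_arr[OF t] by auto

lemma LT_isoI:
  assumes "(e, f, g) \<in> LT" "ldiagram C \<Omega> e' f' g'"
    "lmorphism C \<Omega> (a, b, c) (e, f, g) (e', f', g')" "iso_arrow C a" "iso_arrow C b" "iso_arrow C c"
  shows "(e', f', g') \<in> LT"
  using LT_iso_closed[OF assms(1,2)] assms(3-) unfolding lisomorphic_def by blast

lemma LT_comp_zero:
  assumes t: "(e, f, g) \<in> LT"
  shows "f \<cdot> e = Zer C (FOb \<Omega> (Tgt C g)) (Tgt C f)"
proof -
  obtain N where N: "zero_object C N" using ex_zero_object by blast
  then have NO: "N \<in> Obj C" by (simp add: zero_object_iff)
  \<comment> \<open>The statement about the last two arrows of a left triangle is proved for all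
    triangles and then applied to the rotated one, whose last two arrows are \<open>e\<close> and
    \<open>f\<close>.\<close>
  have main: "g' \<cdot> f' = Zer C (Src C f') (Tgt C g')" if t': "(e', f', g') \<in> LT" for e' f' g'
  proof -
    note T = LT_arr[OF t']
    have A: "Tgt C g' \<in> Obj C" using T by simp
    have "\<exists>a. lmorphism C \<Omega> (a, g', Idn C (Tgt C g')) (e', f', g')
        (\<boxminus> FAr \<Omega> (Zer C (Tgt C g') N), Zer C (FOb \<Omega> N) (Tgt C g'), Idn C (Tgt C g'))"
      using T NO by (intro LTR3[OF t' LTR2[OF LTR1_id[OF N A]]]) simp_all
    then show ?thesis using T NO by (auto simp: lmorphism_def)
  qed
  show ?thesis using main[OF LTR2[OF t]] LT_arr[OF t] by simp
qed

end

section \<open>Right triangulations whose suspension is an equivalence\<close>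

text \<open>The equivalence is required in the form in which the quotient delivers it: fullness and
  faithfulness, and essential surjectivity. The quasi-inverse is built from these below.\<close>

locale stable_right_triangulation = right_triangulation +
  assumes Sigma_full: "A \<in> Obj C \<Longrightarrow> B \<in> Obj C \<Longrightarrow> k \<in> Hom C (FOb \<Sigma> A) (FOb \<Sigma> B) \<Longrightarrow>
      \<exists>f \<in> Hom C A B. FAr \<Sigma> f = k"
    and Sigma_faithful: "f \<in> Hom C A B \<Longrightarrow> FAr \<Sigma> f = Zer C (FOb \<Sigma> A) (FOb \<Sigma> B) \<Longrightarrow> f = Zer C A B"
    and Sigma_essentially_surjective: "B \<in> Obj C \<Longrightarrow> \<exists>A \<in> Obj C. isomorphic C (FOb \<Sigma> A) B"
begin

lemma Sigma_inj:
  assumes "f \<in> Hom C A B" "g \<in> Hom C A B" "FAr \<Sigma> f = FAr \<Sigma> g"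
  shows "f = g"
proof -
  have O: "A \<in> Obj C" "B \<in> Obj C" using Hom_objD[OF assms(1)] by auto
  have "FAr \<Sigma> (f \<boxplus> \<boxminus> g) = Zer C (FOb \<Sigma> A) (FOb \<Sigma> B)" using assms O by simp
  then have "f \<boxplus> \<boxminus> g = Zer C A B" using assms O by (intro Sigma_faithful[of _ A B]) auto
  then show ?thesis using diff_eq_Zer[of f g] assms(1,2) by simp
qed

lemma Sigma_reflects_iso:
  assumes f: "f \<in> Hom C A B" and i: "iso_arrow C (FAr \<Sigma> f)"
  shows "iso_arrow C f"
proof -
  have O: "A \<in> Obj C" "B \<in> Obj C" using Hom_objD[OF f] by auto
  obtain k where k: "k \<in> Hom C (FOb \<Sigma> B) (FOb \<Sigma> A)" "k \<cdot> FAr \<Sigma> f = Idn C (FOb \<Sigma> A)"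
    "FAr \<Sigma> f \<cdot> k = Idn C (FOb \<Sigma> B)"
    using iso_arrowE[OF i, of "FOb \<Sigma> A" "FOb \<Sigma> B"] f by auto
  obtain g where g: "g \<in> Hom C B A" "FAr \<Sigma> g = k" using Sigma_full[OF O(2,1) k(1)] by blast
  have "g \<cdot> f = Idn C A" using f g k O by - (rule Sigma_inj[of _ A A], auto)
  moreover have "f \<cdot> g = Idn C B" using f g k O by - (rule Sigma_inj[of _ B B], auto)
  ultimately show ?thesis using f g by (intro iso_arrowI[of f A B g]) auto
qed

text \<open>Complete \<open>f\<close> to a triangle and rotate it three times; rotate the given
  triangle twice more. Both now begin with -\<Sigma>f and -\<Sigma>(second arrow), so (RTR3) and the
  five lemma give an isomorphism of third terms over the identities. Fullness writes it as
  \<Sigma>k, and faithfulness brings the equations down to \<open>k\<close>, which identifies the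
  completed triangle with \<open>(f, g, h)\<close>.\<close>

lemma RT_rotate_back:
  assumes d: "rdiagram C \<Sigma> f g h" and t: "(g, h, \<boxminus> FAr \<Sigma> f) \<in> RT"
  shows "(f, g, h) \<in> RT"
proof -
  let ?A = "Src C f" and ?B = "Tgt C f" and ?D = "Tgt C g"
  have T: "f \<in> Arr C" "g \<in> Arr C" "h \<in> Arr C" "Src C g = ?B" "Src C h = ?D" "Tgt C h = FOb \<Sigma> ?A"
    using d by (auto simp: rdiagram_def)
  obtain g' h' where t': "(f, g', h') \<in> RT" using RTR1_ex T by blast
  note T' = RT_arr[OF t']
  have r: "(\<boxminus> FAr \<Sigma> f, \<boxminus> FAr \<Sigma> g, \<boxminus> FAr \<Sigma> h) \<in> RT" using RTR2[OF RTR2[OF t]] .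
  have r': "(\<boxminus> FAr \<Sigma> f, \<boxminus> FAr \<Sigma> g', \<boxminus> FAr \<Sigma> h') \<in> RT" using RTR2[OF RTR2[OF RTR2[OF t']]] .
  have "\<exists>c. rmorphism C \<Sigma> (Idn C (FOb \<Sigma> ?A), Idn C (FOb \<Sigma> ?B), c)
      (\<boxminus> FAr \<Sigma> f, \<boxminus> FAr \<Sigma> g', \<boxminus> FAr \<Sigma> h') (\<boxminus> FAr \<Sigma> f, \<boxminus> FAr \<Sigma> g, \<boxminus> FAr \<Sigma> h)"
    using T by (intro RTR3[OF r' r]) auto
  then obtain c where m: "rmorphism C \<Sigma> (Idn C (FOb \<Sigma> ?A), Idn C (FOb \<Sigma> ?B), c)
      (\<boxminus> FAr \<Sigma> f, \<boxminus> FAr \<Sigma> g', \<boxminus> FAr \<Sigma> h') (\<boxminus> FAr \<Sigma> f, \<boxminus> FAr \<Sigma> g, \<boxminus> FAr \<Sigma> h)"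
    by blast
  have ci: "iso_arrow C c" using RT_five_lemma[OF r' r m] T by simp
  have c: "c \<in> Hom C (FOb \<Sigma> (Tgt C g')) (FOb \<Sigma> ?D)" "\<boxminus> (c \<cdot> FAr \<Sigma> g') = \<boxminus> FAr \<Sigma> g"
    "\<boxminus> FAr \<Sigma> h' = \<boxminus> (FAr \<Sigma> h \<cdot> c)"
    using m T T' by (auto simp: rmorphism_def)
  obtain k where k: "k \<in> Hom C (Tgt C g') ?D" "FAr \<Sigma> k = c"
    using Sigma_full[of "Tgt C g'" ?D c] T T' c(1) by auto
  have ki: "iso_arrow C k" using Sigma_reflects_iso k ci by blast
  have "FAr \<Sigma> (k \<cdot> g') = FAr \<Sigma> g"
    using T T' k c(1) arg_cong[OF c(2), of "\<lambda>x. \<boxminus> x"] by simp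
  then have 1: "k \<cdot> g' = g" using T T' k by - (rule Sigma_inj[of _ ?B ?D], auto)
  have "FAr \<Sigma> h' = FAr \<Sigma> (h \<cdot> k)"
    using T T' k c(1) arg_cong[OF c(3), of "\<lambda>x. \<boxminus> x"] by simp
  then have 2: "h' = h \<cdot> k" using T T' k by - (rule Sigma_inj[of _ "Tgt C g'" "FOb \<Sigma> ?A"], auto)
  show ?thesis
  proof (rule RT_isoI[OF t' d])
    show "rmorphism C \<Sigma> (Idn C ?A, Idn C ?B, k) (f, g', h') (f, g, h)"
      using T T' k 1 2 by (auto simp: rmorphism_def)
  qed (use T ki in auto)
qed

text \<open>On objects the quasi-inverse \<open>G\<close> and the isomorphisms \<open>ep\<close>
  from \<Sigma>(G B) to B are chosen together; on arrows \<open>H f\<close> is the arrow whose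
  suspension corresponds to \<open>f\<close> under \<open>ep\<close>.\<close>

lemma Sigma_autoequivalence: "autoequivalence C \<Sigma>"
proof -
  define P where "P = (\<lambda>B (A, k). A \<in> Obj C \<and> k \<in> Hom C (FOb \<Sigma> A) B \<and> iso_arrow C k)"
  define G where "G B = fst (SOME x. P B x)" for B
  define ep where "ep B = snd (SOME x. P B x)" for B
  have ep: "G B \<in> Obj C" "ep B \<in> Hom C (FOb \<Sigma> (G B)) B" "iso_arrow C (ep B)" if B: "B \<in> Obj C" for B
  proof -
    obtain A k where "A \<in> Obj C" "k \<in> Hom C (FOb \<Sigma> A) B" "iso_arrow C k"
      using Sigma_essentially_surjective[OF B] by (auto simp: isomorphic_def)
    then have "P B (A, k)" by (simp add: P_def)
    then have "P B (SOME x. P B x)" by (rule someI)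
    then show "G B \<in> Obj C" "ep B \<in> Hom C (FOb \<Sigma> (G B)) B" "iso_arrow C (ep B)"
      by (auto simp: P_def G_def ep_def split_beta)
  qed
  define Q where "Q f k \<longleftrightarrow> k \<in> Hom C (G (Src C f)) (G (Tgt C f)) \<and>
    ep (Tgt C f) \<cdot> FAr \<Sigma> k = f \<cdot> ep (Src C f)" for f k
  define H where "H f = (SOME k. Q f k)" for f
  have H: "H f \<in> Hom C (G A) (G B)" "ep B \<cdot> FAr \<Sigma> (H f) = f \<cdot> ep A" if f: "f \<in> Hom C A B" for f A B
  proof -
    have O: "A \<in> Obj C" "B \<in> Obj C" using Hom_objD[OF f] by auto
    obtain u where u: "u \<in> Hom C B (FOb \<Sigma> (G B))" "ep B \<cdot> u = Idn C B"
      using iso_arrowE[OF ep(3,2)[OF O(2)]] by blast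
    obtain k where "k \<in> Hom C (G A) (G B)" "FAr \<Sigma> k = u \<cdot> f \<cdot> ep A"
      using Sigma_full[OF ep(1)[OF O(1)] ep(1)[OF O(2)], of "u \<cdot> f \<cdot> ep A"] u f ep[OF O(1)] by auto
    then have "Q f k" using f u(1) ep[OF O(1)] ep[OF O(2)] by (simp add: Q_def u(2)[THEN comp_eq_comp])
    then have "Q f (H f)" unfolding H_def by (rule someI)
    then show "H f \<in> Hom C (G A) (G B)" "ep B \<cdot> FAr \<Sigma> (H f) = f \<cdot> ep A" using f by (auto simp: Q_def)
  qed
  \<comment> \<open>By faithfulness and invertibility of \<open>ep\<close>, an arrow between values
    of \<open>G\<close> is determined by its composite with \<open>ep\<close>. Functoriality of
    \<open>H\<close> thus becomes an equation of such composites.\<close>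
  have uniq: "k = k'" if "k \<in> Hom C (G A) (G B)" "k' \<in> Hom C (G A) (G B)" "B \<in> Obj C"
      "ep B \<cdot> FAr \<Sigma> k = ep B \<cdot> FAr \<Sigma> k'" for k k' A B
    using that ep[OF that(3)]
    by - (rule Sigma_inj[OF that(1,2)],
      rule iso_arrow_cancel_left[of "ep B" "FOb \<Sigma> (G B)" B _ "FOb \<Sigma> (G A)"], auto)
  let ?G = "\<lparr>FOb = G, FAr = H\<rparr>"
  have "endofunctor C ?G"
    unfolding endofunctor_def
  proof (intro conjI ballI impI; simp only: endofun.select_convs)
    fix A assume A: "A \<in> Obj C"
    show "G A \<in> Obj C" using ep A by blast
    show "H (Idn C A) = Idn C (G A)"
      using H[of "Idn C A" A A] A ep[OF A] by - (rule uniq[of _ A A], auto)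
  next
    fix f assume f: "f \<in> Arr C"
    then show "H f \<in> Hom C (G (Src C f)) (G (Tgt C f))" by (intro H) auto
    fix g assume g: "g \<in> Arr C" "Src C g = Tgt C f"
    have O: "Src C f \<in> Obj C" "Tgt C f \<in> Obj C" "Tgt C g \<in> Obj C" using f g by auto
    note Hf = H[of f "Src C f" "Tgt C f"] and Hg = H[of g "Tgt C f" "Tgt C g"]
    have "ep (Tgt C g) \<cdot> FAr \<Sigma> (H g \<cdot> H f) = g \<cdot> f \<cdot> ep (Src C f)"
      using f g Hf Hg ep[OF O(1)] ep[OF O(2)] ep[OF O(3)] by (simp add: Hg(2)[THEN comp_eq_comp])
    then show "H (g \<cdot> f) = H g \<cdot> H f"
      using H[of "g \<cdot> f" "Src C f" "Tgt C g"] f g Hf Hg O ep[OF O(1)]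
      by - (rule uniq[of _ "Src C f" "Tgt C g"], auto)
  qed
  moreover have "naturally_isomorphic C (comp_fun \<Sigma> ?G) id_fun"
    unfolding naturally_isomorphic_def comp_fun_def id_fun_def
    using ep H by (intro exI[of _ ep]) (auto simp del: Hom_iff simp add: Hom_def)
  moreover have "naturally_isomorphic C (comp_fun ?G \<Sigma>) id_fun"
  proof -
    \<comment> \<open>The second natural isomorphism is the preimage under \<Sigma> of
      \<open>ep\<close> at \<Sigma>A, which fullness provides.\<close>
    have "\<exists>k \<in> Hom C (G (FOb \<Sigma> A)) A. FAr \<Sigma> k = ep (FOb \<Sigma> A)" if "A \<in> Obj C" for A
      using that ep[of "FOb \<Sigma> A"] by (intro Sigma_full) auto
    then obtain eta where eta: "\<And>A. A \<in> Obj C \<Longrightarrow> eta A \<in> Hom C (G (FOb \<Sigma> A)) A"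
        "\<And>A. A \<in> Obj C \<Longrightarrow> FAr \<Sigma> (eta A) = ep (FOb \<Sigma> A)"
      by metis
    have "iso_arrow C (eta A)" if "A \<in> Obj C" for A
      using eta[OF that] ep(3)[of "FOb \<Sigma> A"] that by (intro Sigma_reflects_iso[OF eta(1)]) auto
    moreover have "eta (Tgt C f) \<cdot> H (FAr \<Sigma> f) = f \<cdot> eta (Src C f)" if f: "f \<in> Arr C" for f
    proof -
      have O: "Src C f \<in> Obj C" "Tgt C f \<in> Obj C" using f by auto
      note Hf = H[of "FAr \<Sigma> f" "FOb \<Sigma> (Src C f)" "FOb \<Sigma> (Tgt C f)"]
      show ?thesis
        using f Hf eta[OF O(1)] eta[OF O(2)]
        by - (rule Sigma_inj[of _ "G (FOb \<Sigma> (Src C f))" "Tgt C f"], auto)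
    qed
    ultimately show ?thesis
      unfolding naturally_isomorphic_def comp_fun_def id_fun_def
      using eta(1) by (intro exI[of _ eta]) (auto simp del: Hom_iff simp add: Hom_def)
  qed
  ultimately show ?thesis
    using Sigma_additive unfolding autoequivalence_def additive_endofunctor_def by blast
qed

text \<open>The rotated trivial triangle has \<Sigma>N as third term; this is a zero object too and
  may be exchanged for \<open>N\<close>.\<close>

lemma RT_identity:
  assumes N: "zero_object C N" and A: "A \<in> Obj C"
  shows "(Idn C A, Zer C A N, Zer C N (FOb \<Sigma> A)) \<in> RT"
proof (rule RT_isoI[OF RTR2[OF RTR1_id[OF N A]]])
  have O: "N \<in> Obj C" "FOb \<Sigma> N \<in> Obj C" and id: "Idn C N = Zer C N N"
    "Idn C (FOb \<Sigma> N) = Zer C (FOb \<Sigma> N) (FOb \<Sigma> N)"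
    using N Sg.FOb_zero_object[OF N] by (auto simp: zero_object_iff)
  show "rdiagram C \<Sigma> (Idn C A) (Zer C A N) (Zer C N (FOb \<Sigma> A))"
    using A O by (simp add: rdiagram_def)
  show "rmorphism C \<Sigma> (Idn C A, Idn C A, Zer C (FOb \<Sigma> N) N)
      (Idn C A, Zer C A (FOb \<Sigma> N), \<boxminus> FAr \<Sigma> (Zer C N A)) (Idn C A, Zer C A N, Zer C N (FOb \<Sigma> A))"
    using A O by (simp add: rmorphism_def)
  show "iso_arrow C (Zer C (FOb \<Sigma> N) N)"
    using O id by (intro iso_arrowI[of _ "FOb \<Sigma> N" N "Zer C N (FOb \<Sigma> N)"]) auto
qed (use A in auto)

text \<open>(RTR4) wants a triangle with \<open>g\<close> in second position. Since \<Sigma> is an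
  equivalence, the cone of \<open>g\<close> is a suspension up to the isomorphism
  \<open>\<theta>\<close>, and rotating back yields a triangle
  \<open>(l, g, \<theta> \<cdot> g1)\<close>. (RTR4) for the factorization of
  \<open>g \<cdot> f\<close> then gives a triangle starting with \<open>f1 \<cdot> l\<close>; its
  rotation, read along \<open>\<theta>'\<close>, is the required one.\<close>

lemma RT_octahedron:
  assumes t: "(f, f1, f2) \<in> RT" "(g, g1, g2) \<in> RT" "(g \<cdot> f, k1, k2) \<in> RT"
    and gf: "Src C g = Tgt C f"
  shows "\<exists>u \<in> Hom C (Tgt C f1) (Tgt C k1). \<exists>v \<in> Hom C (Tgt C k1) (Tgt C g1).
        (u, v, FAr \<Sigma> f1 \<cdot> g2) \<in> RT \<and>
        u \<cdot> f1 = k1 \<cdot> g \<and> k2 \<cdot> u = f2 \<and> v \<cdot> k1 = g1 \<and> g2 \<cdot> v = FAr \<Sigma> f \<cdot> k2"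
proof -
  let ?X = "Src C f" and ?Y = "Tgt C f" and ?W = "Tgt C g"
    and ?V = "Tgt C g1" and ?U = "Tgt C k1" and ?R = "Tgt C f1"
  note T = RT_arr[OF t(1)] RT_arr[OF t(2)] gf
  have Tk: "k1 \<in> Hom C ?W ?U" "k2 \<in> Hom C ?U (FOb \<Sigma> ?X)"
    using RT_arr[OF t(3)] T by auto
  obtain A \<theta>' where A: "A \<in> Obj C" "\<theta>' \<in> Hom C (FOb \<Sigma> A) ?V" "iso_arrow C \<theta>'"
    using Sigma_essentially_surjective[of ?V] T by (auto simp: isomorphic_def)
  obtain \<theta> where th: "\<theta> \<in> Hom C ?V (FOb \<Sigma> A)" "\<theta> \<cdot> \<theta>' = Idn C (FOb \<Sigma> A)" "\<theta>' \<cdot> \<theta> = Idn C ?V"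
    "iso_arrow C \<theta>"
    using iso_arrowE[OF A(3,2)] by blast
  \<comment> \<open>The sign makes the third arrow of the rotated triangle, -\<Sigma>l, equal to
    \<open>g2 \<cdot> \<theta>'\<close>. The same sign turns the sum relation of (RTR4) into the
    last equation of the octahedral axiom.\<close>
  obtain l where l: "l \<in> Hom C A ?Y" "FAr \<Sigma> l = \<boxminus> (g2 \<cdot> \<theta>')"
    using Sigma_full[of A ?Y "\<boxminus> (g2 \<cdot> \<theta>')"] T A by auto
  have "(g, \<theta> \<cdot> g1, \<boxminus> FAr \<Sigma> l) \<in> RT"
  proof (rule RT_isoI[OF t(2)])
    show "rdiagram C \<Sigma> g (\<theta> \<cdot> g1) (\<boxminus> FAr \<Sigma> l)" using T A th l by (simp add: rdiagram_def)
    show "rmorphism C \<Sigma> (Idn C ?Y, Idn C ?W, \<theta>) (g, g1, g2) (g, \<theta> \<cdot> g1, \<boxminus> FAr \<Sigma> l)"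
      using T A th l by (simp add: rmorphism_def)
  qed (use T th in auto)
  then have t': "(l, g, \<theta> \<cdot> g1) \<in> RT"
    using T th l by - (rule RT_rotate_back, auto simp: rdiagram_def)
  obtain u w where u: "u \<in> Hom C ?R ?U" and w: "w \<in> Hom C ?U (FOb \<Sigma> A)"
    and e: "w \<cdot> k1 = \<theta> \<cdot> g1" "k2 \<cdot> u = f2" "u \<cdot> f1 = k1 \<cdot> g"
      "FAr \<Sigma> f \<cdot> k2 \<boxplus> FAr \<Sigma> l \<cdot> w = Zer C ?U (FOb \<Sigma> ?Y)" "(f1 \<cdot> l, u, w) \<in> RT"
    using RTR4[OF t(3,1) t'] T l by auto
  define v where "v = \<theta>' \<cdot> w"
  have v: "v \<in> Hom C ?U ?V" using w A by (simp add: v_def)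
  have "(u, v, FAr \<Sigma> f1 \<cdot> g2) \<in> RT"
  proof (rule RT_isoI[OF RTR2[OF e(5)]])
    show "rdiagram C \<Sigma> u v (FAr \<Sigma> f1 \<cdot> g2)" using T u v by (simp add: rdiagram_def)
    show "rmorphism C \<Sigma> (Idn C ?R, Idn C ?U, \<theta>') (u, w, \<boxminus> FAr \<Sigma> (f1 \<cdot> l)) (u, v, FAr \<Sigma> f1 \<cdot> g2)"
      using T A u w l Tk by (simp add: rmorphism_def v_def)
  qed (use T u A Tk in auto)
  moreover have "v \<cdot> k1 = g1"
    using T A th w Tk by (simp add: v_def e(1) th(3)[THEN comp_eq_comp])
  moreover have "g2 \<cdot> v = FAr \<Sigma> f \<cdot> k2"
    using T A Tk w l e(4) diff_eq_Zer[of "FAr \<Sigma> f \<cdot> k2" "g2 \<cdot> v"] by (simp add: v_def)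
  ultimately show ?thesis using u v e(2,3) by blast
qed

theorem triangulated: "triangulated_category C \<Sigma> RT"
proof unfold_locales
  show "rdiagram C \<Sigma> f g h \<Longrightarrow> (f, g, h) \<in> RT \<longleftrightarrow> (g, h, \<boxminus> FAr \<Sigma> f) \<in> RT" for f g h
    using RTR2 RT_rotate_back by blast
qed (fact Sigma_additive Sigma_autoequivalence RT_diagram RT_iso_closed RT_identity RTR1_ex RTR3 |
    rule RT_octahedron; assumption)+

end

section \<open>Extensions in pseudo-triangulated categories\<close>

context preadditive_category
begin

lemma factors_throughI:
  assumes "X \<in> J" "u \<in> Hom C A X" "v \<in> Hom C X B" "f = v \<cdot> u"
  shows "factors_through C J f"
proof -
  have f: "f \<in> Arr C" "Src C f = A" "Tgt C f = B" using assms by auto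
  show ?thesis unfolding factors_through_def f(2,3) using assms f(1) by blast
qed

lemma factors_throughE:
  assumes "factors_through C J f" "f \<in> Hom C A B"
  obtains X u v where "X \<in> J" "u \<in> Hom C A X" "v \<in> Hom C X B" "f = v \<cdot> u"
proof -
  have f: "Src C f = A" "Tgt C f = B" using assms(2) by auto
  show thesis using assms(1) that unfolding factors_through_def f by blast
qed

lemma factors_through_comp:
  assumes "factors_through C J f"
  shows "g \<in> Arr C \<Longrightarrow> Src C g = Tgt C f \<Longrightarrow> factors_through C J (g \<cdot> f)"
    and "k \<in> Arr C \<Longrightarrow> Tgt C k = Src C f \<Longrightarrow> factors_through C J (f \<cdot> k)"
proof -
  obtain X u v where f: "X \<in> J" "u \<in> Hom C (Src C f) X" "v \<in> Hom C X (Tgt C f)" "f = v \<cdot> u"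
    using assms unfolding factors_through_def by blast
  show "factors_through C J (g \<cdot> f)" if "g \<in> Arr C" "Src C g = Tgt C f"
    by (rule factors_throughI[OF f(1), of u "Src C f" "g \<cdot> v" "Tgt C g"])
      (use f(2,3) that in \<open>simp, simp, subst f(4), simp\<close>)
  show "factors_through C J (f \<cdot> k)" if "k \<in> Arr C" "Tgt C k = Src C f"
    by (rule factors_throughI[OF f(1), of "u \<cdot> k" "Src C k" v "Tgt C f"])
      (use f(2,3) that in \<open>simp, simp, subst f(4), simp\<close>)
qed

text \<open>Both factorizations are routed through a biproduct of the two intermediate
  objects.\<close>

lemma factors_through_Plus:
  assumes J: "\<And>X Y. X \<in> J \<Longrightarrow> Y \<in> J \<Longrightarrow> \<exists>P \<in> J. \<exists>i j p q. biproduct_data C X Y P i j p q"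
    and f: "factors_through C J f" "factors_through C J g" "Src C g = Src C f" "Tgt C g = Tgt C f"
  shows "factors_through C J (f \<boxplus> g)"
proof -
  obtain X u v where f1: "X \<in> J" "u \<in> Hom C (Src C f) X" "v \<in> Hom C X (Tgt C f)" "f = v \<cdot> u"
    using f(1) unfolding factors_through_def by blast
  obtain Y u' v' where f2: "Y \<in> J" "u' \<in> Hom C (Src C f) Y" "v' \<in> Hom C Y (Tgt C f)" "g = v' \<cdot> u'"
    using f(2) unfolding factors_through_def f(3,4) by blast
  obtain P i j p q where P: "P \<in> J" "biproduct_data C X Y P i j p q" using J f1(1) f2(1) by blast
  note b = biproduct_dataD[OF P(2)]
  show ?thesis
  proof (rule factors_throughI[OF P(1)])
    show "i \<cdot> u \<boxplus> j \<cdot> u' \<in> Hom C (Src C f) P" "v \<cdot> p \<boxplus> v' \<cdot> q \<in> Hom C P (Tgt C f)"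
      using b f1(2,3) f2(2,3) by auto
    have "(v \<cdot> p \<boxplus> v' \<cdot> q) \<cdot> (i \<cdot> u \<boxplus> j \<cdot> u') = v \<cdot> u \<boxplus> v' \<cdot> u'"
      using b f1(2,3) f2(2,3) Hom_objD[OF f1(2)] Hom_objD[OF f1(3)] by (simp add: b(5-8)[THEN comp_eq_comp])
    then show "f \<boxplus> g = (v \<cdot> p \<boxplus> v' \<cdot> q) \<cdot> (i \<cdot> u \<boxplus> j \<cdot> u')" using f1(4) f2(4) by simp
  qed
qed

lemma biproduct_iso:
  assumes "biproduct_data C A B P i j p q" "biproduct_data C A B P' i' j' p' q'"
  shows "iso_arrow C (i' \<cdot> p \<boxplus> j' \<cdot> q)"
proof -
  note b = biproduct_dataD[OF assms(1)] and b' = biproduct_dataD[OF assms(2)]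
  have "(i \<cdot> p' \<boxplus> j \<cdot> q') \<cdot> (i' \<cdot> p \<boxplus> j' \<cdot> q) = i \<cdot> p \<boxplus> j \<cdot> q"
    using b(1-4,10-) b'(1-4,10-) by (simp add: b'(5-8)[THEN comp_eq_comp])
  moreover have "(i' \<cdot> p \<boxplus> j' \<cdot> q) \<cdot> (i \<cdot> p' \<boxplus> j \<cdot> q') = i' \<cdot> p' \<boxplus> j' \<cdot> q'"
    using b(1-4,10-) b'(1-4,10-) by (simp add: b(5-8)[THEN comp_eq_comp])
  ultimately show ?thesis
    using b b' by (intro iso_arrowI[of _ P P' "i \<cdot> p' \<boxplus> j \<cdot> q'"]) (simp_all only:, simp_all)
qed

end

context shifted_category
begin

lemma FAr_biproduct:
  assumes "biproduct_data C A B P i j p q"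
  shows "biproduct_data C (FOb F A) (FOb F B) (FOb F P) (FAr F i) (FAr F j) (FAr F p) (FAr F q)"
proof -
  note b = biproduct_dataD[OF assms]
  note c = b(1-4)[unfolded Hom_iff]
  have "FAr F p \<cdot> FAr F i = FAr F (p \<cdot> i)" "FAr F q \<cdot> FAr F j = FAr F (q \<cdot> j)"
    "FAr F q \<cdot> FAr F i = FAr F (q \<cdot> i)" "FAr F p \<cdot> FAr F j = FAr F (p \<cdot> j)"
    "FAr F i \<cdot> FAr F p \<boxplus> FAr F j \<cdot> FAr F q = FAr F (i \<cdot> p \<boxplus> j \<cdot> q)"
    using c by simp_all
  with b show ?thesis unfolding biproduct_data_def by simp
qed

lemma rmorphism_diff:
  assumes d: "rdiagram C F f g h" "rdiagram C F f' g' h'"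
    and m: "rmorphism C F (a, b, c) (f, g, h) (f', g', h')"
      "rmorphism C F (a1, b1, c1) (f, g, h) (f', g', h')"
  shows "rmorphism C F (a \<boxplus> \<boxminus> a1, b \<boxplus> \<boxminus> b1, c \<boxplus> \<boxminus> c1) (f, g, h) (f', g', h')"
  using d m by (simp add: rdiagram_def rmorphism_iff)

end

context additive_category
begin

text \<open>An additive functor preserves biproducts, so its values are closed under them up to the
  choice of biproduct.\<close>

lemma null_arrow_Plus:
  assumes "additive_endofunctor C F" and "null_arrow C F f" "null_arrow C F g"
    "Src C g = Src C f" "Tgt C g = Tgt C f"
  shows "null_arrow C F (f \<boxplus> g)"
proof -
  interpret shifted_category C F by unfold_locales (rule assms(1))
  show ?thesis unfolding null_arrow_def
  proof (rule factors_through_Plus)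
    fix X Y assume "X \<in> FOb F ` Obj C" "Y \<in> FOb F ` Obj C"
    then obtain A B where AB: "A \<in> Obj C" "B \<in> Obj C" "X = FOb F A" "Y = FOb F B" by blast
    obtain P where P: "biproduct C A B P" using ex_biproduct AB by blast
    then obtain i j p q where b: "biproduct_data C A B P i j p q" by (rule biproductE)
    show "\<exists>P\<in>FOb F ` Obj C. \<exists>i j p q. biproduct_data C X Y P i j p q"
      using FAr_biproduct[OF b] biproduct_dataD[OF b] AB by blast
  qed (use assms in \<open>auto simp: null_arrow_def\<close>)
qed

lemma null_arrow_Zer:
  assumes "additive_endofunctor C F" and "A \<in> Obj C" "B \<in> Obj C"
  shows "null_arrow C F (Zer C A B)"
proof -
  interpret shifted_category C F by unfold_locales (rule assms(1))
  show ?thesis unfolding null_arrow_def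
    using assms(2,3) by (intro factors_throughI[of "FOb F A" _ "Zer C A (FOb F A)" A "Zer C (FOb F A) B" B]) auto
qed

end

section \<open>The adjunction, the recognition of extensions, and homotopies\<close>

context pseudo_triangulated
begin

abbreviation "\<Sigma>o \<equiv> FOb (Sig C)"
abbreviation "\<Omega>o \<equiv> FOb (Ome C)"
abbreviation "\<Sigma>a \<equiv> FAr (Sig C)"
abbreviation "\<Omega>a \<equiv> FAr (Ome C)"

lemma Psi_hom:
  assumes "x \<in> Hom C (\<Omega>o A) B" "A \<in> Obj C" "B \<in> Obj C"
  shows "Psi C A B x \<in> Hom C A (\<Sigma>o B)"
  using Psi_bij[OF assms(2,3)] assms(1) by (blast dest: bij_betwE)

lemma Psi_inj:
  assumes "x \<in> Hom C (\<Omega>o A) B" "y \<in> Hom C (\<Omega>o A) B" "A \<in> Obj C" "B \<in> Obj C"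
    and "Psi C A B x = Psi C A B y"
  shows "x = y"
  using Psi_bij[OF assms(3,4)] assms(1,2,5) unfolding bij_betw_def by (blast dest: inj_onD)

lemma Psi_comp:
  assumes "x \<in> Hom C (\<Omega>o A) B" "A \<in> Obj C"
  shows "b \<in> Hom C B B' \<Longrightarrow> Psi C A B' (b \<cdot> x) = \<Sigma>a b \<cdot> Psi C A B x"
    and "a \<in> Hom C A' A \<Longrightarrow> Psi C A' B (x \<cdot> \<Omega>a a) = Psi C A B x \<cdot> a"
proof -
  have B: "B \<in> Obj C" using Hom_objD assms by blast
  note P = Psi_hom[OF assms B]
  show "Psi C A B' (b \<cdot> x) = \<Sigma>a b \<cdot> Psi C A B x" if b: "b \<in> Hom C B B'"
    using Psi_natural[of A B A B' x "Idn C A" b] assms B Hom_objD[OF b] b P by simp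
  show "Psi C A' B (x \<cdot> \<Omega>a a) = Psi C A B x \<cdot> a" if a: "a \<in> Hom C A' A"
    using Psi_natural[of A B A' B x a "Idn C B"] assms B Hom_objD[OF a] a P by simp
qed

text \<open>\<open>Psi\<close> is given as a natural bijection. Negation is composition with minus
  the identity, so naturality and additivity of \<Sigma> carry it across.\<close>

lemma Psi_Neg:
  assumes "x \<in> Hom C (\<Omega>o A) B" "A \<in> Obj C"
  shows "Psi C A B (\<boxminus> x) = \<boxminus> Psi C A B x"
proof -
  have B: "B \<in> Obj C" using Hom_objD assms by blast
  have x: "\<boxminus> x = \<boxminus> Idn C B \<cdot> x" using assms B by simp
  show ?thesis unfolding x
    using Psi_comp(1)[OF assms, of "\<boxminus> Idn C B" B] Psi_hom[OF assms B] assms B by simp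
qed

lemma Psi_inv_hom:
  assumes "y \<in> Hom C A (\<Sigma>o B)" "A \<in> Obj C" "B \<in> Obj C"
  shows "Psi_inv C A B y \<in> Hom C (\<Omega>o A) B" "Psi C A B (Psi_inv C A B y) = y"
  using Psi_bij[OF assms(2,3)] assms(1) unfolding Psi_inv_def bij_betw_def
  by (metis inv_into_into, metis f_inv_into_f)

lemma ext_tri:
  assumes "extension C e f g h"
  shows "(f, g, h) \<in> RTri C" "(e, f, g) \<in> LTri C" "h = \<boxminus> Psi C (Tgt C g) (Src C f) e"
  using assms by (auto simp: extension_def)

lemma ext_arr:
  assumes "extension C e f g h"
  shows "e \<in> Arr C" "f \<in> Arr C" "g \<in> Arr C" "h \<in> Arr C" "Src C g = Tgt C f" "Src C h = Tgt C g"
    "Tgt C h = \<Sigma>o (Src C f)" "Src C e = \<Omega>o (Tgt C g)" "Tgt C e = Src C f"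
  using RT_arr[OF ext_tri(1)[OF assms]] LT_arr[OF ext_tri(2)[OF assms]] by auto

lemma ext_diagram: "extension C e f g h \<Longrightarrow> rdiagram C (Sig C) f g h"
  using RT_diagram ext_tri(1) by blast

text \<open>Both sides of the \<Sigma>-equation are the images, under minus \<open>Psi\<close>, of
  the two sides of the \<Omega>-equation, and \<open>Psi\<close> is injective. Morphisms of
  extensions can therefore be built on either side.\<close>

lemma ext_morphism_iff:
  assumes x: "extension C e f g h" "extension C e' f' g' h'"
    and a: "a \<in> Hom C (Src C f) (Src C f')" and c: "c \<in> Hom C (Tgt C g) (Tgt C g')"
  shows "\<Sigma>a a \<cdot> h = h' \<cdot> c \<longleftrightarrow> a \<cdot> e = e' \<cdot> \<Omega>a c"
proof -
  let ?A = "Src C f" and ?D = "Tgt C g" and ?A' = "Src C f'" and ?D' = "Tgt C g'"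
  note X = ext_arr[OF x(1)] ext_arr[OF x(2)]
  have P: "Psi C ?D ?A e \<in> Hom C ?D (\<Sigma>o ?A)" "Psi C ?D' ?A' e' \<in> Hom C ?D' (\<Sigma>o ?A')"
    using X by (intro Psi_hom; simp)+
  have "\<Sigma>a a \<cdot> h = \<boxminus> Psi C ?D ?A' (a \<cdot> e)"
    using X P a Psi_comp(1)[of e ?D ?A a ?A'] by (simp add: ext_tri(3)[OF x(1)])
  moreover have "h' \<cdot> c = \<boxminus> Psi C ?D ?A' (e' \<cdot> \<Omega>a c)"
    using X P c Psi_comp(2)[of e' ?D' ?A' c ?D] by (simp add: ext_tri(3)[OF x(2)])
  moreover have "\<boxminus> Psi C ?D ?A' (a \<cdot> e) = \<boxminus> Psi C ?D ?A' (e' \<cdot> \<Omega>a c) \<longleftrightarrow> a \<cdot> e = e' \<cdot> \<Omega>a c"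
  proof
    have H: "a \<cdot> e \<in> Hom C (\<Omega>o ?D) ?A'" "e' \<cdot> \<Omega>a c \<in> Hom C (\<Omega>o ?D) ?A'" using X a c by auto
    have Q: "Psi C ?D ?A' (a \<cdot> e) \<in> Hom C ?D (\<Sigma>o ?A')" "Psi C ?D ?A' (e' \<cdot> \<Omega>a c) \<in> Hom C ?D (\<Sigma>o ?A')"
      using X H by (intro Psi_hom; simp)+
    assume "\<boxminus> Psi C ?D ?A' (a \<cdot> e) = \<boxminus> Psi C ?D ?A' (e' \<cdot> \<Omega>a c)"
    then have "Psi C ?D ?A' (a \<cdot> e) = Psi C ?D ?A' (e' \<cdot> \<Omega>a c)"
      using Q Neg_Neg by (metis Hom_iff)
    then show "a \<cdot> e = e' \<cdot> \<Omega>a c" using H X by (intro Psi_inj[OF H]) auto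
  qed simp
  ultimately show ?thesis by simp
qed

text \<open>An arrow killed by \<open>f\<close> factors through \<open>e\<close>, whose source is a
  value of \<Omega>.\<close>

lemma ext_Omega_monic:
  assumes x: "extension C e f g h"
  shows "Omega_monic C (Ome C) f"
proof -
  note X = ext_arr[OF x]
  have "null_arrow C (Ome C) a" if a: "a \<in> Hom C A' (Src C f)" "f \<cdot> a = Zer C A' (Tgt C f)" for a A'
  proof -
    obtain a' where "a' \<in> Hom C A' (\<Omega>o (Tgt C g))" "e \<cdot> a' = a"
      using LT_weak_kernel2[OF ext_tri(2)[OF x] a] by blast
    then show ?thesis unfolding null_arrow_def
      using X by (intro factors_throughI[of "\<Omega>o (Tgt C g)" _ a' A' e "Src C f"]) auto
  qed
  then show ?thesis unfolding Omega_monic_def using X by blast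
qed

lemma Omega_monic_cancel:
  assumes "Omega_monic C (Ome C) (g \<cdot> f)" "f \<in> Hom C A B" "g \<in> Hom C B D"
  shows "Omega_monic C (Ome C) f"
  unfolding Omega_monic_def
proof (intro conjI ballI impI)
  fix A' a assume a: "A' \<in> Obj C" "a \<in> Hom C A' (Src C f)" "f \<cdot> a = Zer C A' (Tgt C f)"
  then have "(g \<cdot> f) \<cdot> a = Zer C A' (Tgt C (g \<cdot> f))"
    using assms(2,3) Hom_objD[OF assms(3)] by simp
  then show "null_arrow C (Ome C) a"
    using assms a unfolding Omega_monic_def by auto
qed (use assms in auto)

text \<open>The recognition criterion: a right triangle is part of an extension as soon as its first
  arrow is \<Omega>-monic. (G2) compares \<open>f\<close> with the middle arrow of a left triangle
  completing \<open>g\<close>, and transport along the inverse isomorphism puts \<open>f\<close> in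
  its place.\<close>

lemma ext_of_Omega_monic:
  assumes t: "(f, g, h) \<in> RTri C" and f: "Omega_monic C (Ome C) f"
  obtains e where "extension C e f g h"
proof -
  let ?A = "Src C f" and ?B = "Tgt C f" and ?D = "Tgt C g"
  note T = RT_arr[OF t]
  obtain e' f' where t': "(e', f', g) \<in> LTri C" using LTR1_ex T by blast
  note T' = LT_arr[OF t']
  obtain a where a: "a \<in> Hom C ?A (Src C f')" "iso_arrow C a" "f' \<cdot> a = f"
    "\<boxminus> (a \<cdot> Psi_inv C ?D ?A h) = e'"
    using G2[OF f t t'] by blast
  obtain a' where a': "a' \<in> Hom C (Src C f') ?A" "a' \<cdot> a = Idn C ?A" "a \<cdot> a' = Idn C (Src C f')"
    "iso_arrow C a'"
    using iso_arrowE[OF a(2,1)] by blast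
  \<comment> \<open>Forced by the relation \<open>h = \<boxminus> Psi e\<close> in an extension,
    because \<open>Psi\<close> commutes with negation.\<close>
  define e where "e = \<boxminus> Psi_inv C ?D ?A h"
  have P: "Psi_inv C ?D ?A h \<in> Hom C (\<Omega>o ?D) ?A" "Psi C ?D ?A (Psi_inv C ?D ?A h) = h"
    using T by (intro Psi_inv_hom; simp)+
  have e: "e \<in> Hom C (\<Omega>o ?D) ?A" using P(1) by (simp add: e_def)
  have "a' \<cdot> e' = e"
    using a(1) a'(1) P(1) T by (simp add: a(4)[symmetric] e_def a'(2)[THEN comp_eq_comp])
  moreover have "f \<cdot> a' = f'"
    using a(1,3) a'(1,3) T T' comp_assoc_arr[of a' a f'] by simp
  ultimately have "(e, f, g) \<in> LTri C"
    using T T' a' e by (intro LT_isoI[OF t', of e f g a' "Idn C ?B" "Idn C ?D"])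
      (simp_all add: ldiagram_def lmorphism_def)
  moreover have "h = \<boxminus> Psi C ?D ?A e"
    using T P Psi_Neg[of e ?D ?A] by (simp add: e_def Psi_Neg)
  ultimately have "extension C e f g h" using t by (simp add: extension_def)
  then show thesis by (rule that)
qed

text \<open>The counterpart through (G1): a left triangle completes \<open>g\<close>, and the right
  triangle on its middle arrow is transported along the isomorphism \<open>c\<close> so as to
  contain \<open>g\<close>.\<close>

lemma ext_of_Sigma_epic:
  assumes g: "Sigma_epic C (Sig C) g"
  obtains e f h where "extension C e f g h"
proof -
  have gA: "g \<in> Arr C" using g by (simp add: Sigma_epic_def)
  obtain e f where t: "(e, f, g) \<in> LTri C" using LTR1_ex gA by blast
  note T = LT_arr[OF t]
  let ?A = "Src C f" and ?B = "Tgt C f" and ?D = "Tgt C g"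
  obtain g' h' where t': "(f, g', h') \<in> RTri C" using RTR1_ex T by blast
  note T' = RT_arr[OF t']
  obtain c where c: "c \<in> Hom C (Tgt C g') ?D" "iso_arrow C c" "c \<cdot> g' = g"
    "(\<boxminus> Psi C ?D ?A e) \<cdot> c = h'"
    using G1[OF g t t'] by blast
  define h where "h = \<boxminus> Psi C ?D ?A e"
  have "Psi C ?D ?A e \<in> Hom C ?D (\<Sigma>o ?A)" using T by (intro Psi_hom) auto
  then have "h \<in> Hom C ?D (\<Sigma>o ?A)" by (simp add: h_def)
  then have "(f, g, h) \<in> RTri C"
    using T T' c by (intro RT_isoI[OF t', of f g h "Idn C ?A" "Idn C ?B" c])
      (auto simp: rdiagram_def rmorphism_def h_def)
  then show thesis using that t by (auto simp: extension_def h_def)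
qed

text \<open>Let \<open>a\<close> be killed by \<open>m \<cdot> l'\<close>. Then l'a = l b by the
  weak kernel property of \<open>m\<close>, and f b = m'l'a = 0, so b = e c. Moreover m'l e = f e =
  0, so l e = l'z. Hence l'(a - z c) = 0 and a - z c factors through \<open>e2\<close>. Thus
  \<open>a\<close> is a sum of two arrows through values of \<Omega>, which proves
  \<open>m \<cdot> l'\<close> to be \<Omega>-monic.\<close>

lemma ext_octahedron:
  assumes x: "extension C e f g h" "extension C e1 l m n" "extension C e2 l' m' n'"
    and s: "Src C l = Src C f" "Tgt C l' = Tgt C l" "Tgt C m' = Tgt C f" "m' \<cdot> l = f"
  obtains e' g' h' where "extension C e' (m \<cdot> l') g' h'"
    "g' \<in> Hom C (Tgt C m) (Tgt C g)" "h' \<in> Hom C (Tgt C g) (\<Sigma>o (Src C l'))"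
    "h' \<cdot> g = n'" "h \<cdot> g' = n" "g' \<cdot> m = g \<cdot> m'"
    "\<Sigma>a l \<cdot> h \<boxplus> \<Sigma>a l' \<cdot> h' = Zer C (Tgt C g) (\<Sigma>o (Tgt C l))"
proof -
  note X = ext_arr[OF x(1)] ext_arr[OF x(2)] ext_arr[OF x(3)]
  obtain g' h' where t: "g' \<in> Hom C (Tgt C m) (Tgt C g)" "h' \<in> Hom C (Tgt C g) (\<Sigma>o (Src C l'))"
    "h' \<cdot> g = n'" "h \<cdot> g' = n" "g' \<cdot> m = g \<cdot> m'"
    "\<Sigma>a l \<cdot> h \<boxplus> \<Sigma>a l' \<cdot> h' = Zer C (Tgt C g) (\<Sigma>o (Tgt C l))" "(m \<cdot> l', g', h') \<in> RTri C"
    using RTR4[OF x[THEN ext_tri(1)] s] by blast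
  have "null_arrow C (Ome C) a"
    if a: "a \<in> Hom C W (Src C l')" "(m \<cdot> l') \<cdot> a = Zer C W (Tgt C m)" for a W
  proof -
    have W: "W \<in> Obj C" using Hom_objD a(1) by blast
    have "l' \<cdot> a \<in> Hom C W (Src C m)" "m \<cdot> (l' \<cdot> a) = Zer C W (Tgt C m)" using a X s by auto
    then obtain b where b: "b \<in> Hom C W (Src C f)" "l \<cdot> b = l' \<cdot> a"
      using LT_weak_kernel[OF ext_tri(2)[OF x(2)]] s(1) by auto
    have m'l': "m' \<cdot> l' = Zer C (Src C l') (Tgt C f)" using RT_comp_zero[OF ext_tri(1)[OF x(3)]] s by simp
    have "f \<cdot> b = m' \<cdot> (l \<cdot> b)" using X b(1) s comp_assoc_arr[of b l m'] by simp
    also have "\<dots> = Zer C W (Tgt C f)" using X a(1) s by (simp add: b(2) m'l'[THEN comp_eq_comp])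
    finally obtain c where c: "c \<in> Hom C W (\<Omega>o (Tgt C g))" "e \<cdot> c = b"
      using LT_weak_kernel2[OF ext_tri(2)[OF x(1)] b(1)] by blast
    have fe: "f \<cdot> e = Zer C (\<Omega>o (Tgt C g)) (Tgt C f)" using LT_comp_zero[OF ext_tri(2)[OF x(1)]] .
    have "m' \<cdot> (l \<cdot> e) = Zer C (\<Omega>o (Tgt C g)) (Tgt C m')"
      using X s(1-3) fe by (simp add: s(4)[THEN comp_eq_comp])
    then obtain z where z: "z \<in> Hom C (\<Omega>o (Tgt C g)) (Src C l')" "l' \<cdot> z = l \<cdot> e"
      using LT_weak_kernel[OF ext_tri(2)[OF x(3)], of "l \<cdot> e" "\<Omega>o (Tgt C g)"] X s(1-3) by auto
    \<comment> \<open>The two factorizations meet here: l'z c = l e c = l b = l'a.\<close>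
    have "l' \<cdot> (a \<boxplus> \<boxminus> (z \<cdot> c)) = Zer C W (Tgt C l')"
      using X s(1-3) a(1) z(1) c b(1)
      by (simp add: z(2)[THEN comp_eq_comp] b(2)[symmetric])
    then obtain d where d: "d \<in> Hom C W (\<Omega>o (Tgt C m'))" "e2 \<cdot> d = a \<boxplus> \<boxminus> (z \<cdot> c)"
      using LT_weak_kernel2[OF ext_tri(2)[OF x(3)], of "a \<boxplus> \<boxminus> (z \<cdot> c)" W] X a(1) z(1) c(1) by auto
    have "a = z \<cdot> c \<boxplus> e2 \<cdot> d" using a(1) z(1) c(1) d X by (intro diff_eqD[of _ W "Src C l'"]) auto
    moreover have "null_arrow C (Ome C) (z \<cdot> c \<boxplus> e2 \<cdot> d)"
    proof (rule null_arrow_Plus[OF Omega_additive])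
      show "null_arrow C (Ome C) (z \<cdot> c)" unfolding null_arrow_def
        using X z(1) c(1) by (intro factors_throughI[of "\<Omega>o (Tgt C g)" _ c W z]) auto
      show "null_arrow C (Ome C) (e2 \<cdot> d)" unfolding null_arrow_def
        using X d(1) by (intro factors_throughI[of "\<Omega>o (Tgt C m')" _ d W e2]) auto
    qed (use X z(1) c(1) d(1) in auto)
    ultimately show ?thesis by simp
  qed
  then have "Omega_monic C (Ome C) (m \<cdot> l')" unfolding Omega_monic_def using X s by auto
  then obtain e' where "extension C e' (m \<cdot> l') g' h'" using ext_of_Omega_monic[OF t(7)] by blast
  then show thesis using that t by blast
qed

text \<open>As \<open>p\<close> splits \<open>i\<close>, only zero arrows are killed by
  \<open>i\<close>, so \<open>i\<close> is \<Omega>-monic.\<close>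

lemma ext_biproduct:
  assumes "biproduct_data C A B P i j p q"
  obtains e where "extension C e i q (Zer C B (\<Sigma>o A))"
proof -
  note b = biproduct_dataD[OF assms]
  have "null_arrow C (Ome C) a" if a: "a \<in> Hom C A' A" "i \<cdot> a = Zer C A' P" for a A'
  proof -
    have "(p \<cdot> i) \<cdot> a = p \<cdot> (i \<cdot> a)" using b(1,3) a(1) by simp
    then have "a = Zer C A' A" using b a Hom_objD[OF a(1)] by simp
    then show ?thesis using null_arrow_Zer[OF Omega_additive] b Hom_objD[OF a(1)] by simp
  qed
  then have "Omega_monic C (Ome C) i" unfolding Omega_monic_def using b by auto
  then show thesis using ext_of_Omega_monic[OF RT_biproduct[OF assms]] that by blast
qed

text \<open>If a composite is \<Omega>-monic, so is the arrow applied first. This is how inflations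
  are produced: it suffices to recover a known inflation by composing with something.\<close>

lemma ext_cancel:
  assumes x: "extension C e f g h" and "k \<cdot> l = f" "l \<in> Hom C A B" "k \<in> Hom C B D"
  obtains e' m n where "extension C e' l m n"
proof -
  obtain m n where t: "(l, m, n) \<in> RTri C" using RTR1_ex[of l] assms(3) by auto
  have "Omega_monic C (Ome C) l"
    using ext_Omega_monic[OF x] Omega_monic_cancel[of k l A B D] assms by simp
  then show thesis using ext_of_Omega_monic[OF t] that by blast
qed

text \<open>The arrow with components \<open>f\<close> and \<open>i\<close> gives back
  \<open>i\<close> under projection, so it begins an extension. The octahedron for this
  factorization, with the split extension of \<open>Y\<close> by the middle term, displays the new
  cone as an extension of the old third term by \<open>Y\<close>, as a push-out along
  \<open>f\<close> would be; this later places the cone in \<open>Z\<close>.\<close>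

lemma ext_pushout:
  assumes x: "extension C e i j k" and f: "f \<in> Hom C (Src C i) Y"
    and b: "biproduct_data C Y (Tgt C i) M iY iJ pY pJ"
  obtains e1 m n e2 g' h' where "extension C e1 (iY \<cdot> f \<boxplus> iJ \<cdot> i) m n"
    "extension C e2 (m \<cdot> iY) g' h'" "Tgt C g' = Tgt C j"
proof -
  let ?l = "iY \<cdot> f \<boxplus> iJ \<cdot> i"
  note X = ext_arr[OF x] and B = biproduct_dataD[OF b]
  have l: "?l \<in> Hom C (Src C i) M" using X f B by simp
  have pl: "pJ \<cdot> ?l = i" using X f B by (simp add: B(6,7)[THEN comp_eq_comp])
  obtain e1 m n where 1: "extension C e1 ?l m n" using ext_cancel[OF x pl l B(4)] by blast
  obtain e0 where 0: "extension C e0 iY pJ (Zer C (Tgt C i) (\<Sigma>o Y))" using ext_biproduct[OF b] by blast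
  obtain e2 g' h' where "extension C e2 (m \<cdot> iY) g' h'" "g' \<in> Hom C (Tgt C m) (Tgt C j)"
    by (rule ext_octahedron[OF x 1 0]) (use pl l B in auto)
  then show thesis using that[OF 1] by auto
qed

text \<open>For \<open>r = 0\<close> this adds the split sequence \<open>0 \<rightarrow> I \<rightarrow> I\<close> to an extension; in general the result
  is twisted by the automorphism \<open>(i, y) \<mapsto> (i + r y, y)\<close> of \<open>I \<oplus> Y\<close>.\<close>

lemma ext_add_split:
  assumes x: "extension C e f g h" and r: "r \<in> Hom C (Tgt C f) I"
    and bM: "biproduct_data C I (Tgt C f) M i j p q"
    and bN: "biproduct_data C I (Tgt C g) N i2 j2 p2 q2"
  obtains e' where "extension C e' (j \<cdot> f \<boxplus> i \<cdot> r \<cdot> f) (i2 \<cdot> (p \<boxplus> \<boxminus> (r \<cdot> q)) \<boxplus> j2 \<cdot> g \<cdot> q) (h \<cdot> q2)"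
proof -
  let ?l = "j \<cdot> f \<boxplus> i \<cdot> r \<cdot> f" and ?m = "i2 \<cdot> (p \<boxplus> \<boxminus> (r \<cdot> q)) \<boxplus> j2 \<cdot> g \<cdot> q"
  note X = ext_arr[OF x] and B = biproduct_dataD[OF bM] and B2 = biproduct_dataD[OF bN]
  have l: "?l \<in> Hom C (Src C f) M" using X r B by simp
  have ql: "q \<cdot> ?l = f" using X r B by (simp add: B(6,7)[THEN comp_eq_comp])
  have pl: "p \<cdot> ?l = r \<cdot> f" using X r B by (simp add: B(5,8)[THEN comp_eq_comp])
  obtain e1 m n where 1: "extension C e1 ?l m n" using ext_cancel[OF x ql l B(4)] by blast
  note X1 = ext_arr[OF 1]
  have m: "m \<in> Hom C M (Tgt C m)" "n \<in> Hom C (Tgt C m) (\<Sigma>o (Src C f))" using X1 l by auto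
  obtain e0 where 0: "extension C e0 i q (Zer C (Tgt C f) (\<Sigma>o I))" using ext_biproduct[OF bM] by blast
  obtain e2 g' h' where 2: "extension C e2 (m \<cdot> i) g' h'" "g' \<in> Hom C (Tgt C m) (Tgt C g)"
    "h \<cdot> g' = n" "g' \<cdot> m = g \<cdot> q"
    by (rule ext_octahedron[OF x 1 0]) (use ql l B in auto)
  have "(p \<boxplus> \<boxminus> (r \<cdot> q)) \<cdot> ?l = p \<cdot> ?l \<boxplus> \<boxminus> (r \<cdot> q \<cdot> ?l)" using l r B by simp
  then have "(p \<boxplus> \<boxminus> (r \<cdot> q)) \<cdot> ?l = Zer C (Src C ?l) I" unfolding pl ql using l X r by simp
  \<comment> \<open>\<open>p - r q\<close> kills the arrow \<open>?l\<close>, whose components are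
    \<open>f\<close> and \<open>r \<cdot> f\<close>. The induced \<open>s\<close> is a retraction of
    \<open>m \<cdot> i\<close>, so the extension obtained from the octahedron splits.\<close>
  then obtain s where s: "s \<in> Hom C (Tgt C m) I" "s \<cdot> m = p \<boxplus> \<boxminus> (r \<cdot> q)"
    using RT_weak_cokernel[OF ext_tri(1)[OF 1], of "p \<boxplus> \<boxminus> (r \<cdot> q)" I] l r B by auto
  have "s \<cdot> (m \<cdot> i) = Idn C I"
    using s(1) m B r by (simp add: s(2)[THEN comp_eq_comp])
  then obtain k where k: "biproduct_data C I (Tgt C g) (Tgt C m) (m \<cdot> i) k s g'"
    using RT_split_biproduct[OF ext_tri(1)[OF 2(1)], of s] s(1) m B 2(2) by auto
  \<comment> \<open>Two descriptions of the cone of \<open>?l\<close>: the split biproduct just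
    found and the prescribed \<open>N\<close>. The comparison \<open>?c\<close> turns
    \<open>m\<close> into \<open>?m\<close> and transports the triangle.\<close>
  let ?c = "i2 \<cdot> s \<boxplus> j2 \<cdot> g'"
  have iso: "iso_arrow C ?c" using biproduct_iso[OF k bN] .
  have c: "?c \<in> Hom C (Tgt C m) N" using s(1) 2(2) B2 by simp
  have cm: "?c \<cdot> m = ?m" using s(1) 2(2) m B2 by (simp add: s(2) 2(4))
  have "q2 \<cdot> ?c = g'" using s(1) 2(2) m B2 by (simp add: B2(6,7)[THEN comp_eq_comp])
  then have "(h \<cdot> q2) \<cdot> ?c = n" using X c B2(4) 2(3) by (simp del: comp_Plus)
  then have t: "(?l, ?m, h \<cdot> q2) \<in> RTri C"
    using l c cm m B2 r B X iso X1(3)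
    by (intro RT_isoI[OF ext_tri(1)[OF 1], of ?l ?m "h \<cdot> q2" "Idn C (Src C f)" "Idn C M" ?c])
      (simp_all add: rdiagram_def rmorphism_def del: comp_Plus comp_assoc_arr)
  then show thesis
    using ext_of_Omega_monic[OF t ext_Omega_monic[OF 1]] that by blast
qed

text \<open>If \<open>b\<close> kills \<open>g \<cdot> m'\<close>, then b g = c n' = c h'g for some
  \<open>c\<close>, so b - c h' kills \<open>g\<close> and equals d h. Thus \<open>b\<close> is a
  sum of two arrows through values of \<Sigma>. The purpose is to obtain an extension ending in
  \<open>g \<cdot> m'\<close>, to which (AC1) applies.\<close>

lemma ext_comp_Sigma_epic:
  assumes x: "extension C e f g h" "extension C e2 l' m' n'" and s: "Tgt C m' = Tgt C f"
    and h': "h' \<in> Hom C (Tgt C g) (\<Sigma>o (Src C l'))" "h' \<cdot> g = n'"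
  shows "Sigma_epic C (Sig C) (g \<cdot> m')"
proof -
  note X = ext_arr[OF x(1)] ext_arr[OF x(2)]
  have "null_arrow C (Sig C) b"
    if b: "b \<in> Hom C (Tgt C g) W" "b \<cdot> (g \<cdot> m') = Zer C (Tgt C l') W" for b W
  proof -
    have "b \<cdot> g \<in> Hom C (Tgt C m') W" "(b \<cdot> g) \<cdot> m' = Zer C (Tgt C l') W" using X s b by auto
    then obtain c where c: "c \<in> Hom C (\<Sigma>o (Src C l')) W" "c \<cdot> n' = b \<cdot> g"
      using RT_weak_cokernel2[OF ext_tri(1)[OF x(2)]] by blast
    have "(b \<boxplus> \<boxminus> (c \<cdot> h')) \<cdot> g = Zer C (Tgt C f) W"
      using X s b(1) c(1) h'(1) by (simp add: h'(2) c(2))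
    then obtain d where d: "d \<in> Hom C (\<Sigma>o (Src C f)) W" "d \<cdot> h = b \<boxplus> \<boxminus> (c \<cdot> h')"
      using RT_weak_cokernel2[OF ext_tri(1)[OF x(1)], of "b \<boxplus> \<boxminus> (c \<cdot> h')" W] X s b(1) c(1) h'(1) by auto
    have "b = c \<cdot> h' \<boxplus> d \<cdot> h" using b(1) c(1) d h'(1) X by (intro diff_eqD[of _ "Tgt C g" W]) auto
    moreover have "null_arrow C (Sig C) (c \<cdot> h' \<boxplus> d \<cdot> h)"
    proof (rule null_arrow_Plus[OF Sigma_additive])
      show "null_arrow C (Sig C) (c \<cdot> h')" unfolding null_arrow_def
        using X c(1) h'(1) by (intro factors_throughI[of "\<Sigma>o (Src C l')" _ h' "Tgt C g" c]) auto
      show "null_arrow C (Sig C) (d \<cdot> h)" unfolding null_arrow_def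
        using X d(1) by (intro factors_throughI[of "\<Sigma>o (Src C f)" _ h "Tgt C g" d]) auto
    qed (use X c(1) h'(1) d(1) in auto)
    ultimately show ?thesis by simp
  qed
  then show ?thesis unfolding Sigma_epic_def using X s by auto
qed

text \<open>Subtracting \<open>f' \<cdot> a'\<close> from \<open>b\<close> leaves an arrow killing
  \<open>f\<close>, hence of the form t g. The corrected \<open>c - g't\<close> kills
  \<open>g\<close> and is killed by \<open>h'\<close>; (AC1) splits it off through \<open>g'\<close>
  as well.\<close>

lemma ext_null_homotopy:
  assumes AC: "AC1 C" and x: "extension C e f g h" "extension C e' f' g' h'"
    and m: "rmorphism C (Sig C) (a, b, c) (f, g, h) (f', g', h')"
    and a: "a' \<in> Hom C (Tgt C f) (Src C f')" "a = a' \<cdot> f"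
  obtains t where "t \<in> Hom C (Tgt C g) (Src C g')" "c = g' \<cdot> t"
proof -
  note X = ext_arr[OF x(1)] ext_arr[OF x(2)]
  from m have h: "b \<in> Hom C (Tgt C f) (Tgt C f')" "c \<in> Hom C (Tgt C g) (Tgt C g')"
    and E: "b \<cdot> f = f' \<cdot> a" "c \<cdot> g = g' \<cdot> b" "\<Sigma>a a \<cdot> h = h' \<cdot> c"
    by (auto simp: rmorphism_def)
  have "(b \<boxplus> \<boxminus> (f' \<cdot> a')) \<cdot> f = Zer C (Src C f) (Tgt C f')" using X h a E(1) by simp
  then obtain t where t: "t \<in> Hom C (Tgt C g) (Tgt C f')" "t \<cdot> g = b \<boxplus> \<boxminus> (f' \<cdot> a')"
    using RT_weak_cokernel[OF ext_tri(1)[OF x(1)], of "b \<boxplus> \<boxminus> (f' \<cdot> a')" "Tgt C f'"] X h a by auto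
  let ?c = "c \<boxplus> \<boxminus> (g' \<cdot> t)"
  have cH: "?c \<in> Hom C (Tgt C g) (Tgt C g')" using X h t by simp
  have "?c \<cdot> g = Zer C (Src C g) (Tgt C g')"
    using X h t(1) a(1) by (simp add: t(2) E(2) RT_comp_zero[OF ext_tri(1)[OF x(2)], THEN comp_eq_comp])
  moreover have "h' \<cdot> c = Zer C (Tgt C g) (Tgt C h')"
    using X a(1) RT_comp_zero3[OF ext_tri(1)[OF x(1)]] by (simp add: E(3)[symmetric] a(2))
  then have "h' \<cdot> ?c = Zer C (Tgt C g) (Tgt C h')"
    using X h t(1) by (simp add: RT_comp_zero2[OF ext_tri(1)[OF x(2)], THEN comp_eq_comp])
  ultimately obtain d where d: "d \<in> Hom C (Tgt C g) (Src C g')" "?c = g' \<cdot> d"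
    using AC x cH unfolding AC1_def by blast
  have "c = g' \<cdot> t \<boxplus> g' \<cdot> d" using X h t(1) d by (intro diff_eqD[of _ "Tgt C g" "Tgt C g'"]) auto
  then show thesis using that[of "t \<boxplus> d"] X t d by simp
qed

text \<open>The dual argument. The square with \<open>h\<close> has to be translated into one with
  \<open>e\<close>, the form in which (AC2) is stated.\<close>

lemma ext_null_homotopy':
  assumes AC: "AC2 C" and x: "extension C e f g h" "extension C e' f' g' h'"
    and m: "rmorphism C (Sig C) (a, b, c) (f, g, h) (f', g', h')"
    and c: "c' \<in> Hom C (Tgt C g) (Src C g')" "c = g' \<cdot> c'"
  obtains t where "t \<in> Hom C (Tgt C f) (Src C f')" "a = t \<cdot> f"
proof -
  note X = ext_arr[OF x(1)] ext_arr[OF x(2)]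
  from m have h: "a \<in> Hom C (Src C f) (Src C f')" "b \<in> Hom C (Tgt C f) (Tgt C f')"
      "c \<in> Hom C (Tgt C g) (Tgt C g')"
    and E: "b \<cdot> f = f' \<cdot> a" "c \<cdot> g = g' \<cdot> b" "\<Sigma>a a \<cdot> h = h' \<cdot> c"
    by (auto simp: rmorphism_def)
  have e: "a \<cdot> e = e' \<cdot> \<Omega>a c" using ext_morphism_iff[OF x h(1,3)] E(3) by simp
  have "g' \<cdot> (b \<boxplus> \<boxminus> (c' \<cdot> g)) = Zer C (Tgt C f) (Tgt C g')" using X h c E(2) by simp
  then obtain s where s: "s \<in> Hom C (Tgt C f) (Src C f')" "f' \<cdot> s = b \<boxplus> \<boxminus> (c' \<cdot> g)"
    using LT_weak_kernel[OF ext_tri(2)[OF x(2)], of "b \<boxplus> \<boxminus> (c' \<cdot> g)" "Tgt C f"] X h c by auto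
  let ?a = "a \<boxplus> \<boxminus> (s \<cdot> f)"
  have aH: "?a \<in> Hom C (Src C f) (Src C f')" using X h s by simp
  have "f' \<cdot> ?a = Zer C (Src C f) (Tgt C f')"
    using X h s(1) c(1) RT_comp_zero[OF ext_tri(1)[OF x(1)]]
    by (simp add: s(2)[THEN comp_eq_comp] E(1))
  \<comment> \<open>\<open>a \<cdot> e\<close> equals e'\<Omega>c, and \<open>c\<close> passes
    through \<open>g'\<close>; the composite e'\<Omega>g' vanishes in the rotated left triangle, up
    to the sign introduced by rotation.\<close>
  moreover have "a \<cdot> e = Zer C (Src C e) (Src C f')"
  proof -
    have "e' \<cdot> \<boxminus> \<Omega>a g' = Zer C (\<Omega>o (Src C g')) (Src C f')"
      using LT_comp_zero[OF LTR2[OF ext_tri(2)[OF x(2)]]] X by simp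
    then have "\<boxminus> (\<boxminus> (e' \<cdot> \<Omega>a g')) = \<boxminus> Zer C (\<Omega>o (Src C g')) (Src C f')" using X by simp
    then have "e' \<cdot> \<Omega>a g' = Zer C (\<Omega>o (Src C g')) (Src C f')" using X by simp
    then show ?thesis using X c(1) by (simp add: e c(2) comp_eq_comp)
  qed
  then have "?a \<cdot> e = Zer C (Src C e) (Src C f')"
    using X h s(1) LT_comp_zero[OF ext_tri(2)[OF x(1)]] by simp
  ultimately obtain d where d: "d \<in> Hom C (Tgt C f) (Src C f')" "?a = d \<cdot> f"
    using AC x aH unfolding AC2_def by blast
  have "a = s \<cdot> f \<boxplus> d \<cdot> f" using X h s(1) d by (intro diff_eqD[of _ "Src C f" "Src C f'"]) auto
  then show thesis using that[of "s \<boxplus> d"] X s d by simp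
qed

end

section \<open>The quotient of an additive subcategory by an ideal\<close>

locale quotient_setting = additive_category C
  for C :: "('o, 'm, 'b) cat_scheme" (structure) +
  fixes Z J :: "'o set"
  assumes Z_additive: "additive_subcategory C Z"
    and J_subset: "J \<subseteq> Z"
    and J_nonempty: "J \<noteq> {}"
    and J_biproduct: "X \<in> J \<Longrightarrow> Y \<in> J \<Longrightarrow> \<exists>P \<in> J. \<exists>i j p q. biproduct_data C X Y P i j p q"
begin

abbreviation "cl \<equiv> arrow_class C J"
abbreviation "Q \<equiv> quotient_category C Z J"

lemma Z_obj [simp]: "A \<in> Z \<Longrightarrow> A \<in> Obj C"
  using Z_additive by (auto simp: additive_subcategory_def)

lemma J_Z [simp]: "A \<in> J \<Longrightarrow> A \<in> Z"
  using J_subset by blast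

lemma factors_Zer [simp]:
  assumes "A \<in> Obj C" "B \<in> Obj C"
  shows "factors_through C J (Zer C A B)"
proof -
  obtain X where X: "X \<in> J" using J_nonempty by blast
  then have "X \<in> Obj C" by simp
  then show ?thesis using X assms by (intro factors_throughI[of X _ "Zer C A X" A "Zer C X B"]) auto
qed

lemma factors_Plus:
  assumes "factors_through C J f" "factors_through C J g" "Src C g = Src C f" "Tgt C g = Tgt C f"
  shows "factors_through C J (f \<boxplus> g)"
  using factors_through_Plus[OF J_biproduct] assms by blast

lemma factors_Neg:
  assumes "factors_through C J f"
  shows "factors_through C J (\<boxminus> f)"
proof -
  have f: "f \<in> Arr C" using assms by (simp add: factors_through_def)
  then have "\<boxminus> f = \<boxminus> Idn C (Tgt C f) \<cdot> f" by simp
  then show ?thesis using factors_through_comp(1)[OF assms, of "\<boxminus> Idn C (Tgt C f)"] f by simp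
qed

lemma cl_eq_iff:
  assumes "f \<in> Hom C A B" "g \<in> Hom C A B"
  shows "cl f = cl g \<longleftrightarrow> factors_through C J (f \<boxplus> \<boxminus> g)"
proof
  have O: "A \<in> Obj C" "B \<in> Obj C" using Hom_objD[OF assms(1)] by auto
  have "f \<in> cl f" using assms O by (simp add: arrow_class_def)
  moreover assume "cl f = cl g"
  ultimately have "f \<in> cl g" by simp
  then show "factors_through C J (f \<boxplus> \<boxminus> g)" by (simp add: arrow_class_def)
next
  assume fg: "factors_through C J (f \<boxplus> \<boxminus> g)"
  \<comment> \<open>One inclusion of classes. The other follows with \<open>f\<close> and
    \<open>g\<close> exchanged, as the ideal is closed under negation.\<close>
  have swap: "k \<in> cl g'" if k: "k \<in> cl f'" and h: "f' \<in> Hom C A B" "g' \<in> Hom C A B"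
      "factors_through C J (f' \<boxplus> \<boxminus> g')" for k f' g'
  proof -
    have kH: "k \<in> Hom C A B" and kf: "factors_through C J (k \<boxplus> \<boxminus> f')"
      using k h by (auto simp: arrow_class_def)
    have "factors_through C J ((k \<boxplus> \<boxminus> f') \<boxplus> (f' \<boxplus> \<boxminus> g'))"
      using kH h by (intro factors_Plus kf h(3)) auto
    moreover have "(k \<boxplus> \<boxminus> f') \<boxplus> (f' \<boxplus> \<boxminus> g') = k \<boxplus> \<boxminus> g'"
      using kH h(1,2) by simp
    ultimately show ?thesis using kH h by (simp add: arrow_class_def)
  qed
  have "\<boxminus> (f \<boxplus> \<boxminus> g) = g \<boxplus> \<boxminus> f" using assms Plus_comm[of "\<boxminus> f" g] by simp
  then have "factors_through C J (g \<boxplus> \<boxminus> f)" using factors_Neg[OF fg] by simp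
  then show "cl f = cl g" using swap fg assms by blast
qed

lemma mem_cl: "f \<in> Arr C \<Longrightarrow> f \<in> cl f"
  by (simp add: arrow_class_def)

lemma mem_clD:
  assumes "k \<in> cl f" "f \<in> Arr C"
  shows "k \<in> Hom C (Src C f) (Tgt C f)" "cl k = cl f"
proof -
  show h: "k \<in> Hom C (Src C f) (Tgt C f)" using assms by (auto simp: arrow_class_def)
  then show "cl k = cl f"
    using assms cl_eq_iff[of k "Src C f" "Tgt C f" f] by (simp add: arrow_class_def)
qed

lemma cl_comp:
  assumes "f \<in> Hom C A B" "f' \<in> Hom C A B" "cl f = cl f'"
    "g \<in> Hom C B D" "g' \<in> Hom C B D" "cl g = cl g'"
  shows "cl (g \<cdot> f) = cl (g' \<cdot> f')"
proof -
  have "factors_through C J ((g \<boxplus> \<boxminus> g') \<cdot> f)"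
    using assms cl_eq_iff[of g B D g'] by (intro factors_through_comp(2)) auto
  moreover have "factors_through C J (g' \<cdot> (f \<boxplus> \<boxminus> f'))"
    using assms cl_eq_iff[of f A B f'] by (intro factors_through_comp(1)) auto
  ultimately have "factors_through C J ((g \<boxplus> \<boxminus> g') \<cdot> f \<boxplus> g' \<cdot> (f \<boxplus> \<boxminus> f'))"
    using assms by (intro factors_Plus) auto
  moreover have "(g \<boxplus> \<boxminus> g') \<cdot> f \<boxplus> g' \<cdot> (f \<boxplus> \<boxminus> f') = g \<cdot> f \<boxplus> \<boxminus> (g' \<cdot> f')"
    using assms(1,2,4,5) by simp
  ultimately show ?thesis using assms cl_eq_iff[of "g \<cdot> f" A D "g' \<cdot> f'"] by simp
qed

lemma cl_Plus:
  assumes "f \<in> Hom C A B" "f' \<in> Hom C A B" "cl f = cl f'"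
    "g \<in> Hom C A B" "g' \<in> Hom C A B" "cl g = cl g'"
  shows "cl (f \<boxplus> g) = cl (f' \<boxplus> g')"
proof -
  have "factors_through C J ((f \<boxplus> \<boxminus> f') \<boxplus> (g \<boxplus> \<boxminus> g'))"
    using assms cl_eq_iff[of g A B g'] cl_eq_iff[of f A B f'] by - (rule factors_Plus, auto)
  moreover have "(f \<boxplus> \<boxminus> f') \<boxplus> (g \<boxplus> \<boxminus> g') = (f \<boxplus> g) \<boxplus> \<boxminus> (f' \<boxplus> g')"
    using assms(1,2,4,5) by (simp add: Plus_left_comm[of "\<boxminus> f'" g])
  ultimately show ?thesis using assms cl_eq_iff[of "f \<boxplus> g" A B "f' \<boxplus> g'"] by simp
qed

lemma Q_Obj [simp]: "Obj Q = Z"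
  by (simp add: quotient_category_def)

lemma Q_Idn [simp]: "Idn Q A = cl (Idn C A)"
  by (simp add: quotient_category_def)

lemma Q_Zer [simp]: "Zer Q A B = cl (Zer C A B)"
  by (simp add: quotient_category_def)

lemma Q_Arr [simp]: "f \<in> Arr C \<Longrightarrow> Src C f \<in> Z \<Longrightarrow> Tgt C f \<in> Z \<Longrightarrow> cl f \<in> Arr Q"
  by (simp add: quotient_category_def)

text \<open>All representatives share their source and a class is nonempty, so
  \<open>the_elem\<close> is applied to a singleton.\<close>

lemma Q_Src [simp]: "f \<in> Arr C \<Longrightarrow> Src Q (cl f) = Src C f"
proof -
  assume f: "f \<in> Arr C"
  have "Src C k = Src C f" if "k \<in> cl f" for k using mem_clD(1)[OF that f] by simp
  then have "Src C ` cl f = (\<lambda>_. Src C f) ` cl f" by (rule image_cong[OF refl])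
  also have "\<dots> = {Src C f}" using mem_cl[OF f] by blast
  finally have "Src C ` cl f = {Src C f}" .
  then show ?thesis by (simp add: quotient_category_def)
qed

lemma Q_Tgt [simp]: "f \<in> Arr C \<Longrightarrow> Tgt Q (cl f) = Tgt C f"
proof -
  assume f: "f \<in> Arr C"
  have "Tgt C k = Tgt C f" if "k \<in> cl f" for k using mem_clD(1)[OF that f] by simp
  then have "Tgt C ` cl f = (\<lambda>_. Tgt C f) ` cl f" by (rule image_cong[OF refl])
  also have "\<dots> = {Tgt C f}" using mem_cl[OF f] by blast
  finally have "Tgt C ` cl f = {Tgt C f}" .
  then show ?thesis by (simp add: quotient_category_def)
qed

lemma Q_ArrE:
  assumes "F \<in> Arr Q"
  obtains f where "f \<in> Arr C" "Src C f \<in> Z" "Tgt C f \<in> Z" "F = cl f"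
  using assms by (auto simp: quotient_category_def)

lemma Q_HomE:
  assumes "F \<in> Hom Q A B"
  obtains f where "f \<in> Hom C A B" "A \<in> Z" "B \<in> Z" "F = cl f"
proof -
  have F: "F \<in> Arr Q" "Src Q F = A" "Tgt Q F = B" using assms by (auto simp: Hom_def)
  obtain f where f: "f \<in> Arr C" "Src C f \<in> Z" "Tgt C f \<in> Z" "F = cl f" using Q_ArrE F(1) by blast
  then show thesis using F that[of f] by auto
qed

lemma Q_HomI: "f \<in> Hom C A B \<Longrightarrow> A \<in> Z \<Longrightarrow> B \<in> Z \<Longrightarrow> cl f \<in> Hom Q A B"
  by (auto simp: Hom_def[of Q])

text \<open>All composites of representatives have the same class, so the union in the definition is
  a nonempty union of equal sets.\<close>

lemma Q_Comp [simp]: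
  assumes "f \<in> Arr C" "g \<in> Arr C" "Src C g = Tgt C f"
  shows "cl g \<cdot>\<^bsub>Q\<^esub> cl f = cl (g \<cdot> f)"
proof -
  have "cl (g' \<cdot> f') = cl (g \<cdot> f)" if "g' \<in> cl g" "f' \<in> cl f" for g' f'
    using mem_clD[OF that(1) assms(2)] mem_clD[OF that(2) assms(1)] assms
    by (intro cl_comp[of f' "Src C f" "Tgt C f" f g' "Tgt C g" g]) auto
  moreover have "cl f \<noteq> {}" "cl g \<noteq> {}" using mem_cl assms(1,2) by blast+
  ultimately have "(\<Union>g'\<in>cl g. \<Union>f'\<in>cl f. cl (g' \<cdot> f')) = cl (g \<cdot> f)"
    by (intro SUP_eq_const) blast+
  then show ?thesis by (simp add: quotient_category_def)
qed

lemma Q_Plus [simp]: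
  assumes "f \<in> Arr C" "g \<in> Arr C" "Src C g = Src C f" "Tgt C g = Tgt C f"
  shows "cl f \<boxplus>\<^bsub>Q\<^esub> cl g = cl (f \<boxplus> g)"
proof -
  have "cl (f' \<boxplus> g') = cl (f \<boxplus> g)" if "g' \<in> cl g" "f' \<in> cl f" for g' f'
    using mem_clD[OF that(1) assms(2)] mem_clD[OF that(2) assms(1)] assms
    by (intro cl_Plus[of f' "Src C f" "Tgt C f" f g' g]) auto
  moreover have "cl f \<noteq> {}" "cl g \<noteq> {}" using mem_cl assms(1,2) by blast+
  ultimately have "(\<Union>f'\<in>cl f. \<Union>g'\<in>cl g. cl (f' \<boxplus> g')) = cl (f \<boxplus> g)"
    by (intro SUP_eq_const) blast+
  then show ?thesis by (simp add: quotient_category_def)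
qed

lemma Q_preadditive: "preadditive_category Q"
proof (intro preadditive_category.intro category.intro preadditive_category_axioms.intro)
  fix F assume "F \<in> Arr Q"
  then show "Src Q F \<in> Obj Q" "Tgt Q F \<in> Obj Q" by (auto elim: Q_ArrE)
next
  fix A assume "A \<in> Obj Q"
  then show "Idn Q A \<in> Hom Q A A" by (auto intro!: Q_HomI)
next
  fix F G A B D assume "F \<in> Hom Q A B" "G \<in> Hom Q B D"
  then show "G \<cdot>\<^bsub>Q\<^esub> F \<in> Hom Q A D" by (elim Q_HomE) (auto intro!: Q_HomI)
next
  fix F A B assume "F \<in> Hom Q A B"
  then show "F \<cdot>\<^bsub>Q\<^esub> Idn Q A = F" "Idn Q B \<cdot>\<^bsub>Q\<^esub> F = F" by (auto elim!: Q_HomE)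
next
  fix F G H A B D E assume "F \<in> Hom Q A B" "G \<in> Hom Q B D" "H \<in> Hom Q D E"
  then show "(H \<cdot>\<^bsub>Q\<^esub> G) \<cdot>\<^bsub>Q\<^esub> F = H \<cdot>\<^bsub>Q\<^esub> (G \<cdot>\<^bsub>Q\<^esub> F)" by (elim Q_HomE) simp
next
  fix F F' G A B D assume "F \<in> Hom Q A B" "F' \<in> Hom Q A B" "G \<in> Hom Q B D"
  then show "G \<cdot>\<^bsub>Q\<^esub> (F \<boxplus>\<^bsub>Q\<^esub> F') = G \<cdot>\<^bsub>Q\<^esub> F \<boxplus>\<^bsub>Q\<^esub> G \<cdot>\<^bsub>Q\<^esub> F'"
    by (elim Q_HomE) simp
next
  fix F G G' A B D assume "F \<in> Hom Q A B" "G \<in> Hom Q B D" "G' \<in> Hom Q B D"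
  then show "(G \<boxplus>\<^bsub>Q\<^esub> G') \<cdot>\<^bsub>Q\<^esub> F = G \<cdot>\<^bsub>Q\<^esub> F \<boxplus>\<^bsub>Q\<^esub> G' \<cdot>\<^bsub>Q\<^esub> F"
    by (elim Q_HomE) simp
next
  fix A B assume "A \<in> Obj Q" "B \<in> Obj Q"
  then have AB: "A \<in> Z" "B \<in> Z" by auto
  show "comm_group (hom_group Q A B)"
  proof (rule comm_groupI; simp only: hom_group_def monoid.simps partial_object.simps)
    show "Zer Q A B \<in> Hom Q A B" using AB by (auto intro!: Q_HomI)
    show "F \<boxplus>\<^bsub>Q\<^esub> G \<in> Hom Q A B" if "F \<in> Hom Q A B" "G \<in> Hom Q A B" for F G
      using that by (elim Q_HomE) (auto intro!: Q_HomI)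
    show "(F \<boxplus>\<^bsub>Q\<^esub> G) \<boxplus>\<^bsub>Q\<^esub> H = F \<boxplus>\<^bsub>Q\<^esub> (G \<boxplus>\<^bsub>Q\<^esub> H)"
      if "F \<in> Hom Q A B" "G \<in> Hom Q A B" "H \<in> Hom Q A B" for F G H
      using that by (elim Q_HomE) simp
    show "F \<boxplus>\<^bsub>Q\<^esub> G = G \<boxplus>\<^bsub>Q\<^esub> F" if "F \<in> Hom Q A B" "G \<in> Hom Q A B" for F G
      using that by (elim Q_HomE) (simp, metis Plus_comm)
    show "Zer Q A B \<boxplus>\<^bsub>Q\<^esub> F = F" if "F \<in> Hom Q A B" for F
      using that by (elim Q_HomE) simp
    show "\<exists>G \<in> Hom Q A B. G \<boxplus>\<^bsub>Q\<^esub> F = Zer Q A B" if "F \<in> Hom Q A B" for F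
    proof -
      obtain f where f: "f \<in> Hom C A B" "F = cl f" using Q_HomE \<open>F \<in> Hom Q A B\<close> by blast
      then show ?thesis using AB by (intro bexI[of _ "cl (\<boxminus> f)"] Q_HomI) auto
    qed
  qed
qed

sublocale Q: preadditive_category Q
  by (rule Q_preadditive)

lemma Q_biproduct:
  assumes "biproduct_data C A B P i j p q" "A \<in> Z" "B \<in> Z" "P \<in> Z"
  shows "biproduct_data Q A B P (cl i) (cl j) (cl p) (cl q)"
  using biproduct_dataD[OF assms(1)] assms(2-) by (simp add: biproduct_data_def)

lemma Q_zero_object:
  assumes "zero_object C N" "N \<in> Z"
  shows "zero_object Q N"
  using assms unfolding Q.zero_object_iff zero_object_iff by simp

sublocale Q: additive_category Q
proof unfold_locales
  show "\<exists>N. zero_object Q N"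
    using Z_additive Q_zero_object unfolding additive_subcategory_def by blast
  show "\<exists>P. biproduct Q A B P" if "A \<in> Obj Q" "B \<in> Obj Q" for A B
  proof -
    have AB: "A \<in> Z" "B \<in> Z" using that by auto
    then obtain P where P: "P \<in> Z" "biproduct C A B P"
      using Z_additive unfolding additive_subcategory_def by blast
    then obtain i j p q where "biproduct_data C A B P i j p q" by (blast elim: biproductE)
    then have "biproduct_data Q A B P (cl i) (cl j) (cl p) (cl q)" using AB P Q_biproduct by blast
    then show ?thesis using Q.biproduct_dataI by blast
  qed
qed

lemma Q_Neg [simp]:
  assumes "f \<in> Arr C" "Src C f \<in> Z" "Tgt C f \<in> Z"
  shows "\<boxminus>\<^bsub>Q\<^esub> cl f = cl (\<boxminus> f)"
  using assms by (intro Q.Neg_unique[symmetric]) auto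

lemma cl_eqI:
  assumes "f \<in> Hom C A B" "g \<in> Hom C A B" "X \<in> J" "u \<in> Hom C A X" "v \<in> Hom C X B" "f \<boxplus> \<boxminus> g = v \<cdot> u"
  shows "cl f = cl g"
  using cl_eq_iff[OF assms(1,2)] factors_throughI[OF assms(3-)] by blast

lemma cl_eqE:
  assumes "cl f = cl g" "f \<in> Hom C A B" "g \<in> Hom C A B"
  obtains X u v where "X \<in> J" "u \<in> Hom C A X" "v \<in> Hom C X B" "f \<boxplus> \<boxminus> g = v \<cdot> u"
proof -
  have "factors_through C J (f \<boxplus> \<boxminus> g)" using cl_eq_iff[OF assms(2,3)] assms(1) by simp
  then show thesis using that assms(2,3) by (elim factors_throughE[of _ _ A B]) auto
qed

text \<open>\<open>1 - j q = i p\<close> passes through \<open>I\<close>, so adding an object of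
  \<open>J\<close> does not change an object in the quotient. Every later enlargement by an
  injective is undone with this.\<close>

lemma cl_biproduct_iso:
  assumes b: "biproduct_data C I A P i j p q" and "I \<in> J" "A \<in> Z" "P \<in> Z"
  shows "iso_arrow Q (cl j)" "iso_arrow Q (cl q)" "cl (j \<cdot> q) = Idn Q P"
proof -
  note B = biproduct_dataD[OF b]
  have "Idn C P \<boxplus> \<boxminus> (j \<cdot> q) = i \<cdot> p"
    using B(1-4,10-) by (simp add: B(9)[symmetric])
  then have "cl (Idn C P) = cl (j \<cdot> q)"
    using assms B(1-4,10-) by (intro cl_eqI[of _ P P _ I p i]) auto
  then show e: "cl (j \<cdot> q) = Idn Q P" by simp
  have 1: "cl q \<cdot>\<^bsub>Q\<^esub> cl j = Idn Q A" using B by simp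
  have 2: "cl j \<cdot>\<^bsub>Q\<^esub> cl q = Idn Q P" using B e by simp
  show "iso_arrow Q (cl j)" using 1 2 B assms by (intro Q.iso_arrowI[of _ A P "cl q"] Q_HomI) auto
  show "iso_arrow Q (cl q)" using 1 2 B assms by (intro Q.iso_arrowI[of _ P A "cl j"] Q_HomI) auto
qed

end

section \<open>The shift functor of a Frobenius subcategory\<close>

context shifted_category
begin

lemma rmorphism_Plus:
  assumes d: "rdiagram C F f g h" "rdiagram C F f' g' h'"
    and m: "rmorphism C F (a, b, c) (f, g, h) (f', g', h')"
      "rmorphism C F (a1, b1, c1) (f, g, h) (f', g', h')"
  shows "rmorphism C F (a \<boxplus> a1, b \<boxplus> b1, c \<boxplus> c1) (f, g, h) (f', g', h')"
  using d m by (simp add: rdiagram_def rmorphism_iff)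

lemma rmorphism_rotate:
  assumes d: "rdiagram C F f g h" "rdiagram C F f' g' h'"
    and m: "rmorphism C F (a, b, c) (f, g, h) (f', g', h')"
  shows "rmorphism C F (b, c, FAr F a) (g, h, \<boxminus> FAr F f) (g', h', \<boxminus> FAr F f')"
proof -
  note T = d[unfolded rdiagram_def]
  have t: "a \<in> Hom C (Src C f) (Src C f')" "b \<in> Hom C (Tgt C f) (Tgt C f')" and e: "b \<cdot> f = f' \<cdot> a"
    using m unfolding rmorphism_iff by blast+
  have "FAr F b \<cdot> FAr F f = FAr F (b \<cdot> f)" using t T by simp
  also have "\<dots> = FAr F f' \<cdot> FAr F a" unfolding e using t T by simp
  finally show ?thesis using T m by (simp add: rmorphism_iff)
qed

end

locale frobenius_setting = pseudo_triangulated C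
  for C :: "('o, 'm, 'b) pt_cat_scheme" (structure) +
  fixes Z D :: "'o set"
  assumes ac1: "AC1 C" and ac2: "AC2 C"
    and Z_subcategory: "additive_subcategory C Z" and Z_ext: "extension_closed C Z"
    and D_subcategory: "additive_subcategory C D" and D_subset: "D \<subseteq> Z"
    and frob: "frobenius C Z D"
begin

abbreviation "J \<equiv> injectives C Z D"

lemma conf_ext: "conflation C Z e f g h \<Longrightarrow> extension C e f g h"
  by (simp add: conflation_def)

lemma conf_Z:
  assumes "conflation C Z e f g h"
  shows "Src C f \<in> Z" "Tgt C f \<in> Z" "Tgt C g \<in> Z"
  using assms by (auto simp: conflation_def)

lemma conf_diagram: "conflation C Z e f g h \<Longrightarrow> rdiagram C (Sig C) f g h"
  using ext_diagram conf_ext by blast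

lemma conflationI:
  assumes "extension C e f g h" "Src C f \<in> Z" "Tgt C g \<in> Z"
  shows "conflation C Z e f g h"
  using assms Z_ext unfolding conflation_def extension_closed_def by blast

lemma injective_extend:
  assumes x: "conflation C Z e f g h" and "I \<in> J" "y \<in> Hom C (Src C f) I"
  obtains y' where "y' \<in> Hom C (Tgt C f) I" "y' \<cdot> f = y"
proof -
  have "(\<lambda>y. y \<cdot> f) ` Hom C (Tgt C f) I = Hom C (Src C f) I"
    using assms unfolding injectives_def inflation_def by blast
  then show thesis using that assms(3) by (metis imageE)
qed

text \<open>The Frobenius condition: objects of \<open>J\<close>, defined by extension along
  inflations, also lift along deflations.\<close>

lemma projective_lift:
  assumes x: "conflation C Z e f g h" and "P \<in> J" "y \<in> Hom C P (Tgt C g)"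
  obtains y' where "y' \<in> Hom C P (Src C g)" "g \<cdot> y' = y"
proof -
  have "P \<in> projectives C Z D" using assms(2) frob by (simp add: frobenius_def)
  then have "(\<lambda>y. g \<cdot> y) ` Hom C P (Src C g) = Hom C P (Tgt C g)"
    using x unfolding projectives_def deflation_def by blast
  then show thesis using that assms(3) by (metis imageE)
qed

text \<open>Arrows into a biproduct are extended componentwise.\<close>

lemma injectives_biproduct:
  assumes "X \<in> J" "Y \<in> J"
  shows "\<exists>P \<in> J. \<exists>i j p q. biproduct_data C X Y P i j p q"
proof -
  have "X \<in> D" "Y \<in> D" using assms by (auto simp: injectives_def)
  then obtain P where P: "P \<in> D" "biproduct C X Y P"
    using D_subcategory unfolding additive_subcategory_def by blast
  from P(2) obtain i j p q where b: "biproduct_data C X Y P i j p q" by (rule biproductE)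
  note B = biproduct_dataD[OF b]
  have "(\<lambda>y. y \<cdot> f) ` Hom C (Tgt C f) P = Hom C (Src C f) P" if f: "inflation C Z f" for f
  proof
    obtain e g h where x: "conflation C Z e f g h" using f by (auto simp: inflation_def)
    note X = ext_arr[OF conf_ext[OF x]]
    show "(\<lambda>y. y \<cdot> f) ` Hom C (Tgt C f) P \<subseteq> Hom C (Src C f) P" using X by auto
    show "Hom C (Src C f) P \<subseteq> (\<lambda>y. y \<cdot> f) ` Hom C (Tgt C f) P"
    proof
      fix y assume y: "y \<in> Hom C (Src C f) P"
      obtain u where u: "u \<in> Hom C (Tgt C f) X" "u \<cdot> f = p \<cdot> y"
        using injective_extend[OF x assms(1), of "p \<cdot> y"] y B by auto
      obtain v where v: "v \<in> Hom C (Tgt C f) Y" "v \<cdot> f = q \<cdot> y"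
        using injective_extend[OF x assms(2), of "q \<cdot> y"] y B by auto
      have "(i \<cdot> u \<boxplus> j \<cdot> v) \<cdot> f = (i \<cdot> p \<boxplus> j \<cdot> q) \<cdot> y"
        using X u v y B(1-4) by simp
      then have "(i \<cdot> u \<boxplus> j \<cdot> v) \<cdot> f = y" using B(9) y by simp
      moreover have "i \<cdot> u \<boxplus> j \<cdot> v \<in> Hom C (Tgt C f) P" using u v B by simp
      ultimately show "y \<in> (\<lambda>y. y \<cdot> f) ` Hom C (Tgt C f) P" by (metis imageI)
    qed
  qed
  then have "P \<in> J" using P(1) by (auto simp: injectives_def)
  then show ?thesis using b by blast
qed

lemma enough_injectivesE:
  assumes "X \<in> Z"
  obtains e f g h where "conflation C Z e f g h" "Src C f = X" "Tgt C f \<in> J"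
  using frob assms unfolding frobenius_def enough_injectives_def inflation_def by blast

lemma enough_projectivesE:
  assumes "X \<in> Z"
  obtains e f g h where "conflation C Z e f g h" "Tgt C g = X" "Tgt C f \<in> J"
proof -
  obtain e f g h where x: "conflation C Z e f g h" "Tgt C g = X" "Src C g \<in> J"
    using frob assms unfolding frobenius_def enough_projectives_def deflation_def by blast
  then show thesis using that ext_arr(5)[OF conf_ext[OF x(1)]] by simp
qed

sublocale quotient_setting C Z "injectives C Z D"
proof unfold_locales
  obtain N where "N \<in> Z" using Z_subcategory by (auto simp: additive_subcategory_def)
  then show "J \<noteq> {}" using enough_injectivesE by blast
  show "J \<subseteq> Z" using D_subset by (auto simp: injectives_def)
qed (fact Z_subcategory injectives_biproduct)+

lemma Z_biproduct:
  assumes "A \<in> Z" "B \<in> Z"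
  obtains P i j p q where "P \<in> Z" "biproduct_data C A B P i j p q"
proof -
  obtain P where P: "P \<in> Z" "biproduct C A B P"
    using Z_subcategory assms unfolding additive_subcategory_def by blast
  from P(2) obtain i j p q where "biproduct_data C A B P i j p q" by (rule biproductE)
  then show thesis using that P(1) by blast
qed

section \<open>Morphisms between conflations with injective middle term\<close>

lemma conf_extend:
  assumes x: "conflation C Z e f g h" "conflation C Z e' f' g' h'" and J: "Tgt C f' \<in> J"
    and a: "a \<in> Hom C (Src C f) (Src C f')"
  obtains b c where "rmorphism C (Sig C) (a, b, c) (f, g, h) (f', g', h')"
proof -
  note X = ext_arr[OF conf_ext[OF x(2)]]
  obtain b where b: "b \<in> Hom C (Tgt C f) (Tgt C f')" "b \<cdot> f = f' \<cdot> a"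
    using injective_extend[OF x(1) J, of "f' \<cdot> a"] a X by auto
  show thesis
    using RTR3[OF ext_tri(1)[OF conf_ext[OF x(1)]] ext_tri(1)[OF conf_ext[OF x(2)]] a b] that by blast
qed

text \<open>The middle term is projective as well, so \<open>c \<cdot> g\<close> lifts; (LTR3)
  supplies the first component, and the square with \<open>e\<close> is translated into the one with
  \<open>h\<close>.\<close>

lemma conf_lift:
  assumes x: "conflation C Z e f g h" "conflation C Z e' f' g' h'" and J: "Tgt C f \<in> J"
    and c: "c \<in> Hom C (Tgt C g) (Tgt C g')"
  obtains a b where "rmorphism C (Sig C) (a, b, c) (f, g, h) (f', g', h')"
proof -
  note X = ext_arr[OF conf_ext[OF x(1)]] ext_arr[OF conf_ext[OF x(2)]]
  obtain b where b: "b \<in> Hom C (Tgt C f) (Src C g')" "g' \<cdot> b = c \<cdot> g"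
    using projective_lift[OF x(2) J, of "c \<cdot> g"] c X by auto
  have "\<exists>a. lmorphism C (Ome C) (a, b, c) (e, f, g) (e', f', g')"
    using b c X by (intro LTR3[OF ext_tri(2)[OF conf_ext[OF x(1)]] ext_tri(2)[OF conf_ext[OF x(2)]]]) auto
  then obtain a where a: "lmorphism C (Ome C) (a, b, c) (e, f, g) (e', f', g')" by blast
  then have aH: "a \<in> Hom C (Src C f) (Src C f')" and ae: "a \<cdot> e = e' \<cdot> \<Omega>a c"
    by (auto simp: lmorphism_def)
  have "\<Sigma>a a \<cdot> h = h' \<cdot> c" using ext_morphism_iff[OF conf_ext[OF x(1)] conf_ext[OF x(2)] aH c] ae by simp
  then show thesis using that[of a b] a by (simp add: lmorphism_def rmorphism_def)
qed

text \<open>The difference of the first components passes through an injective and therefore extends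
  along the inflation \<open>f\<close>. The homotopy lemma then moves the difference of the third
  components through \<open>Tgt C f'\<close>, which lies in \<open>J\<close>.\<close>

lemma conf_unique:
  assumes x: "conflation C Z e f g h" "conflation C Z e' f' g' h'" and J: "Tgt C f' \<in> J"
    and m: "rmorphism C (Sig C) (a, b, c) (f, g, h) (f', g', h')"
      "rmorphism C (Sig C) (a1, b1, c1) (f, g, h) (f', g', h')"
    and a: "cl a = cl a1"
  shows "cl c = cl c1"
proof -
  note X = ext_arr[OF conf_ext[OF x(1)]] ext_arr[OF conf_ext[OF x(2)]]
  have h: "a \<in> Hom C (Src C f) (Src C f')" "a1 \<in> Hom C (Src C f) (Src C f')"
    "c \<in> Hom C (Tgt C g) (Tgt C g')" "c1 \<in> Hom C (Tgt C g) (Tgt C g')"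
    using m by (auto simp: rmorphism_def)
  obtain W u v where uv: "W \<in> J" "u \<in> Hom C (Src C f) W" "v \<in> Hom C W (Src C f')" "a \<boxplus> \<boxminus> a1 = v \<cdot> u"
    using cl_eqE[OF a h(1,2)] by blast
  obtain u' where u': "u' \<in> Hom C (Tgt C f) W" "u' \<cdot> f = u" using injective_extend[OF x(1) uv(1,2)] by blast
  have 1: "v \<cdot> u' \<in> Hom C (Tgt C f) (Src C f')" "a \<boxplus> \<boxminus> a1 = (v \<cdot> u') \<cdot> f" using X uv u' by auto
  obtain t where t: "t \<in> Hom C (Tgt C g) (Src C g')" "c \<boxplus> \<boxminus> c1 = g' \<cdot> t"
    using ext_null_homotopy[OF ac1 conf_ext[OF x(1)] conf_ext[OF x(2)]
        Sg.rmorphism_diff[OF conf_diagram[OF x(1)] conf_diagram[OF x(2)] m] 1] by blast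
  show ?thesis using X J t h by (intro cl_eqI[OF h(3,4) J, of t g']) auto
qed

text \<open>Dually, a third component through a member of \<open>J\<close> lifts along
  \<open>g'\<close>. Comparison with the zero morphism is what faithfulness of the shift asks
  for.\<close>

lemma conf_unique':
  assumes x: "conflation C Z e f g h" "conflation C Z e' f' g' h'" and J: "Tgt C f \<in> J"
    and m: "rmorphism C (Sig C) (a, b, c) (f, g, h) (f', g', h')"
    and c: "cl c = cl (Zer C (Tgt C g) (Tgt C g'))"
  shows "cl a = cl (Zer C (Src C f) (Src C f'))"
proof -
  note X = ext_arr[OF conf_ext[OF x(1)]] ext_arr[OF conf_ext[OF x(2)]]
  have h: "a \<in> Hom C (Src C f) (Src C f')" "c \<in> Hom C (Tgt C g) (Tgt C g')"
    using m by (auto simp: rmorphism_def)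
  have z: "Zer C (Tgt C g) (Tgt C g') \<in> Hom C (Tgt C g) (Tgt C g')" using X by simp
  obtain W u v where uv: "W \<in> J" "u \<in> Hom C (Tgt C g) W" "v \<in> Hom C W (Tgt C g')"
      "c \<boxplus> \<boxminus> Zer C (Tgt C g) (Tgt C g') = v \<cdot> u"
    using cl_eqE[OF c h(2) z] by blast
  have c': "c = v \<cdot> u" using uv(4) h(2) X by simp
  obtain v' where v': "v' \<in> Hom C W (Src C g')" "g' \<cdot> v' = v" using projective_lift[OF x(2) uv(1,3)] by blast
  have "v' \<cdot> u \<in> Hom C (Tgt C g) (Src C g')" using uv(2) v'(1) by simp
  moreover have "c = g' \<cdot> (v' \<cdot> u)" using X uv(2) v' by (simp add: c' v'(2)[THEN comp_eq_comp])
  ultimately obtain t where t: "t \<in> Hom C (Tgt C f) (Src C f')" "a = t \<cdot> f"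
    using ext_null_homotopy'[OF ac2 conf_ext[OF x(1)] conf_ext[OF x(2)] m] by blast
  show ?thesis using X J t h by (intro cl_eqI[OF h(1) _ J, of _ f t]) auto
qed

lemma ex_shift_choice: "\<exists>s. shift_choice C Z D s"
proof -
  have "\<exists>x. \<forall>e f g h. x = (e, f, g, h) \<longrightarrow> conflation C Z e f g h \<and> Src C f = X \<and> Tgt C f \<in> J"
    if "X \<in> Z" for X using enough_injectivesE[OF that] by (metis prod.inject)
  then obtain c where c: "\<And>X e f g h. X \<in> Z \<Longrightarrow> c X = (e, f, g, h) \<Longrightarrow>
      conflation C Z e f g h \<and> Src C f = X \<and> Tgt C f \<in> J" by metis
  define de where "de X = fst (c X)" for X
  define al where "al X = fst (snd (c X))" for X
  define be where "be X = fst (snd (snd (c X)))" for X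
  define ga where "ga X = snd (snd (snd (c X)))" for X
  have 1: "conflation C Z (de X) (al X) (be X) (ga X) \<and> Src C (al X) = X \<and> Tgt C (al X) \<in> J"
    if "X \<in> Z" for X
    using c[OF that, of "de X" "al X" "be X" "ga X"] by (simp add: de_def al_def be_def ga_def)
  \<comment> \<open>Lifts are chosen per arrow; the relation recovers both objects as source and
    target.\<close>
  define R where "R f x \<longleftrightarrow> rmorphism C (Sig C) (f, fst x, snd x)
      (al (Src C f), be (Src C f), ga (Src C f)) (al (Tgt C f), be (Tgt C f), ga (Tgt C f))" for f x
  have 2: "\<exists>x. R f x" if f: "f \<in> Hom C X Y" "X \<in> Z" "Y \<in> Z" for f X Y
  proof -
    obtain b d where "rmorphism C (Sig C) (f, b, d) (al X, be X, ga X) (al Y, be Y, ga Y)"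
      using conf_extend[of "de X" "al X" "be X" "ga X" "de Y" "al Y" "be Y" "ga Y" f]
        1[OF f(2)] 1[OF f(3)] f(1) by metis
    then have "R f (b, d)" using f(1) by (simp add: R_def)
    then show ?thesis by blast
  qed
  define w where "w f = (SOME x. R f x)" for f
  let ?s = "\<lparr>sh_delta = de, sh_alpha = al, sh_beta = be, sh_gamma = ga,
    sh_I = \<lambda>f. fst (w f), sh_S = \<lambda>f. snd (w f)\<rparr>"
  have w: "R f (w f)" if f: "f \<in> Hom C X Y" "X \<in> Z" "Y \<in> Z" for f X Y
    unfolding w_def using 2[OF f] by (rule someI_ex)
  have "rmorphism C (Sig C) (f, fst (w f), snd (w f)) (al X, be X, ga X) (al Y, be Y, ga Y)"
    if "f \<in> Hom C X Y" "X \<in> Z" "Y \<in> Z" for f X Y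
    using w[OF that] that(1) by (simp add: R_def)
  then have "shift_choice C Z D ?s"
    unfolding shift_choice_def shift_data.simps using 1 by blast
  then show ?thesis by blast
qed

end

section \<open>The shift as an additive equivalence of the quotient\<close>

locale shift_setting = frobenius_setting +
  fixes s :: "('a, 'b) shift_data"
  assumes shift: "shift_choice C Z D s"
begin

abbreviation "al \<equiv> sh_alpha s"
abbreviation "be \<equiv> sh_beta s"
abbreviation "ga \<equiv> sh_gamma s"
abbreviation "Io X \<equiv> Tgt C (sh_alpha s X)"
abbreviation "So X \<equiv> Tgt C (sh_beta s X)"
abbreviation "SF \<equiv> shift_functor C Z D s"

lemma sh_conf: "X \<in> Z \<Longrightarrow> conflation C Z (sh_delta s X) (al X) (be X) (ga X)"
  using shift by (simp add: shift_choice_def)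

lemma sh_arr [simp]:
  assumes "X \<in> Z"
  shows "al X \<in> Arr C" "Src C (al X) = X" "be X \<in> Arr C" "Src C (be X) = Io X"
    "ga X \<in> Arr C" "Src C (ga X) = So X" "Tgt C (ga X) = \<Sigma>o X" "Io X \<in> J" "Io X \<in> Z" "So X \<in> Z"
proof -
  show 1: "Src C (al X) = X" and 2: "Io X \<in> J" using shift assms by (auto simp: shift_choice_def)
  show "Io X \<in> Z" using 2 by simp
  show "So X \<in> Z" using conf_Z[OF sh_conf[OF assms]] by simp
  show "al X \<in> Arr C" "be X \<in> Arr C" "Src C (be X) = Io X"
    "ga X \<in> Arr C" "Src C (ga X) = So X" "Tgt C (ga X) = \<Sigma>o X"
    using ext_arr[OF conf_ext[OF sh_conf[OF assms]]] 1 by auto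
qed

lemma sh_diagram: "X \<in> Z \<Longrightarrow> rdiagram C (Sig C) (al X) (be X) (ga X)"
  using conf_diagram sh_conf by blast

lemma sh_mor:
  assumes "f \<in> Hom C X Y" "X \<in> Z" "Y \<in> Z"
  shows "rmorphism C (Sig C) (f, sh_I s f, sh_S s f) (al X, be X, ga X) (al Y, be Y, ga Y)"
  using shift assms unfolding shift_choice_def by blast

lemma SF_Ob [simp]: "FOb SF X = So X"
  by (simp add: shift_functor_def)

text \<open>The shift may be computed from any morphism of the chosen conflations over
  \<open>a\<close>, so functoriality and additivity follow by composing and adding such
  morphisms.\<close>

lemma SF_cl:
  assumes "X \<in> Z" "Y \<in> Z"
    and m: "rmorphism C (Sig C) (a, b, c) (al X, be X, ga X) (al Y, be Y, ga Y)"
  shows "FAr SF (cl a) = cl c"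
proof -
  have a: "a \<in> Hom C X Y" using m assms(1,2) by (simp add: rmorphism_def)
  have "cl (sh_S s f) = cl c" if f: "f \<in> cl a" for f
  proof -
    have f': "f \<in> Hom C X Y" "cl f = cl a" using mem_clD[OF f] a by auto
    show ?thesis
      using conf_unique[OF sh_conf[OF assms(1)] sh_conf[OF assms(2)] _ sh_mor[OF f'(1) assms(1,2)] m f'(2)]
        assms by simp
  qed
  moreover have "cl a \<noteq> {}" using mem_cl a by auto
  ultimately have "(\<Union>f\<in>cl a. cl (sh_S s f)) = cl c" by (intro SUP_eq_const) auto
  then show ?thesis by (simp add: shift_functor_def)
qed

lemma SF_cl_S:
  assumes "f \<in> Hom C X Y" "X \<in> Z" "Y \<in> Z"
  shows "FAr SF (cl f) = cl (sh_S s f)" "sh_S s f \<in> Hom C (So X) (So Y)"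
  using SF_cl[OF assms(2,3) sh_mor[OF assms]] sh_mor[OF assms] by (auto simp: rmorphism_def)

lemma SF_additive: "additive_endofunctor Q SF"
  unfolding additive_endofunctor_def endofunctor_def
proof (intro conjI ballI impI)
  fix A assume "A \<in> Obj Q"
  then have A: "A \<in> Z" by simp
  show "FOb SF A \<in> Obj Q" using A by simp
  have "rmorphism C (Sig C) (Idn C A, Idn C (Io A), Idn C (So A)) (al A, be A, ga A) (al A, be A, ga A)"
    using Sg.rmorphism_Idn[OF sh_diagram[OF A]] A by simp
  then show "FAr SF (Idn Q A) = Idn Q (FOb SF A)" using SF_cl A by simp
next
  fix F assume "F \<in> Arr Q"
  then obtain f where f: "f \<in> Hom C (Src C f) (Tgt C f)" "Src C f \<in> Z" "Tgt C f \<in> Z" "F = cl f"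
    by (auto elim: Q_ArrE)
  then show "FAr SF F \<in> Hom Q (FOb SF (Src Q F)) (FOb SF (Tgt Q F))"
    using SF_cl_S[OF f(1-3)] by simp
  fix G assume "G \<in> Arr Q" "Src Q G = Tgt Q F"
  then obtain g where g: "g \<in> Hom C (Tgt C f) (Tgt C g)" "Tgt C g \<in> Z" "G = cl g"
    using f by (auto elim!: Q_ArrE)
  have "rmorphism C (Sig C) (g \<cdot> f, sh_I s g \<cdot> sh_I s f, sh_S s g \<cdot> sh_S s f)
     (al (Src C f), be (Src C f), ga (Src C f)) (al (Tgt C g), be (Tgt C g), ga (Tgt C g))"
    using Sg.rmorphism_comp[OF sh_diagram sh_diagram sh_diagram sh_mor[OF f(1-3)] sh_mor[OF g(1) f(3) g(2)]]
      f g by blast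
  then have "FAr SF (cl (g \<cdot> f)) = cl (sh_S s g \<cdot> sh_S s f)" using SF_cl f g by blast
  then show "FAr SF (G \<cdot>\<^bsub>Q\<^esub> F) = FAr SF G \<cdot>\<^bsub>Q\<^esub> FAr SF F"
    using f g SF_cl_S[OF f(1-3)] SF_cl_S[OF g(1) f(3) g(2)] by simp
next
  fix A B F G assume "A \<in> Obj Q" "B \<in> Obj Q" "F \<in> Hom Q A B" "G \<in> Hom Q A B"
  then obtain f g where fg: "f \<in> Hom C A B" "g \<in> Hom C A B" "A \<in> Z" "B \<in> Z" "F = cl f" "G = cl g"
    by (auto elim!: Q_HomE simp del: Hom_iff Q.Hom_iff)
  have "rmorphism C (Sig C) (f \<boxplus> g, sh_I s f \<boxplus> sh_I s g, sh_S s f \<boxplus> sh_S s g)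
     (al A, be A, ga A) (al B, be B, ga B)"
    using Sg.rmorphism_Plus[OF sh_diagram sh_diagram sh_mor[OF fg(1,3,4)] sh_mor[OF fg(2-4)]] fg by blast
  then have "FAr SF (cl (f \<boxplus> g)) = cl (sh_S s f \<boxplus> sh_S s g)" using SF_cl fg by blast
  then show "FAr SF (F \<boxplus>\<^bsub>Q\<^esub> G) = FAr SF F \<boxplus>\<^bsub>Q\<^esub> FAr SF G"
    using fg SF_cl_S[OF fg(1,3,4)] SF_cl_S[OF fg(2-4)] by simp
qed

sublocale SQ: shifted_category Q SF
  by unfold_locales (rule SF_additive)

text \<open>A representative of \<open>K\<close> lifts backwards through the projective middle terms
  to a morphism of conflations, whose first component is the preimage.\<close>

lemma SF_full:
  assumes "A \<in> Z" "B \<in> Z" "K \<in> Hom Q (So A) (So B)"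
  shows "\<exists>F \<in> Hom Q A B. FAr SF F = K"
proof -
  obtain c where c: "c \<in> Hom C (So A) (So B)" "K = cl c" using Q_HomE[OF assms(3)] by blast
  obtain a b where m: "rmorphism C (Sig C) (a, b, c) (al A, be A, ga A) (al B, be B, ga B)"
    using conf_lift[OF sh_conf[OF assms(1)] sh_conf[OF assms(2)] _ c(1)] assms by auto
  then have "a \<in> Hom C A B" using assms by (simp add: rmorphism_def)
  then show ?thesis using SF_cl[OF assms(1,2) m] c(2) Q_HomI assms(1,2) by blast
qed

lemma SF_faithful:
  assumes "F \<in> Hom Q A B" "FAr SF F = Zer Q (So A) (So B)"
  shows "F = Zer Q A B"
proof -
  obtain f where f: "f \<in> Hom C A B" "A \<in> Z" "B \<in> Z" "F = cl f" using Q_HomE[OF assms(1)] by blast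
  have "cl (sh_S s f) = cl (Zer C (So A) (So B))" using assms(2) f SF_cl_S[OF f(1-3)] by simp
  then show ?thesis
    using conf_unique'[OF sh_conf[OF f(2)] sh_conf[OF f(3)] _ sh_mor[OF f(1-3)]] f by simp
qed

text \<open>Take \<open>A\<close> as first term of a conflation ending in \<open>B\<close> with
  middle term in \<open>J\<close>. This and the chosen conflation of \<open>A\<close> have injective
  middle terms, so the identity of \<open>A\<close> extends both ways; uniqueness makes the third
  components mutually inverse in the quotient.\<close>

lemma SF_essentially_surjective:
  assumes "B \<in> Z"
  shows "\<exists>A \<in> Z. isomorphic Q (So A) B"
proof -
  obtain e f g h where x: "conflation C Z e f g h" "Tgt C g = B" "Tgt C f \<in> J"
    using enough_projectivesE[OF assms] by blast
  let ?A = "Src C f"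
  have A: "?A \<in> Z" using conf_Z[OF x(1)] by simp
  note X = ext_arr[OF conf_ext[OF x(1)]] and y = sh_conf[OF A]
  note d = conf_diagram[OF x(1)] conf_diagram[OF y]
  obtain b c where m: "rmorphism C (Sig C) (Idn C ?A, b, c) (f, g, h) (al ?A, be ?A, ga ?A)"
    using conf_extend[OF x(1) y, of "Idn C ?A"] A by auto
  obtain b' c' where m': "rmorphism C (Sig C) (Idn C ?A, b', c') (al ?A, be ?A, ga ?A) (f, g, h)"
    using conf_extend[OF y x(1) x(3), of "Idn C ?A"] A by auto
  have c: "c \<in> Hom C B (So ?A)" "c' \<in> Hom C (So ?A) B" using m m' x(2) by (auto simp: rmorphism_def)
  have "cl (c' \<cdot> c) = cl (Idn C B)"
    using conf_unique[OF x(1) x(1) x(3) Sg.rmorphism_comp[OF d(1,2,1) m m'] Sg.rmorphism_Idn[OF d(1)]]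
      A x(2) by simp
  moreover have "cl (c \<cdot> c') = cl (Idn C (So ?A))"
    using conf_unique[OF y y _ Sg.rmorphism_comp[OF d(2,1,2) m' m] Sg.rmorphism_Idn[OF d(2)]] A by simp
  ultimately have "iso_arrow Q (cl c')" "cl c' \<in> Hom Q (So ?A) B"
    using c A assms by (auto intro!: Q.iso_arrowI[of "cl c'" "So ?A" B "cl c"])
  then show ?thesis using A unfolding isomorphic_def by blast
qed

end

section \<open>Octahedra\<close>

context pre_right_triangulation
begin

lemma RT_isoI':
  assumes t: "(f', g', h') \<in> RT" and d: "rdiagram C \<Sigma> f g h"
    and m: "rmorphism C \<Sigma> (a, b, c) (f, g, h) (f', g', h')" "iso_arrow C a" "iso_arrow C b" "iso_arrow C c"
  shows "(f, g, h) \<in> RT"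
proof -
  have "risomorphic C \<Sigma> (f, g, h) (f', g', h')" using m unfolding risomorphic_def by blast
  then show ?thesis
    using Sg.risomorphic_sym[OF d tri_diagram[OF t]] tri_iso_closed[OF t d] by blast
qed

text \<open>Octahedra may be built for isomorphic data. Isomorphisms of the third triangles, of the
  common source and of \<open>M\<close> are given; those of the other two cones, \<open>c\<close>
  and \<open>d\<close>, come from (RTR3) and the five lemma.\<close>

lemma octahedron_transfer:
  assumes t: "(f, g, h) \<in> RT" "(l, m, n) \<in> RT" "(l', m', n') \<in> RT"
    and s: "Src C l = Src C f" "Tgt C l' = Tgt C l" "Tgt C m' = Tgt C f" "m' \<cdot> l = f"
    and t1: "(f1, g1, h1) \<in> RT" "(l1, m1, n1) \<in> RT" "(l1', m1', n1') \<in> RT"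
    and s1: "Src C l1 = Src C f1" "Tgt C l1' = Tgt C l1" "Tgt C m1' = Tgt C f1" "m1' \<cdot> l1 = f1"
    and a: "a \<in> Hom C (Src C f) (Src C f1)" "iso_arrow C a"
    and \<mu>: "\<mu> \<in> Hom C (Tgt C l) (Tgt C l1)" "iso_arrow C \<mu>" "\<mu> \<cdot> l = l1 \<cdot> a"
    and r: "rmorphism C \<Sigma> (a', \<mu>, b) (l', m', n') (l1', m1', n1')" "iso_arrow C a'" "iso_arrow C b"
    and o: "\<exists>g1' \<in> Hom C (Tgt C m1) (Tgt C g1). \<exists>h1' \<in> Hom C (Tgt C g1) (FOb \<Sigma> (Src C l1')).
        h1' \<cdot> g1 = n1' \<and> h1 \<cdot> g1' = n1 \<and> g1' \<cdot> m1 = g1 \<cdot> m1' \<and>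
        FAr \<Sigma> l1 \<cdot> h1 \<boxplus> FAr \<Sigma> l1' \<cdot> h1' = Zer C (Tgt C g1) (FOb \<Sigma> (Tgt C l1)) \<and>
        (m1 \<cdot> l1', g1', h1') \<in> RT"
  shows "\<exists>g' \<in> Hom C (Tgt C m) (Tgt C g). \<exists>h' \<in> Hom C (Tgt C g) (FOb \<Sigma> (Src C l')).
        h' \<cdot> g = n' \<and> h \<cdot> g' = n \<and> g' \<cdot> m = g \<cdot> m' \<and>
        FAr \<Sigma> l \<cdot> h \<boxplus> FAr \<Sigma> l' \<cdot> h' = Zer C (Tgt C g) (FOb \<Sigma> (Tgt C l)) \<and>
        (m \<cdot> l', g', h') \<in> RT"
proof -
  obtain g1' h1' where g1': "g1' \<in> Hom C (Tgt C m1) (Tgt C g1)"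
    and h1': "h1' \<in> Hom C (Tgt C g1) (FOb \<Sigma> (Src C l1'))"
    and o: "h1' \<cdot> g1 = n1'" "h1 \<cdot> g1' = n1" "g1' \<cdot> m1 = g1 \<cdot> m1'"
        "FAr \<Sigma> l1 \<cdot> h1 \<boxplus> FAr \<Sigma> l1' \<cdot> h1' = Zer C (Tgt C g1) (FOb \<Sigma> (Tgt C l1))"
        "(m1 \<cdot> l1', g1', h1') \<in> RT"
    using o by blast
  note T = RT_arr[OF t(1)] RT_arr[OF t(2)] RT_arr[OF t(3)] s(1-3)
  note T1 = RT_arr[OF t1(1)] RT_arr[OF t1(2)] RT_arr[OF t1(3)] s1(1-3)
  have ab: "a' \<in> Hom C (Src C l') (Src C l1')" "b \<in> Hom C (Tgt C f) (Tgt C f1)"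
    and re: "\<mu> \<cdot> l' = l1' \<cdot> a'" "b \<cdot> m' = m1' \<cdot> \<mu>" "FAr \<Sigma> a' \<cdot> n' = n1' \<cdot> b"
    using r(1) T T1 by (auto simp: rmorphism_def)
  have bf: "b \<cdot> f = f1 \<cdot> a"
  proof -
    have "b \<cdot> f = m1' \<cdot> \<mu> \<cdot> l"
      using T T1 ab \<mu>(1) comp_assoc_arr[of l m' b] by (simp add: s(4) re(2))
    also have "\<dots> = f1 \<cdot> a" using T T1 a(1) \<mu>(1) comp_assoc_arr[of a l1 m1'] by (simp add: \<mu>(3) s1(4))
    finally show ?thesis .
  qed
  obtain c where c: "rmorphism C \<Sigma> (a, b, c) (f, g, h) (f1, g1, h1)" "iso_arrow C c"
    using RT_ex_iso[OF t(1) t1(1) a(1) ab(2) bf a(2) r(3)] by blast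
  have "a \<in> Hom C (Src C l) (Src C l1)" using a(1) s s1 by simp
  then obtain d where d: "rmorphism C \<Sigma> (a, \<mu>, d) (l, m, n) (l1, m1, n1)" "iso_arrow C d"
    using RT_ex_iso[OF t(2) t1(2) _ \<mu>(1,3) a(2) \<mu>(2)] by blast
  have cH: "c \<in> Hom C (Tgt C g) (Tgt C g1)" and ce: "c \<cdot> g = g1 \<cdot> b" "FAr \<Sigma> a \<cdot> h = h1 \<cdot> c"
    using c(1) by (auto simp: rmorphism_def)
  have dH: "d \<in> Hom C (Tgt C m) (Tgt C m1)" and de: "d \<cdot> m = m1 \<cdot> \<mu>" "FAr \<Sigma> a \<cdot> n = n1 \<cdot> d"
    using d(1) by (auto simp: rmorphism_def)
  obtain ci where ci: "ci \<in> Hom C (Tgt C g1) (Tgt C g)" "ci \<cdot> c = Idn C (Tgt C g)" "c \<cdot> ci = Idn C (Tgt C g1)"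
    using iso_arrowE[OF c(2) cH] by blast
  have "FAr \<Sigma> a' \<in> Hom C (FOb \<Sigma> (Src C l')) (FOb \<Sigma> (Src C l1'))" using ab by simp
  then obtain k where k: "k \<in> Hom C (FOb \<Sigma> (Src C l1')) (FOb \<Sigma> (Src C l'))"
    "k \<cdot> FAr \<Sigma> a' = Idn C (FOb \<Sigma> (Src C l'))" "FAr \<Sigma> a' \<cdot> k = Idn C (FOb \<Sigma> (Src C l1'))"
    using iso_arrowE[OF Sg.FAr_iso_arrow[OF r(2)]] by blast
  \<comment> \<open>The known arrows conjugated by the isomorphisms of triangles; \<open>k\<close>
    is the inverse of the suspended \<open>a'\<close>.\<close>
  define g' where "g' = ci \<cdot> g1' \<cdot> d"
  define h' where "h' = k \<cdot> h1' \<cdot> c"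
  have g': "g' \<in> Hom C (Tgt C m) (Tgt C g)" using ci(1) g1' dH by (simp add: g'_def)
  have h': "h' \<in> Hom C (Tgt C g) (FOb \<Sigma> (Src C l'))" using k(1) h1' cH by (simp add: h'_def)
  have cg': "c \<cdot> g' = g1' \<cdot> d" using ci(1) cH g1' dH by (simp add: g'_def ci(3)[THEN comp_eq_comp])
  have ah': "FAr \<Sigma> a' \<cdot> h' = h1' \<cdot> c"
    using k(1) cH h1' ab by (simp add: h'_def k(3)[THEN comp_eq_comp])
  have e1: "h' \<cdot> g = n'"
    using T T1 k(1) h1' cH ab
    by (simp add: h'_def ce(1) o(1)[THEN comp_eq_comp] re(3)[symmetric] k(2)[THEN comp_eq_comp])
  \<comment> \<open>From here on relations are checked after composition with an isomorphism, in
    turn \<open>FAr \<Sigma> a\<close>, \<open>c\<close> and \<open>FAr \<Sigma> \<mu>\<close>,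
    which is then cancelled.\<close>
  have "FAr \<Sigma> a \<cdot> (h \<cdot> g') = FAr \<Sigma> a \<cdot> n"
    using T T1 a(1) g' cH g1' dH
    by (simp add: ce(2)[THEN comp_eq_comp] cg' o(2)[THEN comp_eq_comp] de(2))
  then have e2: "h \<cdot> g' = n"
    using iso_arrow_cancel_left[OF Sg.FAr_iso_arrow[OF a(2)], of "FOb \<Sigma> (Src C f)"
        "FOb \<Sigma> (Src C f1)" "h \<cdot> g'" "Tgt C m" n] T a(1) g' by simp
  have "c \<cdot> (g' \<cdot> m) = c \<cdot> (g \<cdot> m')"
    using T T1 g' cH g1' dH \<mu>(1) ab
    by (simp add: cg'[THEN comp_eq_comp] ce(1)[THEN comp_eq_comp] de(1) o(3)[THEN comp_eq_comp] re(2))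
  then have e3: "g' \<cdot> m = g \<cdot> m'"
    using iso_arrow_cancel_left[OF c(2) cH, of "g' \<cdot> m" "Tgt C l" "g \<cdot> m'"] T g' by simp
  have \<mu>l: "FAr \<Sigma> \<mu> \<cdot> FAr \<Sigma> l = FAr \<Sigma> l1 \<cdot> FAr \<Sigma> a"
    using T T1 a(1) \<mu>(1) arg_cong[OF \<mu>(3), of "FAr \<Sigma>"] by simp
  have \<mu>l': "FAr \<Sigma> \<mu> \<cdot> FAr \<Sigma> l' = FAr \<Sigma> l1' \<cdot> FAr \<Sigma> a'"
    using T T1 ab \<mu>(1) arg_cong[OF re(1), of "FAr \<Sigma>"] by simp
  have "FAr \<Sigma> \<mu> \<cdot> (FAr \<Sigma> l \<cdot> h \<boxplus> FAr \<Sigma> l' \<cdot> h') = (FAr \<Sigma> l1 \<cdot> h1 \<boxplus> FAr \<Sigma> l1' \<cdot> h1') \<cdot> c"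
    using T T1 a(1) ab \<mu>(1) h' h1' cH
    by (simp add: \<mu>l[THEN comp_eq_comp] \<mu>l'[THEN comp_eq_comp] ce(2) ah')
  also have "\<dots> = FAr \<Sigma> \<mu> \<cdot> Zer C (Tgt C g) (FOb \<Sigma> (Tgt C l))"
    unfolding o(4) using T T1 cH \<mu>(1) by simp
  finally have e4: "FAr \<Sigma> l \<cdot> h \<boxplus> FAr \<Sigma> l' \<cdot> h' = Zer C (Tgt C g) (FOb \<Sigma> (Tgt C l))"
    using iso_arrow_cancel_left[OF Sg.FAr_iso_arrow[OF \<mu>(2)], of "FOb \<Sigma> (Tgt C l)"
        "FOb \<Sigma> (Tgt C l1)" "FAr \<Sigma> l \<cdot> h \<boxplus> FAr \<Sigma> l' \<cdot> h'" "Tgt C g"] T \<mu>(1) h' by simp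
  have "(m \<cdot> l', g', h') \<in> RT"
  proof (rule RT_isoI'[OF o(5) _ _ r(2) d(2) c(2)])
    show "rdiagram C \<Sigma> (m \<cdot> l') g' h'" using T g' h' by (simp add: rdiagram_def)
    show "rmorphism C \<Sigma> (a', d, c) (m \<cdot> l', g', h') (m1 \<cdot> l1', g1', h1')"
      using T T1 g' h' g1' h1' ab cH dH cg' ah' \<mu>(1)
      by (simp add: rmorphism_def de(1)[THEN comp_eq_comp] re(1))
  qed
  then show ?thesis using g' h' e1 e2 e3 e4 by blast
qed

end

text \<open>Lifts the sum relation of the octahedron from \<Sigma>M to the third term of an
  extension starting at M: \<open>z\<close> says that \<open>\<gamma>\<close> kills
  \<open>c1 + c2\<close>, and (AC1) upgrades this to a factorization through \<open>\<beta>\<close>.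
  In the quotient, with an injective middle term, the sum vanishes.\<close>

lemma (in pseudo_triangulated) ext_octahedron_sum:
  assumes AC: "AC1 C"
    and x: "extension C e f g h" "extension C e1 l m n" "extension C e2 l' m' n'"
      "extension C e3 (m \<cdot> l') g' h'"
    and s: "Src C l = Src C f" "Tgt C l' = Tgt C l" "Tgt C m' = Tgt C f" "m' \<cdot> l = f"
    and g': "g' \<in> Hom C (Tgt C m) (Tgt C g)" "g' \<cdot> m = g \<cdot> m'"
    and h': "h' \<in> Hom C (Tgt C g) (\<Sigma>o (Src C l'))" "h' \<cdot> g = n'"
    and z: "\<Sigma>a l \<cdot> h \<boxplus> \<Sigma>a l' \<cdot> h' = Zer C (Tgt C g) (\<Sigma>o (Tgt C l))"
    and y: "extension C e4 \<alpha> \<beta> \<gamma>" "Src C \<alpha> = Tgt C l"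
    and r1: "rmorphism C (Sig C) (l, b1, c1) (f, g, h) (\<alpha>, \<beta>, \<gamma>)"
    and r2: "rmorphism C (Sig C) (l', b2, c2) (m \<cdot> l', g', h') (\<alpha>, \<beta>, \<gamma>)"
  obtains t where "t \<in> Hom C (Tgt C g) (Tgt C \<alpha>)" "c1 \<boxplus> c2 = \<beta> \<cdot> t"
proof -
  let ?M = "Tgt C l" and ?I = "Tgt C \<alpha>" and ?S = "Tgt C \<beta>" and ?D = "Tgt C g"
  note X = ext_arr[OF x(1)] ext_arr[OF x(2)] ext_arr[OF x(3)] s(1-3) ext_arr[OF y(1)] y(2)
  have b1: "b1 \<in> Hom C (Tgt C f) ?I" and c1: "c1 \<in> Hom C ?D ?S"
    and E1: "b1 \<cdot> f = \<alpha> \<cdot> l" "c1 \<cdot> g = \<beta> \<cdot> b1" "\<Sigma>a l \<cdot> h = \<gamma> \<cdot> c1"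
    using r1 by (auto simp: rmorphism_def)
  have b2: "b2 \<in> Hom C (Tgt C m) ?I" and c2: "c2 \<in> Hom C ?D ?S"
    and E2: "b2 \<cdot> (m \<cdot> l') = \<alpha> \<cdot> l'" "c2 \<cdot> g' = \<beta> \<cdot> b2" "\<Sigma>a l' \<cdot> h' = \<gamma> \<cdot> c2"
    using r2 X g'(1) by (auto simp: rmorphism_def)
  \<comment> \<open>The sum of the two middle components differs from \<open>\<alpha>\<close> by
    \<open>k\<close>, which kills \<open>l'\<close> and \<open>l\<close>; hence k = t g m' for some
    \<open>t\<close>. As \<beta>\<alpha> = 0, subtracting \<beta>t from \<open>c1 + c2\<close> gives
    an arrow killing \<open>g \<cdot> m'\<close>.\<close>
  define k where "k = b1 \<cdot> m' \<boxplus> b2 \<cdot> m \<boxplus> \<boxminus> \<alpha>"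
  have k: "k \<in> Hom C ?M ?I" using X b1 b2 by (simp add: k_def)
  have "k \<cdot> l' = Zer C (Src C l') ?I"
    using X b1 b2 RT_comp_zero[OF ext_tri(1)[OF x(3)]] by (simp add: k_def E2(1))
  then obtain j where j: "j \<in> Hom C (Tgt C f) ?I" "j \<cdot> m' = k"
    using RT_weak_cokernel[OF ext_tri(1)[OF x(3)], of k ?I] k s by auto
  have "j \<cdot> f = k \<cdot> l" using X j(1) comp_assoc_arr[of l m' j] by (simp add: s(4) j(2))
  also have "\<dots> = Zer C (Src C f) ?I"
    using X b1 b2 RT_comp_zero[OF ext_tri(1)[OF x(2)]] by (simp add: k_def s(4) E1(1))
  finally obtain t where t: "t \<in> Hom C ?D ?I" "t \<cdot> g = j"
    using RT_weak_cokernel[OF ext_tri(1)[OF x(1)] j(1)] by blast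
  let ?c = "c1 \<boxplus> c2 \<boxplus> \<boxminus> (\<beta> \<cdot> t)"
  have c: "?c \<in> Hom C ?D ?S" using X c1 c2 t by simp
  have "t \<cdot> (g \<cdot> m') = k" using X t(1) j by (simp add: t(2)[THEN comp_eq_comp])
  moreover have "c2 \<cdot> (g \<cdot> m') = \<beta> \<cdot> (b2 \<cdot> m)"
    using X c2 b2 g'(1) by (simp add: g'(2)[symmetric] E2(2)[THEN comp_eq_comp])
  moreover have "c1 \<cdot> (g \<cdot> m') = \<beta> \<cdot> (b1 \<cdot> m')"
    using X c1 b1 by (simp add: E1(2)[THEN comp_eq_comp])
  ultimately have "?c \<cdot> (g \<cdot> m') = \<beta> \<cdot> (b1 \<cdot> m') \<boxplus> (\<beta> \<cdot> (b2 \<cdot> m) \<boxplus> \<boxminus> (\<beta> \<cdot> k))"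
    using X c1 c2 t(1) k by simp
  also have "\<dots> = \<beta> \<cdot> ((b1 \<cdot> m' \<boxplus> b2 \<cdot> m) \<boxplus> \<boxminus> (b1 \<cdot> m' \<boxplus> b2 \<cdot> m)) \<boxplus> \<beta> \<cdot> \<alpha>"
    using X b1 b2 by (simp add: k_def del: Plus_Neg)
  also have "\<dots> = Zer C ?M ?S"
    using X b1 b2 RT_comp_zero[OF ext_tri(1)[OF y(1)]] by (subst Plus_Neg) simp_all
  finally have 1: "?c \<cdot> (g \<cdot> m') = Zer C ?M ?S" .
  have 2: "\<gamma> \<cdot> ?c = Zer C ?D (Tgt C \<gamma>)"
    using X c1 c2 t(1) z h'(1) by (simp add: E1(3)[symmetric] E2(3)[symmetric]
        RT_comp_zero2[OF ext_tri(1)[OF y(1)], THEN comp_eq_comp])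
  \<comment> \<open>(AC1) speaks about extensions, so \<open>g \<cdot> m'\<close> must first be
    recognised as the last arrow of one.\<close>
  obtain e5 f5 h5 where 3: "extension C e5 f5 (g \<cdot> m') h5"
    using ext_of_Sigma_epic[OF ext_comp_Sigma_epic[OF x(1,3) s(3) h']] by blast
  have "\<exists>d \<in> Hom C (Tgt C (g \<cdot> m')) (Src C \<beta>). ?c = \<beta> \<cdot> d"
    by (rule AC[unfolded AC1_def, rule_format]) (use 3 y(1) c 1 2 X in auto)
  then obtain d where d: "d \<in> Hom C ?D ?I" "?c = \<beta> \<cdot> d" using X by auto
  have "c1 \<boxplus> c2 = \<beta> \<cdot> t \<boxplus> \<beta> \<cdot> d" using X c1 c2 t(1) d by (intro diff_eqD[of _ ?D ?S]) auto
  then show thesis using that[of "t \<boxplus> d"] X t d by simp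
qed

section \<open>The right triangulation of the quotient\<close>

context shift_setting
begin

abbreviation "Td \<equiv> distinguished_triangles C Z D s"

text \<open>The data of a standard triangle, recast as a morphism over the identity into the chosen
  conflation of the source. Comparisons of connecting arrows thereby become compositions of
  morphisms of conflations.\<close>

definition connecting :: "'b \<Rightarrow> 'b \<Rightarrow> 'b \<Rightarrow> 'b \<Rightarrow> 'b \<Rightarrow> bool" where
  "connecting f g h p q \<longleftrightarrow> rmorphism C (Sig C) (Idn C (Src C f), p, q) (f, g, h)
     (al (Src C f), be (Src C f), ga (Src C f))"

lemma connecting_ex:
  assumes "conflation C Z e f g h"
  obtains p q where "connecting f g h p q"
  using conf_extend[OF assms sh_conf, of "Src C f" "Idn C (Src C f)"] conf_Z[OF assms]
  unfolding connecting_def by auto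

lemma connectingD:
  assumes "conflation C Z e f g h" "connecting f g h p q"
  shows "p \<in> Hom C (Tgt C f) (Io (Src C f))" "q \<in> Hom C (Tgt C g) (So (Src C f))"
    "p \<cdot> f = al (Src C f)" "q \<cdot> g = be (Src C f) \<cdot> p" "ga (Src C f) \<cdot> q = h"
  using assms(2) conf_Z[OF assms(1)] ext_arr[OF conf_ext[OF assms(1)]]
  unfolding connecting_def by (auto simp: rmorphism_def)

lemma standard_iff:
  "t \<in> standard_triangles C Z D s \<longleftrightarrow> (\<exists>e f g h p q. t = (cl f, cl g, cl q) \<and>
     conflation C Z e f g h \<and> connecting f g h p q)"
proof
  assume "t \<in> standard_triangles C Z D s"
  then obtain e f g h p q where x: "conflation C Z e f g h" and t: "t = (cl f, cl g, cl q)"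
    and pq: "p \<in> Hom C (Tgt C f) (Io (Src C f))" "q \<in> Hom C (Tgt C g) (So (Src C f))"
      "p \<cdot> f = al (Src C f)" "q \<cdot> g = be (Src C f) \<cdot> p" "ga (Src C f) \<cdot> q = h"
    unfolding standard_triangles_def by blast
  have "connecting f g h p q"
    using pq conf_Z[OF x] ext_arr[OF conf_ext[OF x]] by (simp add: connecting_def rmorphism_def)
  then show "\<exists>e f g h p q. t = (cl f, cl g, cl q) \<and> conflation C Z e f g h \<and> connecting f g h p q"
    using x t by blast
next
  assume "\<exists>e f g h p q. t = (cl f, cl g, cl q) \<and> conflation C Z e f g h \<and> connecting f g h p q"
  then obtain e f g h p q where x: "t = (cl f, cl g, cl q)" "conflation C Z e f g h" "connecting f g h p q"
    by blast
  show "t \<in> standard_triangles C Z D s"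
    unfolding standard_triangles_def mem_Collect_eq
    by (rule exI[of _ e], rule exI[of _ f], rule exI[of _ g], rule exI[of _ h], rule exI[of _ p],
        rule exI[of _ q], rule exI[of _ "Src C f"]) (intro conjI refl x connectingD[OF x(2,3)])
qed

lemma standard_diagram:
  assumes "conflation C Z e f g h" "connecting f g h p q"
  shows "rdiagram Q SF (cl f) (cl g) (cl q)"
  using connectingD[OF assms] conf_Z[OF assms(1)] ext_arr[OF conf_ext[OF assms(1)]]
  by (simp add: rdiagram_def)

lemma Td_iff:
  "(u, v, w) \<in> Td \<longleftrightarrow> rdiagram Q SF u v w \<and> (\<exists>e f g h p q. conflation C Z e f g h \<and>
     connecting f g h p q \<and> risomorphic Q SF (u, v, w) (cl f, cl g, cl q))"
proof -
  have "(u, v, w) \<in> Td \<longleftrightarrow> rdiagram Q SF u v w \<and>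
      (\<exists>t. t \<in> standard_triangles C Z D s \<and> risomorphic Q SF (u, v, w) t)"
    by (simp add: distinguished_triangles_def Bex_def)
  then show ?thesis unfolding standard_iff by blast
qed

lemma standard_Td:
  assumes "conflation C Z e f g h" "connecting f g h p q"
  shows "(cl f, cl g, cl q) \<in> Td"
proof -
  have "risomorphic Q SF (cl f, cl g, cl q) (cl f, cl g, cl q)"
    unfolding risomorphic_def
    using SQ.rmorphism_Idn[OF standard_diagram[OF assms]] connectingD[OF assms]
      conf_Z[OF assms(1)] ext_arr[OF conf_ext[OF assms(1)]] Q.iso_arrow_Idn
    by (intro exI conjI) auto
  then show ?thesis unfolding Td_iff using standard_diagram[OF assms] assms by blast
qed

lemma Td_diagram: "(u, v, w) \<in> Td \<Longrightarrow> rdiagram Q SF u v w"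
  by (simp add: distinguished_triangles_def)

lemma TdE:
  assumes "(u, v, w) \<in> Td"
  obtains e f g h p q a b c where "conflation C Z e f g h" "connecting f g h p q"
    "rmorphism Q SF (a, b, c) (u, v, w) (cl f, cl g, cl q)"
    "iso_arrow Q a" "iso_arrow Q b" "iso_arrow Q c"
  using assms unfolding Td_iff risomorphic_def by blast

lemma Td_iso_closed:
  assumes "(u, v, w) \<in> Td" "rdiagram Q SF u' v' w'" "risomorphic Q SF (u, v, w) (u', v', w')"
  shows "(u', v', w') \<in> Td"
proof -
  obtain e f g h p q where x: "conflation C Z e f g h" "connecting f g h p q"
    and i: "risomorphic Q SF (u, v, w) (cl f, cl g, cl q)"
    using assms(1) unfolding Td_iff by blast
  note d = Td_diagram[OF assms(1)] standard_diagram[OF x]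
  have "risomorphic Q SF (u', v', w') (cl f, cl g, cl q)"
    using SQ.risomorphic_trans[OF assms(2) d SQ.risomorphic_sym[OF d(1) assms(2,3)] i] .
  then show ?thesis unfolding Td_iff using assms(2) x by blast
qed

lemma Td_isoI:
  assumes "(u, v, w) \<in> Td" "rdiagram Q SF u' v' w'"
    and "rmorphism Q SF (a, b, c) (u', v', w') (u, v, w)" "iso_arrow Q a" "iso_arrow Q b" "iso_arrow Q c"
  shows "(u', v', w') \<in> Td"
  using Td_iso_closed[OF assms(1,2)] SQ.risomorphic_sym[OF assms(2) Td_diagram[OF assms(1)]] assms(3-)
  unfolding risomorphic_def by blast

text \<open>Two morphisms over \<open>a\<close> lead into the chosen conflation of the second
  source: one through the second conflation, one through the chosen conflation of the first source.
  Their third components agree in the quotient, which is the last square.\<close>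

lemma standard_morphism:
  assumes x: "conflation C Z e f g h" "connecting f g h p q"
    and x': "conflation C Z e' f' g' h'" "connecting f' g' h' p' q'"
    and m: "rmorphism C (Sig C) (a, b, c) (f, g, h) (f', g', h')"
  shows "rmorphism Q SF (cl a, cl b, cl c) (cl f, cl g, cl q) (cl f', cl g', cl q')"
proof -
  let ?A = "Src C f" and ?A' = "Src C f'"
  note X = ext_arr[OF conf_ext[OF x(1)]] ext_arr[OF conf_ext[OF x'(1)]]
  note O = conf_Z[OF x(1)] conf_Z[OF x'(1)]
  note P = connectingD[OF x] connectingD[OF x']
  have abc: "a \<in> Hom C ?A ?A'" "b \<in> Hom C (Tgt C f) (Tgt C f')" "c \<in> Hom C (Tgt C g) (Tgt C g')"
    and E: "b \<cdot> f = f' \<cdot> a" "c \<cdot> g = g' \<cdot> b"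
    using m by (auto simp: rmorphism_def)
  note S = SF_cl_S[OF abc(1) O(1,4)]
  have "rmorphism C (Sig C) (Idn C ?A' \<cdot> a, p' \<cdot> b, q' \<cdot> c) (f, g, h) (al ?A', be ?A', ga ?A')"
    using Sg.rmorphism_comp[OF conf_diagram[OF x(1)] conf_diagram[OF x'(1)] sh_diagram[OF O(4)] m]
      x'(2) unfolding connecting_def by blast
  moreover have "rmorphism C (Sig C) (a \<cdot> Idn C ?A, sh_I s a \<cdot> p, sh_S s a \<cdot> q) (f, g, h)
      (al ?A', be ?A', ga ?A')"
    using Sg.rmorphism_comp[OF conf_diagram[OF x(1)] sh_diagram[OF O(1)] sh_diagram[OF O(4)]
        x(2)[unfolded connecting_def] sh_mor[OF abc(1) O(1,4)]] .
  ultimately have "cl (sh_S s a \<cdot> q) = cl (q' \<cdot> c)"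
    using conf_unique[OF x(1) sh_conf[OF O(4)]] abc(1) O by (metis comp_Idn Hom_iff sh_arr(8))
  then show ?thesis
    using X O P abc E S by (simp add: rmorphism_def)
qed

text \<open>That the cone lies in \<open>Z\<close> is seen from the other extension: it is an
  extension of \<open>So X\<close> by \<open>Y\<close>.\<close>

lemma conf_pushout:
  assumes f: "f \<in> Hom C X Y" "X \<in> Z" "Y \<in> Z"
    and b: "biproduct_data C (Io X) Y M i j p q"
  obtains e m n where "conflation C Z e (j \<cdot> f \<boxplus> i \<cdot> al X) m n"
proof -
  note B = biproduct_dataD[OF b]
  have f': "f \<in> Hom C (Src C (al X)) Y" using f by simp
  obtain e1 m n e2 g' h' where 1: "extension C e1 (j \<cdot> f \<boxplus> i \<cdot> al X) m n"
    "extension C e2 (m \<cdot> j) g' h'" "Tgt C g' = So X"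
    using ext_pushout[OF conf_ext[OF sh_conf[OF f(2)]] f' biproduct_data_swap[OF b]] by blast
  have m: "m \<in> Arr C" "Src C m = M" using ext_arr[OF 1(1)] f B by auto
  have "conflation C Z e2 (m \<cdot> j) g' h'" using 1 m f B by (intro conflationI) auto
  then have "Tgt C m \<in> Z" using conf_Z(2) m B by fastforce
  then have "conflation C Z e1 (j \<cdot> f \<boxplus> i \<cdot> al X) m n" using 1 f B by (intro conflationI) auto
  then show thesis by (rule that)
qed

section \<open>Existence, rotation and morphisms of triangles in the quotient\<close>

lemma cl_add_injective:
  assumes "f \<in> Hom C A B" "u \<in> Hom C A I" "v \<in> Hom C I B" "I \<in> J"
  shows "cl (f \<boxplus> v \<cdot> u) = cl f"
proof -
  have "(f \<boxplus> v \<cdot> u) \<boxplus> \<boxminus> f = v \<cdot> u"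
    using assms(1-3) Plus_comm[of "v \<cdot> u" "\<boxminus> f"] by simp
  then show ?thesis using assms by (intro cl_eqI[of _ A B f I u v]) auto
qed

text \<open>In the quotient the component \<open>al ?X\<close> disappears and \<open>j\<close>
  becomes invertible, so the inflation into the biproduct is isomorphic to \<open>f\<close>.\<close>

lemma Td_ex:
  assumes "F \<in> Arr Q"
  shows "\<exists>G H. (F, G, H) \<in> Td"
proof -
  obtain f where f: "f \<in> Arr C" "Src C f \<in> Z" "Tgt C f \<in> Z" "F = cl f" using Q_ArrE[OF assms] by blast
  let ?X = "Src C f" and ?Y = "Tgt C f"
  obtain M i j p q where M: "M \<in> Z" "biproduct_data C (Io ?X) ?Y M i j p q"
    using Z_biproduct[OF sh_arr(9)[OF f(2)] f(3)] by blast
  note B = biproduct_dataD[OF M(2)]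
  let ?l = "j \<cdot> f \<boxplus> i \<cdot> al ?X"
  have fH: "f \<in> Hom C ?X ?Y" using f by simp
  obtain e m n where x: "conflation C Z e ?l m n" using conf_pushout[OF fH f(2,3) M(2)] by blast
  obtain p1 q1 where c: "connecting ?l m n p1 q1" using connecting_ex[OF x] by blast
  note X = ext_arr[OF conf_ext[OF x]] and O = conf_Z[OF x] and P = connectingD[OF x c]
  have l: "?l \<in> Hom C ?X M" using f B by simp
  have m: "m \<in> Hom C M (Tgt C m)" "q1 \<in> Hom C (Tgt C m) (So ?X)" using X l P by auto
  have "cl ?l = cl (j \<cdot> f)"
    using cl_add_injective[of "j \<cdot> f" ?X M "al ?X" "Io ?X" i] f B by simp
  then have "rmorphism Q SF (Idn Q ?X, cl j, Idn Q (Tgt C m)) (cl f, cl (m \<cdot> j), cl q1) (cl ?l, cl m, cl q1)"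
    using f l m B M O SQ.FAr_Idn[of ?X] by (simp add: rmorphism_def del: comp_Plus Plus_arr)
  moreover have "rdiagram Q SF (cl f) (cl (m \<cdot> j)) (cl q1)"
    using f m B O by (simp add: rdiagram_def)
  moreover have "iso_arrow Q (cl j)" using cl_biproduct_iso[OF M(2)] M f by simp
  ultimately have "(cl f, cl (m \<cdot> j), cl q1) \<in> Td"
    using Td_isoI[OF standard_Td[OF x c]] f m O Q.iso_arrow_Idn[of ?X] Q.iso_arrow_Idn[of "Tgt C m"] by simp
  then show ?thesis using f by blast
qed

text \<open>A zero object of the quotient need not be one in the original category, as injectives
  become zero. The triangle is therefore built with a genuine zero object and carried over.\<close>

lemma Td_zero:
  assumes N: "zero_object Q N" and A: "A \<in> Obj Q"
  shows "(Zer Q N A, Idn Q A, Zer Q A (FOb SF N)) \<in> Td"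
proof -
  obtain N0 where N0: "N0 \<in> Z" "zero_object C N0"
    using Z_subcategory unfolding additive_subcategory_def by blast
  have O: "A \<in> Z" "N \<in> Z" using A N by (auto simp: Q.zero_object_iff)
  have t: "(Zer C N0 A, Idn C A, Zer C A (\<Sigma>o N0)) \<in> RTri C" using RTR1_id[OF N0(2)] O by simp
  have "null_arrow C (Ome C) a" if a: "a \<in> Hom C B N0" for a B
    using arrow_to_zero_object[OF N0(2), of a] null_arrow_Zer[OF Omega_additive, of B N0]
      a Hom_objD[OF a] by simp
  then have "Omega_monic C (Ome C) (Zer C N0 A)" unfolding Omega_monic_def using O N0 by auto
  then obtain e where x0: "extension C e (Zer C N0 A) (Idn C A) (Zer C A (\<Sigma>o N0))"
    using ext_of_Omega_monic[OF t] by blast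
  have x: "conflation C Z e (Zer C N0 A) (Idn C A) (Zer C A (\<Sigma>o N0))"
    using O N0 by (intro conflationI[OF x0]) auto
  obtain p q where c: "connecting (Zer C N0 A) (Idn C A) (Zer C A (\<Sigma>o N0)) p q"
    using connecting_ex[OF x] by blast
  have q: "q \<in> Hom C A (So N0)" using connectingD[OF x c] O N0 by simp
  have zN: "zero_object Q N0" using Q_zero_object N0 by blast
  have z: "zero_object Q (FOb SF N0)" using SQ.FOb_zero_object[OF zN] .
  have cq: "cl q = Zer Q A (So N0)"
    using Q.arrow_to_zero_object[OF z, of "cl q"] q O N0 by simp
  have idN: "cl (Idn C N) = cl (Zer C N N)" "cl (Idn C N0) = cl (Zer C N0 N0)"
    using N zN by (auto simp: Q.zero_object_iff)
  have i: "iso_arrow Q (Zer Q N N0)"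
    using O N0 idN by (intro Q.iso_arrowI[of _ N N0 "Zer Q N0 N"]) auto
  have "FAr SF (Zer Q N N0) = Zer Q (So N) (So N0)" using SQ.FAr_Zer[of N N0] O N0 by simp
  then have m: "rmorphism Q SF (Zer Q N N0, Idn Q A, Idn Q A) (Zer Q N A, Idn Q A, Zer Q A (FOb SF N))
      (cl (Zer C N0 A), cl (Idn C A), cl q)"
    using O N0 cq q by (simp add: rmorphism_def)
  have "rdiagram Q SF (Zer Q N A) (Idn Q A) (Zer Q A (FOb SF N))"
    using O by (simp add: rdiagram_def)
  then show ?thesis using Td_isoI[OF standard_Td[OF x c] _ m i] O Q.iso_arrow_Idn[of A] by simp
qed

text \<open>\<alpha>_X = p f factors through the inflation \<open>l\<close> into the sum of Y and
  I_X. The octahedron with the split extension of I_X by Y yields the conflation Y -> N -> S_X, with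
  N the sum of W and I_X. It remains to identify its second arrow with \<open>q\<close> and its
  connecting arrow with -S f.\<close>

lemma standard_rotate:
  assumes x: "conflation C Z e f g h" and c: "connecting f g h p q"
  shows "(cl g, cl q, \<boxminus>\<^bsub>Q\<^esub> FAr SF (cl f)) \<in> Td"
proof -
  let ?X = "Src C f" and ?Y = "Tgt C f" and ?W = "Tgt C g"
  note X = ext_arr[OF conf_ext[OF x]] and O = conf_Z[OF x] and P = connectingD[OF x c]
  have gf: "g \<cdot> f = Zer C ?X ?W" using RT_comp_zero[OF ext_tri(1)[OF conf_ext[OF x]]] .
  obtain M i j pM qM where M: "M \<in> Z" "biproduct_data C (Io ?X) ?Y M i j pM qM"
    using Z_biproduct[OF sh_arr(9)[OF O(1)] O(2)] by blast
  obtain N i2 j2 p2 q2 where N: "N \<in> Z" "biproduct_data C (Io ?X) ?W N i2 j2 p2 q2"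
    using Z_biproduct[OF sh_arr(9)[OF O(1)] O(3)] by blast
  note B = biproduct_dataD[OF M(2)] and B2 = biproduct_dataD[OF N(2)]
  \<comment> \<open>The twist by \<open>p\<close> in the split sequence is chosen so that the
    I_X-component of \<open>l\<close> is p f = \<alpha>_X.\<close>
  define l where "l = j \<cdot> f \<boxplus> i \<cdot> p \<cdot> f"
  define m where "m = i2 \<cdot> (pM \<boxplus> \<boxminus> (p \<cdot> qM)) \<boxplus> j2 \<cdot> g \<cdot> qM"
  obtain e1 where x1: "extension C e1 l m (h \<cdot> q2)"
    unfolding l_def m_def using ext_add_split[OF conf_ext[OF x] P(1) M(2) N(2)] by blast
  obtain e0 where x0: "extension C e0 j pM (Zer C (Io ?X) (\<Sigma>o ?Y))"
    using ext_biproduct[OF biproduct_data_swap[OF M(2)]] by blast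
  have l: "l \<in> Hom C ?X M" using X P(1) B by (simp add: l_def)
  have m: "m \<in> Hom C M N" using X P(1) B B2 by (simp add: m_def)
  have pl: "pM \<cdot> l = al ?X" using X P(1) B O(1) by (simp add: l_def B(5,8)[THEN comp_eq_comp] P(3))
  have ql: "qM \<cdot> l = f" using X P(1) B by (simp add: l_def B(6,7)[THEN comp_eq_comp])
  have mi: "m \<cdot> i = i2" using X P(1) B B2 by (simp add: m_def)
  have mj: "m \<cdot> j = j2 \<cdot> g \<boxplus> i2 \<cdot> \<boxminus> p"
    using X P(1) B B2 Plus_comm[of "j2 \<cdot> g" "\<boxminus> (i2 \<cdot> p)"] by (simp add: m_def)
  have ss: "Src C l = Src C (al ?X)" "Tgt C j = Tgt C l" "Tgt C pM = Tgt C (al ?X)"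
    using l B O by auto
  obtain e2 k h' where x2: "extension C e2 (m \<cdot> j) k h'" and k: "k \<in> Hom C (Tgt C m) (So ?X)"
    and h': "h' \<in> Hom C (So ?X) (\<Sigma>o (Src C j))"
    and E: "ga ?X \<cdot> k = h \<cdot> q2" "k \<cdot> m = be ?X \<cdot> pM"
      "\<Sigma>a l \<cdot> ga ?X \<boxplus> \<Sigma>a j \<cdot> h' = Zer C (So ?X) (\<Sigma>o (Tgt C l))"
    using ext_octahedron[OF conf_ext[OF sh_conf[OF O(1)]] x1 x0 ss pl] by metis
  have k: "k \<in> Hom C N (So ?X)" and h': "h' \<in> Hom C (So ?X) (\<Sigma>o ?Y)" using k h' m B by auto
  let ?k = "m \<cdot> j"
  have kH: "?k \<in> Hom C ?Y N" using m B by simp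
  have ki2: "k \<cdot> i2 = be ?X"
    using m k B O by (simp add: mi[symmetric] E(2)[THEN comp_eq_comp])
  \<comment> \<open>Projecting the sum relation by \<open>qM\<close> isolates \<open>h'\<close>,
    since \<open>qM \<cdot> l = f\<close> and \<open>qM \<cdot> j\<close> is an identity.\<close>
  have "\<Sigma>a qM \<cdot> (\<Sigma>a l \<cdot> ga ?X \<boxplus> \<Sigma>a j \<cdot> h') = \<Sigma>a (qM \<cdot> l) \<cdot> ga ?X \<boxplus> \<Sigma>a (qM \<cdot> j) \<cdot> h'"
    using l h' B(1-4) O by simp
  also have "\<dots> = \<Sigma>a f \<cdot> ga ?X \<boxplus> h'" unfolding ql using h' B by simp
  finally have h'_eq: "\<Sigma>a f \<cdot> ga ?X \<boxplus> h' = Zer C (So ?X) (\<Sigma>o ?Y)"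
    unfolding E(3) using l B O by simp
  have fga: "\<Sigma>a f \<cdot> ga ?X = \<boxminus> h'"
    using diff_eq_Zer[of "\<Sigma>a f \<cdot> ga ?X" "\<boxminus> h'"] h'_eq X h' O by simp
  have y: "conflation C Z e2 ?k k h'" using conflationI[OF x2] kH k O by simp
  obtain p3 q3 where c3: "connecting ?k k h' p3 q3" using connecting_ex[OF y] by blast
  have P3: "p3 \<in> Hom C N (Io ?Y)" "q3 \<in> Hom C (So ?X) (So ?Y)" using connectingD[OF y c3] kH k by auto
  have kf: "?k \<cdot> f = \<boxminus> (i2 \<cdot> al ?X)"
    using X P(1) B2 O(1) gf by (simp add: mj P(3))
  \<comment> \<open>Both signs are forced: g f = 0 leaves only -p f in the first square, and
    \<open>h'\<close> is minus \<Sigma>f \<gamma>_X. Followed by the connecting morphism of the new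
    conflation, this computes S f as -q3.\<close>
  have "rmorphism C (Sig C) (f, \<boxminus> i2, \<boxminus> Idn C (So ?X)) (al ?X, be ?X, ga ?X) (?k, k, h')"
    unfolding Sg.rmorphism_iff using X O kH k h' B2 kf ki2 fga by (simp del: comp_Plus comp_assoc_arr)
  then have "rmorphism C (Sig C) (Idn C (Src C ?k) \<cdot> f, p3 \<cdot> \<boxminus> i2, q3 \<cdot> \<boxminus> Idn C (So ?X))
      (al ?X, be ?X, ga ?X) (al (Src C ?k), be (Src C ?k), ga (Src C ?k))"
    using Sg.rmorphism_comp[OF sh_diagram[OF O(1)] conf_diagram[OF y] sh_diagram] c3 conf_Z(1)[OF y]
    unfolding connecting_def by blast
  then have Sf: "FAr SF (cl f) = cl (\<boxminus> q3)"
    using SF_cl[of ?X ?Y] kH O P3 X by simp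
  \<comment> \<open>With this relation and the next one, \<open>p\<close> and
    \<open>k \<cdot> j2\<close> form a connecting morphism of the original conflation, so
    \<open>k \<cdot> j2\<close> agrees with \<open>q\<close> in the quotient.\<close>
  have kj2g: "k \<cdot> j2 \<cdot> g = be ?X \<cdot> p"
  proof -
    have "k \<cdot> m \<cdot> j = Zer C ?Y (So ?X)"
      using m k B O by (simp add: E(2)[THEN comp_eq_comp])
    then have "k \<cdot> j2 \<cdot> g \<boxplus> \<boxminus> (be ?X \<cdot> p) = Zer C ?Y (So ?X)"
      unfolding mj using X O k B2 P(1) by (simp add: ki2[THEN comp_eq_comp])
    then show ?thesis using diff_eq_Zer[of "k \<cdot> j2 \<cdot> g" "be ?X \<cdot> p"] X O k B2 P(1) by simp
  qed
  have "ga ?X \<cdot> (k \<cdot> j2) = h"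
    using X O k B2 by (simp add: E(1)[THEN comp_eq_comp])
  then have "rmorphism C (Sig C) (Idn C ?X, p, k \<cdot> j2) (f, g, h) (al ?X, be ?X, ga ?X)"
    using X O k B2 P(1,3) kj2g by (simp add: rmorphism_def)
  then have kq: "cl (k \<cdot> j2) = cl q"
    using conf_unique[OF x sh_conf[OF O(1)]] c O unfolding connecting_def by (metis sh_arr(8))
  have "cl ?k = cl (j2 \<cdot> g)"
    unfolding mj using cl_add_injective[of "j2 \<cdot> g" ?Y N "\<boxminus> p" "Io ?X" i2] X O P(1) B2 by simp
  then have r: "rmorphism Q SF (Idn Q ?Y, cl j2, Idn Q (So ?X)) (cl g, cl q, \<boxminus>\<^bsub>Q\<^esub> FAr SF (cl f)) (cl ?k, cl k, cl q3)"
    unfolding SQ.rmorphism_iff Sf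
    using X O N kH k P(2) P3 B2 kq SQ.FAr_Idn[of ?Y] by (simp del: comp_assoc_arr)
  have "rdiagram Q SF (cl g) (cl q) (\<boxminus>\<^bsub>Q\<^esub> FAr SF (cl f))"
    unfolding Sf using X O P(2) P3 by (simp add: rdiagram_def)
  then show ?thesis
    using Td_isoI[OF standard_Td[OF y c3] _ r] cl_biproduct_iso(1)[OF N(2)] N O
      Q.iso_arrow_Idn[of ?Y] Q.iso_arrow_Idn[of "So ?X"] by simp
qed

lemma Td_rotate:
  assumes "(u, v, w) \<in> Td"
  shows "(v, w, \<boxminus>\<^bsub>Q\<^esub> FAr SF u) \<in> Td"
proof -
  obtain e f g h p q a b c where x: "conflation C Z e f g h" "connecting f g h p q"
    and m: "rmorphism Q SF (a, b, c) (u, v, w) (cl f, cl g, cl q)"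
    "iso_arrow Q a" "iso_arrow Q b" "iso_arrow Q c"
    using TdE[OF assms] by blast
  note d = Td_diagram[OF assms] standard_diagram[OF x]
  have "rdiagram Q SF v w (\<boxminus>\<^bsub>Q\<^esub> FAr SF u)" using d(1) by (simp add: rdiagram_def)
  then show ?thesis
    using Td_isoI[OF standard_rotate[OF x] _ SQ.rmorphism_rotate[OF d m(1)] m(3,4)]
      SQ.FAr_iso_arrow[OF m(2)] by blast
qed

text \<open>The square commutes only up to v u through an injective. Extending \<open>u\<close>
  along the inflation \<open>f\<close> allows a correction of the representative of \<open>b\<close>
  within its class, after which (RTR3) applies.\<close>

lemma standard_complete:
  assumes x: "conflation C Z e f g h" "connecting f g h p q"
    and x': "conflation C Z e' f' g' h'" "connecting f' g' h' p' q'"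
    and ab: "a \<in> Hom Q (Src C f) (Src C f')" "b \<in> Hom Q (Tgt C f) (Tgt C f')"
      "b \<cdot>\<^bsub>Q\<^esub> cl f = cl f' \<cdot>\<^bsub>Q\<^esub> a"
  shows "\<exists>c. rmorphism Q SF (a, b, c) (cl f, cl g, cl q) (cl f', cl g', cl q')"
proof -
  note X = ext_arr[OF conf_ext[OF x(1)]] ext_arr[OF conf_ext[OF x'(1)]]
  obtain a0 where a0: "a0 \<in> Hom C (Src C f) (Src C f')" "a = cl a0" using Q_HomE[OF ab(1)] by blast
  obtain b0 where b0: "b0 \<in> Hom C (Tgt C f) (Tgt C f')" "b = cl b0" using Q_HomE[OF ab(2)] by blast
  have "cl (b0 \<cdot> f) = cl (f' \<cdot> a0)" using ab(3) a0 b0 X by simp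
  then obtain W u v where uv: "W \<in> J" "u \<in> Hom C (Src C f) W" "v \<in> Hom C W (Tgt C f')"
    "b0 \<cdot> f \<boxplus> \<boxminus> (f' \<cdot> a0) = v \<cdot> u"
    using cl_eqE[of "b0 \<cdot> f" "f' \<cdot> a0" "Src C f" "Tgt C f'"] a0 b0 X by auto
  obtain u' where u': "u' \<in> Hom C (Tgt C f) W" "u' \<cdot> f = u" using injective_extend[OF x(1) uv(1,2)] by blast
  define b1 where "b1 = b0 \<boxplus> v \<cdot> \<boxminus> u'"
  have b1: "b1 \<in> Hom C (Tgt C f) (Tgt C f')" using b0 uv u' by (simp add: b1_def)
  have cb: "cl b1 = cl b0"
    unfolding b1_def using cl_add_injective[of b0 "Tgt C f" "Tgt C f'" "\<boxminus> u'" W v] b0 uv u' by simp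
  have "b0 \<cdot> f = f' \<cdot> a0 \<boxplus> v \<cdot> u"
    using a0 b0 X uv by (intro diff_eqD[of _ "Src C f" "Tgt C f'"]) auto
  then have "b1 \<cdot> f = f' \<cdot> a0"
    using a0(1) b0(1) uv(2,3) u' X by (simp add: b1_def)
  then obtain c where "rmorphism C (Sig C) (a0, b1, c) (f, g, h) (f', g', h')"
    using RTR3[OF ext_tri(1)[OF conf_ext[OF x(1)]] ext_tri(1)[OF conf_ext[OF x'(1)]] a0(1) b1] by blast
  then show ?thesis using standard_morphism[OF x x'] cb a0 b0 by metis
qed

text \<open>The square is conjugated to one between standard triangles, completed there, and
  conjugated back.\<close>

lemma Td_morphism:
  assumes t: "(f, g, h) \<in> Td" "(f', g', h') \<in> Td"
    and ab: "a \<in> Hom Q (Src Q f) (Src Q f')" "b \<in> Hom Q (Tgt Q f) (Tgt Q f')" "b \<cdot>\<^bsub>Q\<^esub> f = f' \<cdot>\<^bsub>Q\<^esub> a"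
  shows "\<exists>c. rmorphism Q SF (a, b, c) (f, g, h) (f', g', h')"
proof -
  obtain e0 f0 g0 h0 p0 q0 x y z where x0: "conflation C Z e0 f0 g0 h0" "connecting f0 g0 h0 p0 q0"
    and m: "rmorphism Q SF (x, y, z) (f, g, h) (cl f0, cl g0, cl q0)"
    "iso_arrow Q x" "iso_arrow Q y" "iso_arrow Q z"
    using TdE[OF t(1)] by blast
  obtain e1 f1 g1 h1 p1 q1 x' y' z' where x1: "conflation C Z e1 f1 g1 h1" "connecting f1 g1 h1 p1 q1"
    and m': "rmorphism Q SF (x', y', z') (f', g', h') (cl f1, cl g1, cl q1)"
    "iso_arrow Q x'" "iso_arrow Q y'" "iso_arrow Q z'"
    using TdE[OF t(2)] by blast
  note d = Td_diagram[OF t(1)] standard_diagram[OF x0] and d' = Td_diagram[OF t(2)] standard_diagram[OF x1]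
  note T = d[unfolded rdiagram_def] d'[unfolded rdiagram_def]
  note X = ext_arr[OF conf_ext[OF x0(1)]] ext_arr[OF conf_ext[OF x1(1)]]
  obtain xi yi zi where i: "rmorphism Q SF (xi, yi, zi) (cl f0, cl g0, cl q0) (f, g, h)"
    "xi \<cdot>\<^bsub>Q\<^esub> x = Idn Q (Src Q f)" "yi \<cdot>\<^bsub>Q\<^esub> y = Idn Q (Tgt Q f)"
    using SQ.rmorphism_isoE[OF d m] by metis
  obtain xj yj zj where i': "rmorphism Q SF (xj, yj, zj) (cl f1, cl g1, cl q1) (f', g', h')"
    "xj \<cdot>\<^bsub>Q\<^esub> x' = Idn Q (Src Q f')" "yj \<cdot>\<^bsub>Q\<^esub> y' = Idn Q (Tgt Q f')"
    using SQ.rmorphism_isoE[OF d' m'] by metis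
  have H: "x \<in> Hom Q (Src Q f) (Src C f0)" "y \<in> Hom Q (Tgt Q f) (Tgt C f0)"
    "x' \<in> Hom Q (Src Q f') (Src C f1)" "y' \<in> Hom Q (Tgt Q f') (Tgt C f1)"
    "xi \<in> Hom Q (Src C f0) (Src Q f)" "yi \<in> Hom Q (Tgt C f0) (Tgt Q f)"
    "xj \<in> Hom Q (Src C f1) (Src Q f')" "yj \<in> Hom Q (Tgt C f1) (Tgt Q f')"
    and E: "y' \<cdot>\<^bsub>Q\<^esub> f' = cl f1 \<cdot>\<^bsub>Q\<^esub> x'" "yi \<cdot>\<^bsub>Q\<^esub> cl f0 = f \<cdot>\<^bsub>Q\<^esub> xi"
    using m(1) m'(1) i(1) i'(1) X unfolding SQ.rmorphism_iff by auto
  have "(y' \<cdot>\<^bsub>Q\<^esub> b \<cdot>\<^bsub>Q\<^esub> yi) \<cdot>\<^bsub>Q\<^esub> cl f0 = cl f1 \<cdot>\<^bsub>Q\<^esub> (x' \<cdot>\<^bsub>Q\<^esub> a \<cdot>\<^bsub>Q\<^esub> xi)"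
    using H ab(1,2) T X
    by (simp add: E(2) ab(3)[THEN Q.comp_eq_comp] E(1)[THEN Q.comp_eq_comp] del: Q_Comp)
  then obtain c where c: "rmorphism Q SF (x' \<cdot>\<^bsub>Q\<^esub> a \<cdot>\<^bsub>Q\<^esub> xi, y' \<cdot>\<^bsub>Q\<^esub> b \<cdot>\<^bsub>Q\<^esub> yi, c)
      (cl f0, cl g0, cl q0) (cl f1, cl g1, cl q1)"
    using standard_complete[OF x0 x1, of "x' \<cdot>\<^bsub>Q\<^esub> a \<cdot>\<^bsub>Q\<^esub> xi" "y' \<cdot>\<^bsub>Q\<^esub> b \<cdot>\<^bsub>Q\<^esub> yi"]
      H ab(1,2) by auto
  have "rmorphism Q SF (xj \<cdot>\<^bsub>Q\<^esub> (x' \<cdot>\<^bsub>Q\<^esub> a \<cdot>\<^bsub>Q\<^esub> xi) \<cdot>\<^bsub>Q\<^esub> x, yj \<cdot>\<^bsub>Q\<^esub> (y' \<cdot>\<^bsub>Q\<^esub> b \<cdot>\<^bsub>Q\<^esub> yi) \<cdot>\<^bsub>Q\<^esub> y,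
      zj \<cdot>\<^bsub>Q\<^esub> c \<cdot>\<^bsub>Q\<^esub> z) (f, g, h) (f', g', h')"
    using SQ.rmorphism_comp[OF d(1) d'(2,1) SQ.rmorphism_comp[OF d d'(2) m(1) c] i'(1)] .
  moreover have "xj \<cdot>\<^bsub>Q\<^esub> (x' \<cdot>\<^bsub>Q\<^esub> a \<cdot>\<^bsub>Q\<^esub> xi) \<cdot>\<^bsub>Q\<^esub> x = a"
    using H ab(1) by (simp add: i(2) i'(2)[THEN Q.comp_eq_comp] del: Q_Comp Q_Idn)
  moreover have "yj \<cdot>\<^bsub>Q\<^esub> (y' \<cdot>\<^bsub>Q\<^esub> b \<cdot>\<^bsub>Q\<^esub> yi) \<cdot>\<^bsub>Q\<^esub> y = b"
    using H ab(2) by (simp add: i(3) i'(3)[THEN Q.comp_eq_comp] del: Q_Comp Q_Idn)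
  ultimately show ?thesis by metis
qed

section \<open>The octahedral axiom in the quotient\<close>

sublocale TQ: pre_right_triangulation Q SF Td
  by unfold_locales (fact SF_additive Td_diagram Td_iso_closed Td_zero Td_ex Td_rotate Td_morphism)+


text \<open>The strictly commutative case. The arrows \<open>g'\<close> and \<open>h'\<close> come
  from the octahedron of extensions; two of the equations are the last squares of the morphisms
  given by \<open>(1, m, g)\<close> and \<open>(1, m', g')\<close>.\<close>

lemma standard_octahedron:
  assumes x1: "conflation C Z e f g h" "connecting f g h pf qf"
    and x2: "conflation C Z e1 l m n" "connecting l m n pl ql"
    and x3: "conflation C Z e2 l' m' n'" "connecting l' m' n' pl' ql'"
    and s: "Src C l = Src C f" "Tgt C l' = Tgt C l" "Tgt C m' = Tgt C f" "m' \<cdot> l = f"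
  shows "\<exists>G \<in> Hom Q (Tgt Q (cl m)) (Tgt Q (cl g)). \<exists>H \<in> Hom Q (Tgt Q (cl g)) (FOb SF (Src Q (cl l'))).
        H \<cdot>\<^bsub>Q\<^esub> cl g = cl ql' \<and> cl qf \<cdot>\<^bsub>Q\<^esub> G = cl ql \<and> G \<cdot>\<^bsub>Q\<^esub> cl m = cl g \<cdot>\<^bsub>Q\<^esub> cl m' \<and>
        FAr SF (cl l) \<cdot>\<^bsub>Q\<^esub> cl qf \<boxplus>\<^bsub>Q\<^esub> FAr SF (cl l') \<cdot>\<^bsub>Q\<^esub> H = Zer Q (Tgt Q (cl g)) (FOb SF (Tgt Q (cl l))) \<and>
        (cl m \<cdot>\<^bsub>Q\<^esub> cl l', G, H) \<in> Td"
proof -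
  note X = ext_arr[OF conf_ext[OF x1(1)]] ext_arr[OF conf_ext[OF x2(1)]] ext_arr[OF conf_ext[OF x3(1)]] s(1-3)
  note O = conf_Z[OF x1(1)] conf_Z[OF x2(1)] conf_Z[OF x3(1)]
  let ?M = "Tgt C l"
  obtain e3 g' h' where y0: "extension C e3 (m \<cdot> l') g' h'"
    and g': "g' \<in> Hom C (Tgt C m) (Tgt C g)" and h': "h' \<in> Hom C (Tgt C g) (\<Sigma>o (Src C l'))"
    and E: "h' \<cdot> g = n'" "h \<cdot> g' = n" "g' \<cdot> m = g \<cdot> m'"
      "\<Sigma>a l \<cdot> h \<boxplus> \<Sigma>a l' \<cdot> h' = Zer C (Tgt C g) (\<Sigma>o (Tgt C l))"
    using ext_octahedron[OF conf_ext[OF x1(1)] conf_ext[OF x2(1)] conf_ext[OF x3(1)] s] by metis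
  have y: "conflation C Z e3 (m \<cdot> l') g' h'" using X O g' by (intro conflationI[OF y0]) auto
  obtain p3 q3 where c: "connecting (m \<cdot> l') g' h' p3 q3" using connecting_ex[OF y] by blast
  note P = connectingD[OF x1] connectingD(2)[OF x2] connectingD(2)[OF x3]
  have q3: "q3 \<in> Hom C (Tgt C g) (So (Src C l'))" using connectingD(2)[OF y c] X g' by simp
  have "rmorphism C (Sig C) (Idn C (Src C l'), m, g) (l', m', n') (m \<cdot> l', g', h')"
    using X O g' E by (simp add: rmorphism_def)
  then have "FAr SF (cl (Idn C (Src C l'))) \<cdot>\<^bsub>Q\<^esub> cl ql' = cl q3 \<cdot>\<^bsub>Q\<^esub> cl g"
    using standard_morphism[OF x3 y c] unfolding SQ.rmorphism_iff by blast
  then have 1: "cl q3 \<cdot>\<^bsub>Q\<^esub> cl g = cl ql'" using X O P(7) SQ.FAr_Idn[of "Src C l'"] by simp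
  have "rmorphism C (Sig C) (Idn C (Src C l), m', g') (l, m, n) (f, g, h)"
    using X O g' E s(4) by (simp add: rmorphism_def)
  then have "FAr SF (cl (Idn C (Src C l))) \<cdot>\<^bsub>Q\<^esub> cl ql = cl qf \<cdot>\<^bsub>Q\<^esub> cl g'"
    using standard_morphism[OF x2 x1] unfolding SQ.rmorphism_iff by blast
  then have 2: "cl qf \<cdot>\<^bsub>Q\<^esub> cl g' = cl ql" using X O P(6) SQ.FAr_Idn[of "Src C l"] by simp
  have lH: "l \<in> Hom C (Src C f) ?M" "l' \<in> Hom C (Src C l') ?M" using X by auto
  note S = SF_cl_S[OF lH(1) O(1,5)] SF_cl_S[OF lH(2) O(7,5)]
  \<comment> \<open>The two summands of the sum relation, represented as third components of
    morphisms into the chosen conflation of \<open>?M\<close>.\<close>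
  have r1: "rmorphism C (Sig C) (l, sh_I s l \<cdot> pf, sh_S s l \<cdot> qf) (f, g, h) (al ?M, be ?M, ga ?M)"
    using Sg.rmorphism_comp[OF conf_diagram[OF x1(1)] sh_diagram[OF O(1)] sh_diagram[OF O(5)]
        x1(2)[unfolded connecting_def] sh_mor[OF lH(1) O(1,5)]] X by simp
  have ml: "Src C (m \<cdot> l') = Src C l'" using X by simp
  have r2: "rmorphism C (Sig C) (l', sh_I s l' \<cdot> p3, sh_S s l' \<cdot> q3) (m \<cdot> l', g', h') (al ?M, be ?M, ga ?M)"
    using Sg.rmorphism_comp[OF conf_diagram[OF y] sh_diagram[OF O(7)] sh_diagram[OF O(5)]
        c[unfolded connecting_def ml] sh_mor[OF lH(2) O(7,5)]] X by simp
  obtain t where t: "t \<in> Hom C (Tgt C g) (Io ?M)" "sh_S s l \<cdot> qf \<boxplus> sh_S s l' \<cdot> q3 = be ?M \<cdot> t"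
    using ext_octahedron_sum[OF ac1 conf_ext[OF x1(1)] conf_ext[OF x2(1)] conf_ext[OF x3(1)] y0 s
        g' E(3) h' E(1,4) conf_ext[OF sh_conf[OF O(5)]] _ r1 r2] O by auto
  have "cl (sh_S s l \<cdot> qf \<boxplus> sh_S s l' \<cdot> q3) = cl (Zer C (Tgt C g) (So ?M))"
    unfolding t(2) using t(1) O by (intro cl_eqI[of _ "Tgt C g" "So ?M" _ "Io ?M" t "be ?M"]) auto
  then have 3: "FAr SF (cl l) \<cdot>\<^bsub>Q\<^esub> cl qf \<boxplus>\<^bsub>Q\<^esub> FAr SF (cl l') \<cdot>\<^bsub>Q\<^esub> cl q3 = cl (Zer C (Tgt C g) (So ?M))"
    using S P q3 by simp
  have 4: "cl g' \<cdot>\<^bsub>Q\<^esub> cl m = cl g \<cdot>\<^bsub>Q\<^esub> cl m'" using X g' E(3) by simp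
  have 5: "(cl m \<cdot>\<^bsub>Q\<^esub> cl l', cl g', cl q3) \<in> Td" using standard_Td[OF y c] X by simp
  have "cl g' \<in> Hom Q (Tgt Q (cl m)) (Tgt Q (cl g))" using X O g' by simp
  moreover have "cl q3 \<in> Hom Q (Tgt Q (cl g)) (FOb SF (Src Q (cl l')))" using X O q3 by simp
  moreover have "Zer Q (Tgt Q (cl g)) (FOb SF (Tgt Q (cl l))) = cl (Zer C (Tgt C g) (So ?M))"
    using X by simp
  ultimately show ?thesis using 1 2 3 4 5 by metis
qed

text \<open>Only the third triangle is taken from the data. The other two are rebuilt around a
  representative \<open>k\<close> of \<open>\<mu> \<cdot> L\<close>, with an added component
  \<open>al ?A\<close> that makes them start with inflations; \<open>octahedron_transfer\<close>
  compares them with the given ones.\<close>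

lemma Td_octahedron:
  assumes t: "(F, G, H) \<in> Td" "(L, M, N) \<in> Td" "(L', M', N') \<in> Td"
    and s: "Src Q L = Src Q F" "Tgt Q L' = Tgt Q L" "Tgt Q M' = Tgt Q F" "M' \<cdot>\<^bsub>Q\<^esub> L = F"
  shows "\<exists>G' \<in> Hom Q (Tgt Q M) (Tgt Q G). \<exists>H' \<in> Hom Q (Tgt Q G) (FOb SF (Src Q L')).
        H' \<cdot>\<^bsub>Q\<^esub> G = N' \<and> H \<cdot>\<^bsub>Q\<^esub> G' = N \<and> G' \<cdot>\<^bsub>Q\<^esub> M = G \<cdot>\<^bsub>Q\<^esub> M' \<and>
        FAr SF L \<cdot>\<^bsub>Q\<^esub> H \<boxplus>\<^bsub>Q\<^esub> FAr SF L' \<cdot>\<^bsub>Q\<^esub> H' = Zer Q (Tgt Q G) (FOb SF (Tgt Q L)) \<and>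
        (M \<cdot>\<^bsub>Q\<^esub> L', G', H') \<in> Td"
proof -
  note T = TQ.RT_arr[OF t(1)] TQ.RT_arr[OF t(2)] TQ.RT_arr[OF t(3)] s(1-3)
  let ?A = "Src Q F"
  have A: "?A \<in> Z" using T Q.arr_obj(1)[of F] by simp
  let ?I = "Io ?A"
  obtain e0 l0 m0 h0 p0 q0 a' \<mu> b where x0: "conflation C Z e0 l0 m0 h0" "connecting l0 m0 h0 p0 q0"
    and r: "rmorphism Q SF (a', \<mu>, b) (L', M', N') (cl l0, cl m0, cl q0)"
      "iso_arrow Q a'" "iso_arrow Q \<mu>" "iso_arrow Q b"
    using TdE[OF t(3)] by blast
  note X0 = ext_arr[OF conf_ext[OF x0(1)]] and O0 = conf_Z[OF x0(1)] and P0 = connectingD[OF x0]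
  let ?M0 = "Tgt C l0" and ?B0 = "Tgt C m0"
  have H: "a' \<in> Hom Q (Src Q L') (Src C l0)" "\<mu> \<in> Hom Q (Tgt Q L) ?M0" "b \<in> Hom Q (Tgt Q F) ?B0"
    and E: "\<mu> \<cdot>\<^bsub>Q\<^esub> L' = cl l0 \<cdot>\<^bsub>Q\<^esub> a'" "b \<cdot>\<^bsub>Q\<^esub> M' = cl m0 \<cdot>\<^bsub>Q\<^esub> \<mu>"
      "FAr SF a' \<cdot>\<^bsub>Q\<^esub> N' = cl q0 \<cdot>\<^bsub>Q\<^esub> b"
    using r(1) T X0 unfolding SQ.rmorphism_iff by auto
  have "\<mu> \<cdot>\<^bsub>Q\<^esub> L \<in> Hom Q ?A ?M0" using H T by simp
  then obtain k where k: "k \<in> Hom C ?A ?M0" "\<mu> \<cdot>\<^bsub>Q\<^esub> L = cl k" using Q_HomE by metis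
  obtain M1 i j p q where M1: "M1 \<in> Z" "biproduct_data C ?I ?M0 M1 i j p q"
    using Z_biproduct[OF sh_arr(9)[OF A] O0(2)] by blast
  obtain B1 i2 j2 p2 q2 where B1: "B1 \<in> Z" "biproduct_data C ?I ?B0 B1 i2 j2 p2 q2"
    using Z_biproduct[OF sh_arr(9)[OF A] O0(3)] by blast
  note B = biproduct_dataD[OF M1(2)] and B2 = biproduct_dataD[OF B1(2)]
  define l' where "l' = j \<cdot> l0"
  \<comment> \<open>\<open>m0\<close> plus the identity of the injective: it sends the components
    \<open>k\<close> and \<open>al ?A\<close> of \<open>l\<close> to the components
    \<open>m0 \<cdot> k\<close> and \<open>al ?A\<close> of \<open>f\<close>, so
    \<open>m' \<cdot> l = f\<close> holds before passing to the quotient.\<close>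
  define m' where "m' = i2 \<cdot> p \<boxplus> j2 \<cdot> m0 \<cdot> q"
  define l where "l = j \<cdot> k \<boxplus> i \<cdot> al ?A"
  define f where "f = j2 \<cdot> (m0 \<cdot> k) \<boxplus> i2 \<cdot> al ?A"
  have h: "l' \<in> Hom C (Src C l0) M1" "m' \<in> Hom C M1 B1" "l \<in> Hom C ?A M1" "f \<in> Hom C ?A B1"
    using X0 B B2 k A by (auto simp: l'_def m'_def l_def f_def)
  have m'j: "m' \<cdot> j = j2 \<cdot> m0" using X0 B B2 by (simp add: m'_def)
  have m'l: "m' \<cdot> l = f"
  proof -
    have m'i: "m' \<cdot> i = i2" using X0 B B2 by (simp add: m'_def)
    show ?thesis
      unfolding l_def f_def using X0 B(1-4) B2(1-4) k(1) A h(2)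
      by (simp add: m'j[THEN comp_eq_comp] m'i[THEN comp_eq_comp])
  qed
  \<comment> \<open>The untwisted case: the split sequence of the injective is added to the standard
    representative of the third triangle.\<close>
  have zr: "Zer C ?M0 ?I \<in> Hom C ?M0 ?I" using O0 A by simp
  obtain e2 where "extension C e2 l' m' (h0 \<cdot> q2)"
    using ext_add_split[OF conf_ext[OF x0(1)] zr M1(2) B1(2)] X0 B B2 by (auto simp: l'_def m'_def)
  then have x3: "conflation C Z e2 l' m' (h0 \<cdot> q2)" using h O0 B1(1) by (intro conflationI) auto
  obtain pl' ql' where c3: "connecting l' m' (h0 \<cdot> q2) pl' ql'" using connecting_ex[OF x3] by blast
  obtain e1 m n where x2: "conflation C Z e1 l m n"
    unfolding l_def using conf_pushout[OF k(1) A O0(2) M1(2)] by blast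
  obtain pl ql where c2: "connecting l m n pl ql" using connecting_ex[OF x2] by blast
  have mk: "m0 \<cdot> k \<in> Hom C ?A ?B0" using X0 k by simp
  obtain e g hh where x1: "conflation C Z e f g hh"
    unfolding f_def using conf_pushout[OF mk A O0(3) B1(2)] by blast
  obtain pf qf where c1: "connecting f g hh pf qf" using connecting_ex[OF x1] by blast
  have ss: "Src C l = Src C f" "Tgt C l' = Tgt C l" "Tgt C m' = Tgt C f" using h by auto
  note oct = standard_octahedron[OF x1 c1 x2 c2 x3 c3 ss m'l]
  have ql': "ql' \<in> Hom C B1 (So (Src C l0))" using connectingD(2)[OF x3 c3] h by simp
  let ?\<mu> = "cl j \<cdot>\<^bsub>Q\<^esub> \<mu>" and ?b = "cl j2 \<cdot>\<^bsub>Q\<^esub> b"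
  have cj: "cl j \<in> Hom Q ?M0 M1" "cl j2 \<in> Hom Q ?B0 B1" using B B2 M1 B1 O0 by auto
  have \<mu>H: "?\<mu> \<in> Hom Q (Tgt Q L) M1" and bH: "?b \<in> Hom Q (Tgt Q F) B1" using cj H by auto
  have \<mu>i: "iso_arrow Q ?\<mu>"
    using Q.iso_arrow_comp[OF H(2) cj(1) r(3)] cl_biproduct_iso(1)[OF M1(2)] A O0 M1 by simp
  have bi: "iso_arrow Q ?b"
    using Q.iso_arrow_comp[OF H(3) cj(2) r(4)] cl_biproduct_iso(1)[OF B1(2)] A O0 B1 by simp
  have "cl l = cl (j \<cdot> k)"
    unfolding l_def using cl_add_injective[of "j \<cdot> k" ?A M1 "al ?A" ?I i] A B k(1) by simp
  then have sq: "?\<mu> \<cdot>\<^bsub>Q\<^esub> L = cl l \<cdot>\<^bsub>Q\<^esub> Idn Q ?A"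
    using H(2) T cj B k h A by simp
  have "rmorphism C (Sig C) (Idn C (Src C l0), j, j2) (l0, m0, h0) (l', m', h0 \<cdot> q2)"
    unfolding Sg.rmorphism_iff using X0 B(2,11) B2 h m'j by (simp add: l'_def)
  then have "FAr SF (cl (Idn C (Src C l0))) \<cdot>\<^bsub>Q\<^esub> cl q0 = cl ql' \<cdot>\<^bsub>Q\<^esub> cl j2"
    using standard_morphism[OF x0 x3 c3] unfolding SQ.rmorphism_iff by blast
  then have qj: "cl ql' \<cdot>\<^bsub>Q\<^esub> cl j2 = cl q0"
    using X0 O0 P0(2) SQ.FAr_Idn[of "Src C l0"] by simp
  have rr: "rmorphism Q SF (a', ?\<mu>, ?b) (L', M', N') (cl l', cl m', cl ql')"
  proof -
    have 1: "?\<mu> \<cdot>\<^bsub>Q\<^esub> L' = cl l' \<cdot>\<^bsub>Q\<^esub> a'"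
    proof -
      have "?\<mu> \<cdot>\<^bsub>Q\<^esub> L' = cl j \<cdot>\<^bsub>Q\<^esub> (cl l0 \<cdot>\<^bsub>Q\<^esub> a')" using H cj T by (simp add: E(1))
      also have "\<dots> = (cl j \<cdot>\<^bsub>Q\<^esub> cl l0) \<cdot>\<^bsub>Q\<^esub> a'"
        using H cj X0 O0 by (intro Q.comp_assoc_arr[symmetric]) auto
      finally show ?thesis using X0 B by (simp add: l'_def)
    qed
    have 2: "?b \<cdot>\<^bsub>Q\<^esub> M' = cl m' \<cdot>\<^bsub>Q\<^esub> ?\<mu>"
    proof -
      have "?b \<cdot>\<^bsub>Q\<^esub> M' = cl j2 \<cdot>\<^bsub>Q\<^esub> (cl m0 \<cdot>\<^bsub>Q\<^esub> \<mu>)" using H cj T by (simp add: E(2))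
      also have "\<dots> = (cl j2 \<cdot>\<^bsub>Q\<^esub> cl m0) \<cdot>\<^bsub>Q\<^esub> \<mu>"
        using H cj X0 O0 by (intro Q.comp_assoc_arr[symmetric]) auto
      also have "\<dots> = (cl m' \<cdot>\<^bsub>Q\<^esub> cl j) \<cdot>\<^bsub>Q\<^esub> \<mu>" using X0 B B2 h m'j by simp
      also have "\<dots> = cl m' \<cdot>\<^bsub>Q\<^esub> ?\<mu>"
        using H cj h M1 B1 by (intro Q.comp_assoc_arr) auto
      finally show ?thesis .
    qed
    have 3: "FAr SF a' \<cdot>\<^bsub>Q\<^esub> N' = cl ql' \<cdot>\<^bsub>Q\<^esub> ?b"
    proof -
      have "FAr SF a' \<cdot>\<^bsub>Q\<^esub> N' = (cl ql' \<cdot>\<^bsub>Q\<^esub> cl j2) \<cdot>\<^bsub>Q\<^esub> b" by (simp only: E(3) qj)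
      also have "\<dots> = cl ql' \<cdot>\<^bsub>Q\<^esub> ?b"
        using H cj ql' B1 O0 by (intro Q.comp_assoc_arr) auto
      finally show ?thesis .
    qed
    show ?thesis unfolding SQ.rmorphism_iff using 1 2 3 H \<mu>H bH T h by simp
  qed
  have idA: "Idn Q ?A \<in> Hom Q (Src Q F) (Src Q (cl f))" "iso_arrow Q (Idn Q ?A)"
    using A h Q.iso_arrow_Idn[of ?A] by auto
  have \<mu>H': "?\<mu> \<in> Hom Q (Tgt Q L) (Tgt Q (cl l))" using \<mu>H h by simp
  have ssQ: "Src Q (cl l) = Src Q (cl f)" "Tgt Q (cl l') = Tgt Q (cl l)" "Tgt Q (cl m') = Tgt Q (cl f)"
      "cl m' \<cdot>\<^bsub>Q\<^esub> cl l = cl f"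
    using h m'l by auto
  show ?thesis
    by (rule TQ.octahedron_transfer[OF t s standard_Td[OF x1 c1] standard_Td[OF x2 c2]
          standard_Td[OF x3 c3] ssQ idA \<mu>H' \<mu>i sq rr r(2) bi oct])
qed

theorem quotient_triangulated: "triangulated_category Q SF Td"
proof -
  interpret stable_right_triangulation Q SF Td
  proof unfold_locales
    show "\<exists>A\<in>Obj Q. isomorphic Q (FOb SF A) B" if "B \<in> Obj Q" for B
      using SF_essentially_surjective that by simp
    show "\<exists>f\<in>Hom Q A B. FAr SF f = k" if "A \<in> Obj Q" "B \<in> Obj Q" "k \<in> Hom Q (FOb SF A) (FOb SF B)" for A B k
      using SF_full that by (simp del: Q.Hom_iff)
    show "f = Zer Q A B" if "f \<in> Hom Q A B" "FAr SF f = Zer Q (FOb SF A) (FOb SF B)" for f A B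
      using SF_faithful that by (simp del: Q.Hom_iff)
  qed (fact SF_additive Td_diagram Td_iso_closed Td_zero Td_ex Td_rotate Td_morphism Td_octahedron)+
  show ?thesis by (rule triangulated)
qed

end

theorem theorem6p17:
  fixes C :: "('o, 'm) pt_cat" and Z :: "'o set"
  assumes "pseudo_triangulated C"
    and "AC1 C" and "AC2 C"
    and "additive_subcategory C Z" and "extension_closed C Z"
  shows "(\<forall>D. additive_subcategory C D \<and> D \<subseteq> Z \<and> summand_closed C Z D \<and> frobenius C Z D \<longrightarrow>
            (\<exists>s. shift_choice C Z D s) \<and>
            (\<forall>s. shift_choice C Z D s \<longrightarrow>
               triangulated_category (quotient_category C Z (injectives C Z D))
                 (shift_functor C Z D s) (distinguished_triangles C Z D s))) \<and>
         (frobenius C Z Z \<longrightarrow>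
            (\<exists>s. shift_choice C Z Z s) \<and>
            (\<forall>s. shift_choice C Z Z s \<longrightarrow>
               triangulated_category (quotient_category C Z (injectives C Z Z))
                 (shift_functor C Z Z s) (distinguished_triangles C Z Z s)))"
proof -
  have main: "(\<exists>s. shift_choice C Z D s) \<and>
      (\<forall>s. shift_choice C Z D s \<longrightarrow>
         triangulated_category (quotient_category C Z (injectives C Z D))
           (shift_functor C Z D s) (distinguished_triangles C Z D s))"
    if "additive_subcategory C D" "D \<subseteq> Z" "frobenius C Z D" for D
  proof -
    interpret pseudo_triangulated C by (rule assms(1))
    interpret frobenius_setting C Z D
      by unfold_locales (fact assms that)+
    show ?thesis
    proof (intro conjI allI impI)
      show "\<exists>s. shift_choice C Z D s" by (rule ex_shift_choice)
      fix s assume "shift_choice C Z D s"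
      then interpret shift_setting C Z D s by unfold_locales
      show "triangulated_category (quotient_category C Z (injectives C Z D))
          (shift_functor C Z D s) (distinguished_triangles C Z D s)"
        by (rule quotient_triangulated)
    qed
  qed
  show ?thesis
  proof (intro conjI[where P = "\<forall>D. _ D"] allI impI)
    show "(\<exists>s. shift_choice C Z D s) \<and> (\<forall>s. shift_choice C Z D s \<longrightarrow>
         triangulated_category (quotient_category C Z (injectives C Z D))
           (shift_functor C Z D s) (distinguished_triangles C Z D s))"
      if "additive_subcategory C D \<and> D \<subseteq> Z \<and> summand_closed C Z D \<and> frobenius C Z D" for D
      using main that by blast
    show "(\<exists>s. shift_choice C Z Z s) \<and> (\<forall>s. shift_choice C Z Z s \<longrightarrow>
         triangulated_category (quotient_category C Z (injectives C Z Z))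
           (shift_functor C Z Z s) (distinguished_triangles C Z Z s))"
      if "frobenius C Z Z"
      using main[OF assms(4) order_refl that] .
  qed
qed


end
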